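(* Two minimal interval exchange systems (IES) with ido are flow equivalent if and only if they admit cylinder-induced systems which are topologically conjugate.
   Context: A system $(X,S)$ is a non-empty compact metric space with a homeomorphism; it is minimal if every orbit is dense. Topological conjugacy of $(X,S)$ and $(Y,T)$ means existence of a homeomorphism $h:X\to Y$ with $hS=Th$. Interval exchanges. Let $\mathcal{A}=\{1,\dots,d\}$, $\pi$ a permutation of $\mathcal{A}$, $\lambda\in\mathbb{R}_{>0}^{\mathcal{A}}$, $\alpha_0=0$, $\alpha_k=\sum_{j\le k}\lambda_j$, $I_k=(\alpha_{k-1},\alpha_k]$. The interval exchange transformation (IET) $T:(\alpha_0,\alpha_d]\to(\alpha_0,\alpha_d]$ with this data permutes the intervals $I_k$ by translations according to $\pi$: for $x\in I_k$, $T(x)=x+\sum_{l>k,\,\pi(l)<\pi(k)}\lambda_l-\sum_{l<k,\,\pi(l)>\pi(k)}\lambda_l$. Its symbolic encoding is the subshift $X\subset\mathcal{A}^{\mathbb{Z}}$ (with the shift $\sigma$) that is the closure of the set of itineraries $(l_j)_{j\in\mathbb{Z}}$, $T^j(x)\in I_{l_j}$, of points $x$ outside the orbits of the discontinuities $\alpha_k$. Such a subshift is an interval exchange system (IES). $T$ has ido (Keane's infinite distinct orbit condition) if the past orbits $\{T^{-n}(\alpha_k):n\in\mathbb{N}\}$ of the internal discontinuities ($1\le k\le d-1$) are infinite and pairwise disjoint; an IES has ido if it is the encoding of an IET with ido. The two IES may be on different alphabets. Cylinder-induced systems. A cylinder of a subshift $X\subset \mathcal{A}^{\mathbb{Z}}$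 is a non-empty set $C=\{x\in X: x_kx_{k+1}\cdots x_{k+n-1}=w\}$ for some $k\in\mathbb{Z}$, $n\ge1$ and $w\in\mathcal{A}^n$. If $X$ is minimal, the first return map $\sigma_C:C\to C$, $\sigma_C(x)=\sigma^{r(x)}(x)$ with $r(x)=\min\{i>0:\sigma^i(x)\in C\}$, is a well-defined homeomorphism; $(C,\sigma_C)$ is called a cylinder-induced system of $(X,\sigma)$. Flow equivalence. The suspension of $(X,S)$ is $\Sigma_SX=(X\times\mathbb{R})/\mathbb{Z}$, where $n\cdot(x,s)=(S^n(x),s-n)$, with flow $(x,s)\mapsto(x,s+s')$. Two systems are flow equivalent if there is a homeomorphism between their suspensions mapping flow orbits onto flow orbits and preserving their orientation. *)

theory Defs
  imports "HOL-Analysis.Analysis" "HOL-Combinatorics.Permutations"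
begin

section \<open>Systems, minimality, conjugacy\<close>

text \<open>A system is a carrier set \<open>X\<close> in an ambient topological space together with a map \<open>S\<close>, of
  which only the values on \<open>X\<close> matter. Only the topology of the metric is used, so the metric is
  rendered as metrizability of the subspace \<open>X\<close>.\<close>

definition dyn_system :: "'a::topological_space set \<Rightarrow> ('a \<Rightarrow> 'a) \<Rightarrow> bool" where
  "dyn_system X S \<longleftrightarrow>
     X \<noteq> {} \<and> compact X \<and> metrizable_space (top_of_set X) \<and> (\<exists>S'. homeomorphism X X S S')"

text \<open>Integer powers of a bijection of the set \<open>X\<close> onto itself.\<close>

definition int_iterate :: "'a set \<Rightarrow> ('a \<Rightarrow> 'a) \<Rightarrow> int \<Rightarrow> 'a \<Rightarrow> 'a" where
  "int_iterate X S n = (if n \<ge> 0 then S ^^ nat n else inv_into X S ^^ nat (- n))"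

definition two_sided_orbit :: "'a set \<Rightarrow> ('a \<Rightarrow> 'a) \<Rightarrow> 'a \<Rightarrow> 'a set" where
  "two_sided_orbit X S x = range (\<lambda>n. int_iterate X S n x)"

definition minimal_system :: "'a::topological_space set \<Rightarrow> ('a \<Rightarrow> 'a) \<Rightarrow> bool" where
  "minimal_system X S \<longleftrightarrow>
     dyn_system X S \<and> (\<forall>x\<in>X. X \<subseteq> closure (two_sided_orbit X S x))"

definition topologically_conjugate ::
    "'a::topological_space set \<Rightarrow> ('a \<Rightarrow> 'a) \<Rightarrow> 'b::topological_space set \<Rightarrow> ('b \<Rightarrow> 'b) \<Rightarrow> bool" where
  "topologically_conjugate X S Y T \<longleftrightarrow>
     (\<exists>h h'. homeomorphism X Y h h' \<and> (\<forall>x\<in>X. h (S x) = T (h x)))"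


section \<open>Suspensions and flow equivalence\<close>

definition quotient_topology :: "'a topology \<Rightarrow> ('a \<Rightarrow> 'b) \<Rightarrow> 'b topology" where
  "quotient_topology X q =
     topology (\<lambda>U. U \<subseteq> q ` topspace X \<and> openin X {x \<in> topspace X. q x \<in> U})"

lemma openin_quotient_topology:
  "openin (quotient_topology X q) U \<longleftrightarrow>
     U \<subseteq> q ` topspace X \<and> openin X {x \<in> topspace X. q x \<in> U}"
proof -
  have "istopology (\<lambda>U. U \<subseteq> q ` topspace X \<and> openin X {x \<in> topspace X. q x \<in> U})"
    unfolding istopology_def
  proof (intro conjI allI impI)
    fix S T
    assume S: "S \<subseteq> q ` topspace X \<and> openin X {x \<in> topspace X. q x \<in> S}"
      and T: "T \<subseteq> q ` topspace X \<and> openin X {x \<in> topspace X. q x \<in> T}"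
    show "S \<inter> T \<subseteq> q ` topspace X" using S by blast
    have "{x \<in> topspace X. q x \<in> S \<inter> T} =
        {x \<in> topspace X. q x \<in> S} \<inter> {x \<in> topspace X. q x \<in> T}" by blast
    moreover have "openin X ({x \<in> topspace X. q x \<in> S} \<inter> {x \<in> topspace X. q x \<in> T})"
      using S[THEN conjunct2] T[THEN conjunct2] by (rule openin_Int)
    ultimately show "openin X {x \<in> topspace X. q x \<in> S \<inter> T}" by (rule ssubst)
  next
    fix K
    assume K: "\<forall>U\<in>K. U \<subseteq> q ` topspace X \<and> openin X {x \<in> topspace X. q x \<in> U}"
    show "\<Union>K \<subseteq> q ` topspace X" using K by blast
    have "{x \<in> topspace X. q x \<in> \<Union>K} = (\<Union>U\<in>K. {x \<in> topspace X. q x \<in> U})" by blast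
    moreover have "openin X (\<Union>U\<in>K. {x \<in> topspace X. q x \<in> U})"
      using K by (intro openin_Union) blast
    ultimately show "openin X {x \<in> topspace X. q x \<in> \<Union>K}" by (rule ssubst)
  qed
  then show ?thesis unfolding quotient_topology_def by (subst topology_inverse') (assumption, rule refl)
qed

lemma topspace_quotient_topology: "topspace (quotient_topology X q) = q ` topspace X"
proof -
  have "{x \<in> topspace X. q x \<in> q ` topspace X} = topspace X" by auto
  then have "openin (quotient_topology X q) (q ` topspace X)"
    by (simp only: openin_quotient_topology subset_refl openin_topspace simp_thms)
  then have "q ` topspace X \<subseteq> topspace (quotient_topology X q)"
    by (rule openin_subset)
  moreover have "topspace (quotient_topology X q) \<subseteq> q ` topspace X"
    using openin_topspace[of "quotient_topology X q"]
    unfolding openin_quotient_topology by (rule conjunct1)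
  ultimately show ?thesis by (rule subset_antisym[rotated])
qed

lemma quotient_map_quotient_topology: "quotient_map X (quotient_topology X q) q"
  unfolding quotient_map_def topspace_quotient_topology openin_quotient_topology by simp

text \<open>The orbit equivalence relation of the action \<open>n \<cdot> (x, s) = (S\<^sup>n x, s - n)\<close> of the integers
  on \<open>X \<times> \<real>\<close>.\<close>

definition suspension_rel :: "'a set \<Rightarrow> ('a \<Rightarrow> 'a) \<Rightarrow> (('a \<times> real) \<times> ('a \<times> real)) set" where
  "suspension_rel X S =
     {((x, s), (int_iterate X S n x, s - of_int n)) | x s n. x \<in> X}"

definition suspension :: "'a::topological_space set \<Rightarrow> ('a \<Rightarrow> 'a) \<Rightarrow> ('a \<times> real) set topology" where
  "suspension X S =
     quotient_topology (top_of_set (X \<times> UNIV)) (\<lambda>p. suspension_rel X S `` {p})"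

text \<open>Points of the suspension are equivalence classes, and translation in the real coordinate
  maps classes to classes.\<close>

definition suspension_flow :: "real \<Rightarrow> ('a \<times> real) set \<Rightarrow> ('a \<times> real) set" where
  "suspension_flow t c = (\<lambda>(x, s). (x, s + t)) ` c"

definition flow_orbit :: "('a \<times> real) set \<Rightarrow> ('a \<times> real) set set" where
  "flow_orbit c = range (\<lambda>t. suspension_flow t c)"

text \<open>Along each flow line, \<open>h\<close> preserves the orientation when it is given by a continuous,
  strictly increasing change of time \<open>\<phi>\<close>; this also covers periodic orbits, where \<open>\<phi>\<close> is a lift
  of the induced map between circles.\<close>

definition flow_equivalent ::
    "'a::topological_space set \<Rightarrow> ('a \<Rightarrow> 'a) \<Rightarrow> 'b::topological_space set \<Rightarrow> ('b \<Rightarrow> 'b) \<Rightarrow> bool" where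
  "flow_equivalent X S Y T \<longleftrightarrow>
     (\<exists>h. homeomorphic_map (suspension X S) (suspension Y T) h \<and>
        (\<forall>c \<in> topspace (suspension X S).
           h ` flow_orbit c = flow_orbit (h c) \<and>
           (\<exists>\<phi>. continuous_on UNIV \<phi> \<and> strict_mono \<phi> \<and>
              (\<forall>t. h (suspension_flow t c) = suspension_flow (\<phi> t) (h c)))))"


section \<open>Interval exchange transformations\<close>

definition iet_data :: "nat \<Rightarrow> (nat \<Rightarrow> nat) \<Rightarrow> (nat \<Rightarrow> real) \<Rightarrow> bool" where
  "iet_data d \<pi> lam \<longleftrightarrow> d \<ge> 1 \<and> \<pi> permutes {1..d} \<and> (\<forall>k\<in>{1..d}. lam k > 0)"

definition iet_alpha :: "(nat \<Rightarrow> real) \<Rightarrow> nat \<Rightarrow> real" where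
  "iet_alpha lam k = (\<Sum>j = 1..k. lam j)"

definition iet_domain :: "nat \<Rightarrow> (nat \<Rightarrow> real) \<Rightarrow> real set" where
  "iet_domain d lam = {iet_alpha lam 0 <.. iet_alpha lam d}"

definition iet_interval :: "(nat \<Rightarrow> real) \<Rightarrow> nat \<Rightarrow> real set" where
  "iet_interval lam k = {iet_alpha lam (k - 1) <.. iet_alpha lam k}"

definition iet :: "nat \<Rightarrow> (nat \<Rightarrow> nat) \<Rightarrow> (nat \<Rightarrow> real) \<Rightarrow> real \<Rightarrow> real" where
  "iet d \<pi> lam x =
     (let k = (THE k. k \<in> {1..d} \<and> x \<in> iet_interval lam k)
      in x + (\<Sum>l | l \<in> {1..d} \<and> l > k \<and> \<pi> l < \<pi> k. lam l)
           - (\<Sum>l | l \<in> {1..d} \<and> l < k \<and> \<pi> l > \<pi> k. lam l))"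

abbreviation iet_power :: "nat \<Rightarrow> (nat \<Rightarrow> nat) \<Rightarrow> (nat \<Rightarrow> real) \<Rightarrow> int \<Rightarrow> real \<Rightarrow> real" where
  "iet_power d \<pi> lam \<equiv> int_iterate (iet_domain d lam) (iet d \<pi> lam)"

definition iet_past_orbit :: "nat \<Rightarrow> (nat \<Rightarrow> nat) \<Rightarrow> (nat \<Rightarrow> real) \<Rightarrow> nat \<Rightarrow> real set" where
  "iet_past_orbit d \<pi> lam k = range (\<lambda>n::nat. iet_power d \<pi> lam (- int n) (iet_alpha lam k))"

definition iet_ido :: "nat \<Rightarrow> (nat \<Rightarrow> nat) \<Rightarrow> (nat \<Rightarrow> real) \<Rightarrow> bool" where
  "iet_ido d \<pi> lam \<longleftrightarrow>
     (\<forall>k\<in>{1..d-1}. infinite (iet_past_orbit d \<pi> lam k)) \<and>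
     (\<forall>k\<in>{1..d-1}. \<forall>k'\<in>{1..d-1}. k \<noteq> k' \<longrightarrow>
        iet_past_orbit d \<pi> lam k \<inter> iet_past_orbit d \<pi> lam k' = {})"


section \<open>Interval exchange systems\<close>

text \<open>All alphabets are subsets of \<open>nat\<close>, so bi-infinite words have type \<open>int \<Rightarrow> nat\<close>; the
  topology of this type is the product topology of the discrete topology on \<open>nat\<close>.\<close>

definition shift :: "(int \<Rightarrow> nat) \<Rightarrow> int \<Rightarrow> nat" where
  "shift x = (\<lambda>j. x (j + 1))"

definition iet_itineraries :: "nat \<Rightarrow> (nat \<Rightarrow> nat) \<Rightarrow> (nat \<Rightarrow> real) \<Rightarrow> (int \<Rightarrow> nat) set" where
  "iet_itineraries d \<pi> lam =
     {l. \<exists>x \<in> iet_domain d lam.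
           (\<forall>k\<in>{1..d-1}.
              x \<notin> two_sided_orbit (iet_domain d lam) (iet d \<pi> lam) (iet_alpha lam k)) \<and>
           (\<forall>j. l j \<in> {1..d} \<and> iet_power d \<pi> lam j x \<in> iet_interval lam (l j))}"

definition iet_encoding :: "nat \<Rightarrow> (nat \<Rightarrow> nat) \<Rightarrow> (nat \<Rightarrow> real) \<Rightarrow> (int \<Rightarrow> nat) set" where
  "iet_encoding d \<pi> lam = closure (iet_itineraries d \<pi> lam)"

definition interval_exchange_system_ido :: "(int \<Rightarrow> nat) set \<Rightarrow> bool" where
  "interval_exchange_system_ido X \<longleftrightarrow>
     (\<exists>d \<pi> lam. iet_data d \<pi> lam \<and> iet_ido d \<pi> lam \<and> X = iet_encoding d \<pi> lam)"


section \<open>Cylinder-induced systems\<close>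

text \<open>Since cylinders are non-empty, the word \<open>w\<close> is automatically over the alphabet of \<open>X\<close>.\<close>

definition cylinder :: "(int \<Rightarrow> nat) set \<Rightarrow> (int \<Rightarrow> nat) set \<Rightarrow> bool" where
  "cylinder X C \<longleftrightarrow> C \<noteq> {} \<and>
     (\<exists>k w. w \<noteq> [] \<and> C = {x \<in> X. map (\<lambda>i. x (k + int i)) [0..<length w] = w})"

definition return_time :: "('a \<Rightarrow> 'a) \<Rightarrow> 'a set \<Rightarrow> 'a \<Rightarrow> nat" where
  "return_time S C x = (LEAST i. i > 0 \<and> (S ^^ i) x \<in> C)"

definition first_return :: "('a \<Rightarrow> 'a) \<Rightarrow> 'a set \<Rightarrow> 'a \<Rightarrow> 'a" where
  "first_return S C x = (S ^^ return_time S C x) x"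

end

theory Submission
  imports Defs
begin

text \<open>Given a flow equivalence, flow boxes transport a small clopen set \<open>U\<close> of \<open>X\<close> to a clopen set of
  \<open>Y\<close> by a homeomorphism \<open>\<psi>\<close> that conjugates the induced maps on \<open>C\<close> and \<open>\<psi> ` C\<close> for every clopen
  \<open>C \<subseteq> U\<close> (Parry and Sullivan). To arrange that both sets are cylinders, consider on \<open>C\<close>
  the relation of having the same first \<open>N\<close> return blocks in the past and in the future. Up to bounded
  changes of \<open>N\<close>, its classes are cylinders, and \<open>\<psi>\<close> carries them to the corresponding classes in
  \<open>Y\<close>. Hence a class that does not split when \<open>N\<close> grows by a suitable constant is a cylinder with a
  cylinder as image. Such a class exists, since an interval exchange of \<open>d\<close> intervals has at most
  \<open>n * d + 1\<close> words of length \<open>n\<close>, whereas constant splitting would produce exponentially many.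

  Conversely, a conjugacy between induced maps extends to the suspensions: the flow segment between
  two consecutive visits to \<open>C\<close> is mapped affinely onto the corresponding segment for \<open>D\<close>.\<close>

section \<open>Integer iterates\<close>

text \<open>A flow equivalence sends a small cylinder to a clopen set, that is, to a finite union of
  cylinders, and shrinking the cylinder need not improve this. Ordinary coordinates cannot be
  compared across the equivalence, because the return times on the two sides are unrelated. Return
  blocks can: \<open>\<psi>\<close> commutes with the induced maps and is a homeomorphism between
  compact sets of sequences, so each return block of the image depends on boundedly many return
  blocks of the source, and conversely. Within one class the blocks occupy a fixed window of
  coordinates, so the class is a cylinder up to the bounded context needed to recognise visits to
  the section. The constant that a class has to survive is the sum of four such bounds: one each for
  \<open>\<psi>\<close> and its inverse, and one for recognising visits on either side. A second
  obstacle is that the time change along a flow line might a priori have bounded range; visits on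
  the two sides can be matched only after this is excluded.\<close>

lemma int_iterate_0 [simp]: "int_iterate A f 0 x = x"
  by (simp add: int_iterate_def)

lemma int_iterate_of_nat: "int_iterate A f (int n) = f ^^ n"
  by (simp add: int_iterate_def)

lemma int_iterate_1 [simp]: "int_iterate A f 1 = f"
  by (simp add: int_iterate_def)

lemma int_iterate_Suc:
  assumes "bij_betw f A A" "x \<in> A"
  shows "int_iterate A f n x \<in> A \<and> f (int_iterate A f n x) = int_iterate A f (n + 1) x"
proof -
  have fA: "f z \<in> A" if "z \<in> A" for z using that assms(1) by (auto simp: bij_betw_def)
  have gA: "inv_into A f z \<in> A" "f (inv_into A f z) = z" if "z \<in> A" for z
    using bij_betw_inv_into[OF assms(1)] bij_betw_inv_into_right[OF assms(1)] that
    by (simp_all add: bij_betwE)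
  have 1: "(f ^^ k) x \<in> A" for k by (induction k) (auto simp: fA assms(2))
  have 2: "(inv_into A f ^^ k) x \<in> A" for k by (induction k) (auto simp: gA assms(2))
  show ?thesis
  proof (cases n rule: int_cases2)
    case (nonneg k)
    have "int_iterate A f n x = (f ^^ k) x" "int_iterate A f (n + 1) x = (f ^^ Suc k) x"
      using int_iterate_of_nat[of A f k] int_iterate_of_nat[of A f "Suc k"] nonneg
      by (simp_all add: add.commute)
    then show ?thesis using 1[of k] by simp
  next
    case (nonpos k)
    show ?thesis
    proof (cases k)
      case 0
      then show ?thesis using nonpos fA[OF assms(2)] assms(2) by simp
    next
      case (Suc j)
      have "int_iterate A f n x = (inv_into A f ^^ Suc j) x"
        using nonpos Suc by (simp add: int_iterate_def nat_add_distrib)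
      moreover have "int_iterate A f (n + 1) x = (inv_into A f ^^ j) x"
        using nonpos Suc by (cases "j = 0") (simp_all add: int_iterate_def)
      ultimately show ?thesis using gA[OF 2[of j]] by simp
    qed
  qed
qed

lemma int_iterate_in: "bij_betw f A A \<Longrightarrow> x \<in> A \<Longrightarrow> int_iterate A f n x \<in> A"
  by (rule int_iterate_Suc[THEN conjunct1])

lemma int_iterate_add:
  assumes "bij_betw f A A" "x \<in> A"
  shows "int_iterate A f (m + n) x = int_iterate A f m (int_iterate A f n x)"
proof (induction m rule: int_induct[where k = 0])
  case base
  then show ?case by simp
next
  case (step1 i)
  have "int_iterate A f (i + 1 + n) x = f (int_iterate A f (i + n) x)"
    using int_iterate_Suc[OF assms, of "i + n"] by (simp add: algebra_simps)
  also have "\<dots> = int_iterate A f (i + 1) (int_iterate A f n x)"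
    using int_iterate_Suc[OF assms(1) int_iterate_in[OF assms], of i n] step1 by simp
  finally show ?case .
next
  case (step2 i)
  have inj: "inj_on f A" using assms(1) by (simp add: bij_betw_def)
  have "f (int_iterate A f (i - 1 + n) x) = int_iterate A f (i + n) x"
    using int_iterate_Suc[OF assms, of "i - 1 + n"] by (simp add: algebra_simps)
  moreover have "f (int_iterate A f (i - 1) (int_iterate A f n x)) = int_iterate A f i (int_iterate A f n x)"
    using int_iterate_Suc[OF assms(1) int_iterate_in[OF assms], of "i - 1" n] by simp
  ultimately have "f (int_iterate A f (i - 1 + n) x) = f (int_iterate A f (i - 1) (int_iterate A f n x))"
    using step2 by simp
  then show ?case
    by (rule inj_onD[OF inj]) (intro int_iterate_in assms)+
qed

text \<open>The indefinite sum over the integers: zero at 0, with increment \<open>f n\<close> from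
  \<open>n\<close> to \<open>n + 1\<close> on both sides of 0. It serves for accumulated return
  times and for time changes with prescribed slopes.\<close>

definition int_sum :: "(int \<Rightarrow> 'a::ab_group_add) \<Rightarrow> int \<Rightarrow> 'a" where
  "int_sum f n = sum f {0..<n} - sum f {n..<0}"

lemma int_sum_0 [simp]: "int_sum f 0 = 0"
  by (simp add: int_sum_def)

lemma int_sum_Suc: "int_sum f (n + 1) = int_sum f n + f n"
proof (cases "n \<ge> 0")
  case True
  then have "{0..<n + 1} = insert n {0..<n}" by auto
  then show ?thesis using True by (simp add: int_sum_def)
next
  case False
  then have "{n..<0} = insert n {n + 1..<0}" by auto
  then show ?thesis using False by (simp add: int_sum_def)
qed

lemma int_sum_lower:
  fixes f :: "int \<Rightarrow> 'a::linordered_idom"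
  assumes "m \<le> n" and "\<And>i. m \<le> i \<Longrightarrow> i < n \<Longrightarrow> l \<le> f i"
  shows "of_int (n - m) * l \<le> int_sum f n - int_sum f m"
  using assms
proof (induction n rule: int_ge_induct)
  case base
  then show ?case by simp
next
  case (step i)
  then have "l \<le> f i" "of_int (i - m) * l \<le> int_sum f i - int_sum f m" by auto
  then show ?case using int_sum_Suc[of f i] by (simp add: algebra_simps)
qed

lemma int_sum_upper:
  fixes f :: "int \<Rightarrow> 'a::linordered_idom"
  assumes "m \<le> n" and "\<And>i. m \<le> i \<Longrightarrow> i < n \<Longrightarrow> f i \<le> l"
  shows "int_sum f n - int_sum f m \<le> of_int (n - m) * l"
  using assms
proof (induction n rule: int_ge_induct)
  case base
  then show ?case by simp
next
  case (step i)
  then have "f i \<le> l" "int_sum f i - int_sum f m \<le> of_int (i - m) * l" by auto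
  then show ?case using int_sum_Suc[of f i] by (simp add: algebra_simps)
qed

section \<open>Suspensions\<close>

definition susp_class :: "'a set \<Rightarrow> ('a \<Rightarrow> 'a) \<Rightarrow> 'a \<times> real \<Rightarrow> ('a \<times> real) set" where
  "susp_class X S p = suspension_rel X S `` {p}"

lemma suspension_eq: "suspension X S = quotient_topology (top_of_set (X \<times> UNIV)) (susp_class X S)"
  by (simp add: suspension_def susp_class_def[abs_def])

locale homeo_system =
  fixes X :: "'a::topological_space set" and S :: "'a \<Rightarrow> 'a"
  assumes homeo: "\<exists>S'. homeomorphism X X S S'"
begin

abbreviation "q \<equiv> susp_class X S"
abbreviation "It \<equiv> int_iterate X S"

lemma bij: "bij_betw S X X"
proof -
  obtain S' where S': "homeomorphism X X S S'" using homeo by blast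
  show ?thesis
    using homeomorphism_image1[OF S'] homeomorphism_image2[OF S']
      homeomorphism_apply1[OF S'] homeomorphism_apply2[OF S']
    by (intro bij_betw_byWitness[where f' = S']) auto
qed

lemma It_in: "x \<in> X \<Longrightarrow> It n x \<in> X"
  by (rule int_iterate_in[OF bij])

lemma It_add: "x \<in> X \<Longrightarrow> It (m + n) x = It m (It n x)"
  by (rule int_iterate_add[OF bij])

lemma It_neg:
  assumes x: "x \<in> X" shows "It (- n) (It n x) = x" "It n (It (- n) x) = x"
  using It_add[OF x, of "- n" n, symmetric] It_add[OF x, of n "- n", symmetric] by simp_all


lemma It_Suc:
  assumes x: "x \<in> X" shows "It (n + 1) x = S (It n x)" "It (n + 1) x = It n (S x)"
  using int_iterate_Suc[OF bij x, of n] It_add[OF x, of n 1] by simp_all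

lemma cont_It: "continuous_on X (It n)"
proof -
  obtain S' where S': "homeomorphism X X S S'" using homeo by blast
  have S: "continuous_on X S" "S ` X \<subseteq> X"
    using homeomorphism_cont1[OF S'] homeomorphism_image1[OF S'] by simp_all
  \<comment> \<open>Negative powers are built from \<open>inv_into X S\<close>, which inherits
    continuity from \<open>S'\<close> because the two agree on \<open>X\<close>.\<close>
  have "inv_into X S z = S' z" if "z \<in> X" for z
  proof -
    have "S' z \<in> X" "S (S' z) = z"
      using homeomorphism_image2[OF S'] homeomorphism_apply2[OF S'] that by blast+
    then show ?thesis using bij_betw_inv_into_left[OF bij, of "S' z"] by simp
  qed
  then have I: "continuous_on X (inv_into X S)" "inv_into X S ` X \<subseteq> X"
    using homeomorphism_cont2[OF S'] homeomorphism_image2[OF S'] by (simp_all cong: continuous_on_cong image_cong)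
  have *: "continuous_on X (f ^^ k) \<and> (f ^^ k) ` X \<subseteq> X"
    if "continuous_on X f" "f ` X \<subseteq> X" for f :: "'a \<Rightarrow> 'a" and k
  proof (induction k)
    case 0
    then show ?case by (simp add: continuous_on_id')
  next
    case (Suc k)
    then have "continuous_on X (f \<circ> (f ^^ k))"
      using that by (intro continuous_on_compose) (auto intro: continuous_on_subset)
    moreover have "(f ^^ Suc k) ` X \<subseteq> X" using Suc that by auto
    ultimately show ?case by simp
  qed
  show ?thesis using *[OF S] *[OF I] by (simp add: int_iterate_def)
qed

lemma class_mem: "x \<in> X \<Longrightarrow> p \<in> q (x, s) \<longleftrightarrow> (\<exists>n. p = (It n x, s - of_int n))"
  by (auto simp: suspension_rel_def susp_class_def)

lemma class_shift:
  assumes "x \<in> X" shows "q (It n x, s) = q (x, s + of_int n)"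
proof -
  have "p \<in> q (It n x, s) \<longleftrightarrow> p \<in> q (x, s + of_int n)" for p
  proof -
    have "p \<in> q (It n x, s) \<longleftrightarrow> (\<exists>m. p = (It (m + n) x, s + of_int n - of_int (m + n)))"
      using assms by (simp add: class_mem It_in It_add)
    also have "\<dots> \<longleftrightarrow> (\<exists>m. p = (It m x, s + of_int n - of_int m))"
    proof
      assume "\<exists>m. p = (It m x, s + of_int n - of_int m)"
      then obtain m where "p = (It m x, s + of_int n - of_int m)" by blast
      then have "p = (It ((m - n) + n) x, s + of_int n - of_int ((m - n) + n))" by simp
      then show "\<exists>m. p = (It (m + n) x, s + of_int n - of_int (m + n))" by blast
    qed blast
    finally show ?thesis using assms by (simp add: class_mem)
  qed
  then show ?thesis by blast
qed

lemma class_eq_iff: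
  assumes "x \<in> X" "x' \<in> X"
  shows "q (x, s) = q (x', s') \<longleftrightarrow> (\<exists>n. x' = It n x \<and> s' = s - of_int n)"
proof
  assume "q (x, s) = q (x', s')"
  moreover have "(x', s') \<in> q (x', s')" using class_mem[OF assms(2)] by (metis diff_0_right int_iterate_0 of_int_0)
  ultimately have "(x', s') \<in> q (x, s)" by simp
  then show "\<exists>n. x' = It n x \<and> s' = s - of_int n" using class_mem[OF assms(1)] by auto
next
  assume "\<exists>n. x' = It n x \<and> s' = s - of_int n"
  then show "q (x, s) = q (x', s')" using class_shift[OF assms(1)] by auto
qed

lemma flow_class [simp]:
  assumes "x \<in> X" shows "suspension_flow t (q (x, s)) = q (x, s + t)"
proof -
  have "q (x, s) = range (\<lambda>n. (It n x, s - of_int n))" for s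
    using class_mem[OF assms] by blast
  then show ?thesis by (simp add: suspension_flow_def image_image algebra_simps)
qed

lemma topspace_susp: "topspace (suspension X S) = q ` (X \<times> UNIV)"
  by (simp add: suspension_eq topspace_quotient_topology)

lemma class_in_topspace [simp]: "x \<in> X \<Longrightarrow> q (x, s) \<in> topspace (suspension X S)"
  by (simp add: topspace_susp)

lemma topspace_suspE:
  assumes "c \<in> topspace (suspension X S)"
  obtains x s where "x \<in> X" "c = q (x, s)"
  using assms by (auto simp: topspace_susp)

lemma quotient_map_class: "quotient_map (top_of_set (X \<times> UNIV)) (suspension X S) q"
  unfolding suspension_eq by (rule quotient_map_quotient_topology)

lemma continuous_class: "continuous_map (top_of_set (X \<times> UNIV)) (suspension X S) q"
  by (rule quotient_imp_continuous_map[OF quotient_map_class])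

lemma continuous_from_susp:
  "continuous_map (suspension X S) Z f \<longleftrightarrow> continuous_map (top_of_set (X \<times> UNIV)) Z (f \<circ> q)"
  using continuous_compose_quotient_map_eq[OF quotient_map_class] by blast

text \<open>The quotient by an action of homeomorphisms is open, because the saturation of
  \<open>W\<close> is the union of its translates.\<close>

lemma open_class:
  assumes "openin (top_of_set (X \<times> UNIV)) W"
  shows "openin (suspension X S) (q ` W)"
proof -
  have W: "W \<subseteq> X \<times> UNIV" using openin_imp_subset[OF assms] .
  let ?a = "\<lambda>n (p::'a \<times> real). (It n (fst p), snd p - of_int n)"
  have "{p \<in> X \<times> UNIV. q p \<in> q ` W} = (\<Union>n. {p \<in> X \<times> UNIV. ?a n p \<in> W})"
  proof (intro equalityI subsetI)
    fix p assume "p \<in> {p \<in> X \<times> UNIV. q p \<in> q ` W}"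
    then obtain x s x' s' where *: "p = (x, s)" "x \<in> X" "(x', s') \<in> W" "q (x, s) = q (x', s')" by auto
    then have "x' \<in> X" using W by auto
    then obtain n where "x' = It n x" "s' = s - of_int n" using * class_eq_iff by blast
    then show "p \<in> (\<Union>n. {p \<in> X \<times> UNIV. ?a n p \<in> W})" using * by auto
  next
    fix p assume "p \<in> (\<Union>n. {p \<in> X \<times> UNIV. ?a n p \<in> W})"
    then obtain x s n where *: "p = (x, s)" "x \<in> X" "(It n x, s - of_int n) \<in> W" by auto
    then have "q (x, s) = q (It n x, s - of_int n)" using class_shift by auto
    then show "p \<in> {p \<in> X \<times> UNIV. q p \<in> q ` W}" using * by auto
  qed
  moreover have "openin (top_of_set (X \<times> UNIV)) {p \<in> X \<times> UNIV. ?a n p \<in> W}" for n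
  proof -
    have "continuous_on (X \<times> UNIV) (?a n)"
      by (intro continuous_on_Pair continuous_on_compose2[OF cont_It] continuous_on_diff
          continuous_on_fst continuous_on_snd continuous_on_const continuous_on_id) auto
    moreover have "?a n ` (X \<times> UNIV) \<subseteq> X \<times> UNIV" using It_in by auto
    ultimately have "continuous_map (top_of_set (X \<times> UNIV)) (top_of_set (X \<times> UNIV)) (?a n)"
      by (simp add: image_subset_iff_funcset)
    from openin_continuous_map_preimage[OF this assms] show ?thesis by simp
  qed
  ultimately have "openin (top_of_set (X \<times> UNIV)) {p \<in> X \<times> UNIV. q p \<in> q ` W}"
    by (simp only:) (rule openin_Union, blast)
  then show ?thesis
    using W unfolding suspension_eq openin_quotient_topology by (simp add: image_mono)
qed

text \<open>Meaningful only for maps that are invariant under the action of the integers; see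
  \<open>lift_class\<close>.\<close>

definition lift :: "('a \<times> real \<Rightarrow> 'b) \<Rightarrow> ('a \<times> real) set \<Rightarrow> 'b" where
  "lift g c = g (SOME p. p \<in> X \<times> UNIV \<and> q p = c)"

lemma lift_class:
  assumes inv: "\<And>x n s. x \<in> X \<Longrightarrow> g (It n x, s) = g (x, s + of_int n)" and x: "x \<in> X"
  shows "lift g (q (x, s)) = g (x, s)"
proof -
  let ?P = "\<lambda>p. p \<in> X \<times> UNIV \<and> q p = q (x, s)"
  have "?P (SOME p. ?P p)" by (rule someI[of ?P "(x, s)"]) (use x in simp)
  then obtain x' s' where *: "(SOME p. ?P p) = (x', s')" "x' \<in> X" "q (x, s) = q (x', s')"
    by (metis (no_types, lifting) mem_Sigma_iff surj_pair)
  then obtain n where "x' = It n x" "s' = s - of_int n" using class_eq_iff x by blast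
  then have "g (x', s') = g (x, s)" using inv x by simp
  then show ?thesis using * by (simp add: lift_def)
qed

lemma continuous_lift:
  assumes "\<And>x n s. x \<in> X \<Longrightarrow> g (It n x, s) = g (x, s + of_int n)"
    and g: "continuous_map (top_of_set (X \<times> UNIV)) Z g"
  shows "continuous_map (suspension X S) Z (lift g)"
  unfolding continuous_from_susp
  by (rule continuous_map_eq[OF g]) (clarsimp simp: lift_class[OF assms(1)])

end

section \<open>Clopen sections and first return maps\<close>

text \<open>Continuity for the discrete topology on the values, expressed through fibres so that
  numbers, words, pairs and truth values can all be used without a topology of their own.\<close>

definition loc_const :: "'a::topological_space set \<Rightarrow> ('a \<Rightarrow> 'b) \<Rightarrow> bool" where
  "loc_const X f \<longleftrightarrow> (\<forall>v. openin (top_of_set X) {x \<in> X. f x = v})"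

lemma openin_finite_conj:
  assumes "finite F" "\<And>j. j \<in> F \<Longrightarrow> openin (top_of_set X) {x \<in> X. P j x}"
  shows "openin (top_of_set X) {x \<in> X. \<forall>j\<in>F. P j x}"
  using assms
proof (induction F)
  case empty
  then show ?case by simp
next
  case (insert a F)
  have "{x \<in> X. \<forall>j\<in>insert a F. P j x} = {x \<in> X. P a x} \<inter> {x \<in> X. \<forall>j\<in>F. P j x}" by auto
  then show ?case using insert by auto
qed

text \<open>A formula with a discrete parameter \<open>e\<close> may be checked with the parameter
  frozen, since the sets on which it is constant are open. This handles all maps below whose
  formulas contain entry or return times.\<close>

lemma loc_const_paste:
  assumes e: "loc_const X e"
    and f: "\<And>k. continuous_map (top_of_set ({x \<in> X. e x = k} \<times> U)) Z (f k)"
  shows "continuous_map (top_of_set (X \<times> U)) Z (\<lambda>p. f (e (fst p)) p)"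
proof (rule pasting_lemma[where I = UNIV and T = "\<lambda>k. {x \<in> X. e x = k} \<times> U" and f = f])
  show "openin (top_of_set (X \<times> U)) ({x \<in> X. e x = k} \<times> U)" for k
    using e by (auto simp: loc_const_def intro: openin_Times)
  show "continuous_map (subtopology (top_of_set (X \<times> U)) ({x \<in> X. e x = k} \<times> U)) Z (f k)" for k
  proof -
    have "X \<times> U \<inter> {x \<in> X. e x = k} \<times> U = {x \<in> X. e x = k} \<times> U" by auto
    then show ?thesis using f[of k] by (simp add: subtopology_subtopology)
  qed
qed auto

lemma loc_const_pair: "loc_const X f \<Longrightarrow> loc_const X g \<Longrightarrow> loc_const X (\<lambda>x. (f x, g x))"
  unfolding loc_const_def
proof
  fix v :: "'b \<times> 'c"
  assume *: "\<forall>v. openin (top_of_set X) {x \<in> X. f x = v}" "\<forall>v. openin (top_of_set X) {x \<in> X. g x = v}"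
  have "{x \<in> X. (f x, g x) = v} = {x \<in> X. f x = fst v} \<inter> {x \<in> X. g x = snd v}" by auto
  then show "openin (top_of_set X) {x \<in> X. (f x, g x) = v}" using * by auto
qed

lemma loc_const_openin:
  assumes "loc_const X f" shows "openin (top_of_set X) {x \<in> X. P (f x)}"
proof -
  have "{x \<in> X. P (f x)} = (\<Union>v\<in>Collect P. {x \<in> X. f x = v})" by auto
  then show ?thesis using assms by (auto simp: loc_const_def)
qed

lemma loc_const_compose:
  assumes f: "loc_const Y f" and g: "continuous_on X g" "g ` X \<subseteq> Y"
  shows "loc_const X (\<lambda>x. f (g x))"
  unfolding loc_const_def
proof
  fix v
  have "continuous_map (top_of_set X) (top_of_set Y) g" using g by (simp add: image_subset_iff_funcset)
  from openin_continuous_map_preimage[OF this, of "{y \<in> Y. f y = v}"]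
  have "openin (top_of_set X) {x \<in> X. g x \<in> {y \<in> Y. f y = v}}" using f by (simp add: loc_const_def)
  moreover have "{x \<in> X. g x \<in> {y \<in> Y. f y = v}} = {x \<in> X. f (g x) = v}" using g by auto
  ultimately show "openin (top_of_set X) {x \<in> X. f (g x) = v}" by simp
qed

section \<open>Return times and towers over a clopen section\<close>

locale clopen_section = homeo_system +
  fixes C :: "'a set"
  assumes cpt: "compact X"
    and opC: "openin (top_of_set X) C"
    and clC: "closedin (top_of_set X) C"
    and hit: "\<And>x. x \<in> X \<Longrightarrow> \<exists>n. It n x \<in> C"
begin

abbreviation "rt \<equiv> return_time S C"
abbreviation "fr \<equiv> first_return S C"

lemma C_sub: "C \<subseteq> X"
  using opC openin_imp_subset by blast

lemma open_visit: "openin (top_of_set X) {x \<in> X. It n x \<in> C}"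
proof -
  have "continuous_map (top_of_set X) (top_of_set X) (It n)"
    using cont_It It_in by (simp add: image_subset_iff_funcset[symmetric] image_subset_iff)
  from openin_continuous_map_preimage[OF this opC] show ?thesis by simp
qed

lemma open_no_visit: "openin (top_of_set X) {x \<in> X. It n x \<notin> C}"
proof -
  have "continuous_map (top_of_set X) (top_of_set X) (It n)"
    using cont_It It_in by (simp add: image_subset_iff_funcset[symmetric] image_subset_iff)
  moreover have "openin (top_of_set X) (X - C)" using clC by (simp add: closedin_def)
  ultimately have "openin (top_of_set X) {x \<in> topspace (top_of_set X). It n x \<in> X - C}"
    by (rule openin_continuous_map_preimage)
  moreover have "{x \<in> topspace (top_of_set X). It n x \<in> X - C} = {x \<in> X. It n x \<notin> C}"
    using It_in by auto
  ultimately show ?thesis by simp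
qed

text \<open>Compactness turns the mere existence of a visit at some integer time into gaps of
  bounded length, in the future and in the past. This is what makes return and entry times well
  defined.\<close>

lemma bounded_visits:
  "\<exists>M. \<forall>x\<in>X. (\<exists>n. 0 < n \<and> n \<le> M \<and> It (int n) x \<in> C) \<and> (\<exists>n\<le>M. It (- int n) x \<in> C)"
proof -
  let ?V = "\<lambda>n. {x \<in> X. It n x \<in> C}"
  have "X \<subseteq> \<Union>(range ?V)" using hit by auto
  moreover have "\<forall>c\<in>range ?V. openin (top_of_set X) c" using open_visit by auto
  ultimately obtain D where D: "D \<subseteq> range ?V" "finite D" "X \<subseteq> \<Union>D"
    using cpt unfolding compact_eq_openin_cover by meson
  obtain F where F: "finite F" "D = ?V ` F"
    using finite_subset_image[OF D(2,1)] by auto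
  obtain K where K: "\<forall>n\<in>F. \<bar>n\<bar> \<le> K"
    using F(1) by (intro that[of "Max (abs ` F)"]) auto
  have "\<exists>n. -\<bar>K\<bar> \<le> n \<and> n \<le> \<bar>K\<bar> \<and> It n x \<in> C" if x: "x \<in> X" for x
  proof -
    obtain n where "n \<in> F" "It n x \<in> C" using D(3) F(2) x by blast
    then show ?thesis using K by (intro exI[of _ n]) (auto simp: abs_le_iff)
  qed
  note V = this
  \<comment> \<open>Every point visits \<open>C\<close> within times \<open>-\<bar>K\<bar>\<close>
    to \<open>\<bar>K\<bar>\<close>. Applying this to the points at times
    \<open>\<bar>K\<bar> + 1\<close> and \<open>-\<bar>K\<bar>\<close> moves the range to strictly
    positive times up to \<open>2 * \<bar>K\<bar> + 1\<close> and to times at most 0.\<close>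
  show ?thesis
  proof (rule exI[of _ "nat (2 * \<bar>K\<bar> + 1)"], intro ballI conjI)
    fix x assume x: "x \<in> X"
    obtain n where n: "-\<bar>K\<bar> \<le> n" "n \<le> \<bar>K\<bar>" "It n (It (\<bar>K\<bar> + 1) x) \<in> C" using V[OF It_in[OF x]] by blast
    then show "\<exists>n. 0 < n \<and> n \<le> nat (2 * \<bar>K\<bar> + 1) \<and> It (int n) x \<in> C"
      unfolding It_add[OF x, of n "\<bar>K\<bar> + 1", symmetric]
      by (intro exI[of _ "nat (n + (\<bar>K\<bar> + 1))"]) simp
    obtain n where n: "-\<bar>K\<bar> \<le> n" "n \<le> \<bar>K\<bar>" "It n (It (-\<bar>K\<bar>) x) \<in> C" using V[OF It_in[OF x]] by blast
    then show "\<exists>n\<le>nat (2 * \<bar>K\<bar> + 1). It (- int n) x \<in> C"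
      unfolding It_add[OF x, of n "-\<bar>K\<bar>", symmetric]
      by (intro exI[of _ "nat (\<bar>K\<bar> - n)"]) simp
  qed
qed

lemma It_nat: "It (int n) = S ^^ n"
  by (rule int_iterate_of_nat)

lemma rt_props:
  assumes "x \<in> X"
  shows "rt x > 0" "It (int (rt x)) x \<in> C" "0 < j \<Longrightarrow> j < int (rt x) \<Longrightarrow> It j x \<notin> C"
proof -
  let ?P = "\<lambda>i. i > 0 \<and> (S ^^ i) x \<in> C"
  have "\<exists>i. ?P i" using bounded_visits assms It_nat by metis
  then have *: "?P (rt x)" unfolding return_time_def by (rule LeastI_ex)
  then show "rt x > 0" "It (int (rt x)) x \<in> C" by (auto simp: It_nat)
  assume j: "0 < j" "j < int (rt x)"
  then have "\<not> ?P (nat j)" using not_less_Least[of "nat j" ?P] unfolding return_time_def by auto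
  then show "It j x \<notin> C" using j It_nat[of "nat j"] by auto
qed

lemma rt_le: "x \<in> X \<Longrightarrow> 0 < n \<Longrightarrow> It (int n) x \<in> C \<Longrightarrow> rt x \<le> n"
  unfolding return_time_def by (rule Least_le) (simp add: It_nat)

lemma rt_eqI:
  assumes "x \<in> X" "n > 0" "It (int n) x \<in> C" "\<And>j. 0 < j \<Longrightarrow> j < int n \<Longrightarrow> It j x \<notin> C"
  shows "rt x = n"
proof (rule ccontr)
  assume "rt x \<noteq> n"
  then have "rt x < n" using rt_le[OF assms(1-3)] by simp
  then show False using assms(4)[of "int (rt x)"] rt_props(1,2)[OF assms(1)] by simp
qed

lemma fr_eq: "fr x = It (int (rt x)) x"
  by (simp add: first_return_def It_nat)

lemma fr_in: "x \<in> X \<Longrightarrow> fr x \<in> C"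
  by (simp add: fr_eq rt_props)

lemma rt_bounded: "\<exists>M. \<forall>x\<in>X. rt x \<le> M"
proof -
  obtain M where M: "\<forall>x\<in>X. \<exists>n. 0 < n \<and> n \<le> M \<and> It (int n) x \<in> C" using bounded_visits by blast
  have "rt x \<le> M" if x: "x \<in> X" for x
  proof -
    obtain n where "0 < n" "n \<le> M" "It (int n) x \<in> C" using M x by blast
    then show ?thesis using rt_le[OF x, of n] by simp
  qed
  then show ?thesis by blast
qed

lemma loc_const_rt: "loc_const X rt"
  unfolding loc_const_def
proof
  fix n
  show "openin (top_of_set X) {x \<in> X. rt x = n}"
  proof (cases "n = 0")
    case True
    have "{x \<in> X. rt x = n} = {}" using rt_props(1) True by (metis (mono_tags, lifting) Collect_empty_eq less_irrefl)
    then show ?thesis by (simp only: openin_empty)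
  next
    case False
    have "{x \<in> X. rt x = n} = {x \<in> X. It (int n) x \<in> C} \<inter> {x \<in> X. \<forall>j\<in>{0<..<int n}. It j x \<notin> C}"
      (is "?L = ?R")
    proof
      show "?L \<subseteq> ?R" using rt_props(2,3) by auto
      show "?R \<subseteq> ?L" using rt_eqI[of _ n] False by auto
    qed
    then show ?thesis
      using open_visit open_no_visit by (simp add: openin_Int openin_finite_conj)
  qed
qed

text \<open>The time since the latest visit, which is 0 on \<open>C\<close> itself, whereas
  \<open>rt\<close> is always positive on \<open>X\<close>. The pair \<open>base x\<close>,
  \<open>ent x\<close> gives the coordinates of \<open>x\<close> in the Kakutani-Rokhlin tower whose
  column over \<open>y\<close> has height \<open>rt y\<close>.\<close>

definition ent :: "'a \<Rightarrow> nat" where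
  "ent x = (LEAST k. It (- int k) x \<in> C)"

definition base :: "'a \<Rightarrow> 'a" where
  "base x = It (- int (ent x)) x"

lemma ent_props:
  assumes "x \<in> X"
  shows "base x \<in> C" "0 \<le> j \<Longrightarrow> j < int (ent x) \<Longrightarrow> It (- j) x \<notin> C" "It (int (ent x)) (base x) = x"
proof -
  let ?P = "\<lambda>k. It (- int k) x \<in> C"
  have "\<exists>k. ?P k" using bounded_visits assms by metis
  then have "?P (ent x)" unfolding ent_def by (rule LeastI_ex)
  then show "base x \<in> C" by (simp add: base_def)
  show "It (int (ent x)) (base x) = x" by (simp add: base_def It_neg assms)
  assume j: "0 \<le> j" "j < int (ent x)"
  then have "\<not> ?P (nat j)" using not_less_Least[of "nat j" ?P] unfolding ent_def by auto
  then show "It (- j) x \<notin> C" using j by auto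
qed

lemma ent_eqI:
  assumes "x \<in> C" "n < rt x"
  shows "ent (It (int n) x) = n" "base (It (int n) x) = x"
proof -
  have x: "x \<in> X" using assms C_sub by auto
  show *: "ent (It (int n) x) = n"
    unfolding ent_def
  proof (rule Least_equality)
    show "It (- int n) (It (int n) x) \<in> C" using It_neg x assms by simp
    fix k assume k: "It (- int k) (It (int n) x) \<in> C"
    show "n \<le> k"
    proof (rule ccontr)
      assume "\<not> n \<le> k"
      then have "0 < int n - int k" "int n - int k < int (rt x)" using assms by auto
      then have "It (int n - int k) x \<notin> C" using rt_props(3)[OF x] by blast
      then show False using k It_add[OF x, of "- int k" "int n"] by simp
    qed
  qed
  show "base (It (int n) x) = x" unfolding base_def * using It_neg x by simp
qed

text \<open>Otherwise the first return of \<open>base x\<close> would be a visit between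
  \<open>base x\<close> and \<open>x\<close>, later than the latest one.\<close>

lemma ent_less: assumes "x \<in> X" shows "ent x < rt (base x)"
proof (rule ccontr)
  assume "\<not> ?thesis"
  moreover have b: "base x \<in> X" using ent_props(1)[OF assms] C_sub by auto
  ultimately have j: "0 \<le> int (ent x) - int (rt (base x))" "int (ent x) - int (rt (base x)) < int (ent x)"
    using rt_props(1)[OF b] by auto
  have "It (int (rt (base x))) (base x) = It (- (int (ent x) - int (rt (base x)))) x"
    unfolding base_def by (simp flip: It_add[OF assms])
  then show False using ent_props(2)[OF assms j] rt_props(2)[OF b] by simp
qed

lemma loc_const_ent: "loc_const X ent"
  unfolding loc_const_def
proof
  fix n
  have "{x \<in> X. ent x = n} = {x \<in> X. It (- int n) x \<in> C} \<inter> {x \<in> X. \<forall>j\<in>{0..<int n}. It (- j) x \<notin> C}"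
    (is "?L = ?R")
  proof
    show "?L \<subseteq> ?R" using ent_props by (auto simp: base_def)
    show "?R \<subseteq> ?L"
    proof
      fix x assume x: "x \<in> ?R"
      have "ent x = n" unfolding ent_def
      proof (rule Least_equality)
        show "It (- int n) x \<in> C" using x by simp
        show "n \<le> k" if k: "It (- int k) x \<in> C" for k
        proof (rule ccontr)
          assume "\<not> n \<le> k"
          then have "int k \<in> {0..<int n}" by auto
          then show False using x k by blast
        qed
      qed
      then show "x \<in> ?L" using x by simp
    qed
  qed
  then show "openin (top_of_set X) {x \<in> X. ent x = n}"
    using open_visit open_no_visit by (simp add: openin_Int openin_finite_conj)
qed

text \<open>If two points of \<open>C\<close> have the same first return, the one with the longer
  return time passes through the other strictly before returning, unless the two times are equal. A
  preimage of \<open>y\<close> is the visit preceding \<open>y\<close>.\<close>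

lemma bij_fr: "bij_betw fr C C"
proof (rule bij_betw_imageI)
  show "inj_on fr C"
  proof (rule inj_onI)
    have *: "x = x'" if "x \<in> C" "x' \<in> C" "fr x = fr x'" "rt x \<ge> rt x'" for x x'
    proof -
      have x: "x \<in> X" "x' \<in> X" using that C_sub by auto
      have "It (- int (rt x')) (It (int (rt x)) x) = x'" using that It_neg x by (simp add: fr_eq)
      then have "It (int (rt x) - int (rt x')) x = x'" by (simp flip: It_add[OF x(1)])
      then show "x = x'" using rt_props(3)[OF x(1), of "int (rt x) - int (rt x')"] rt_props(1)[OF x(2)] that
        by (cases "rt x = rt x'") auto
    qed
    show "x = x'" if "x \<in> C" "x' \<in> C" "fr x = fr x'" for x x'
      using *[of x x'] *[of x' x] that by (cases "rt x \<ge> rt x'") auto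
  qed
  show "fr ` C = C"
  proof
    show "fr ` C \<subseteq> C" using fr_in C_sub by auto
    show "C \<subseteq> fr ` C"
    proof
      fix y assume y: "y \<in> C"
      then have yX: "y \<in> X" using C_sub by auto
      \<comment> \<open>Stepping back once before looking for the latest visit excludes
        \<open>y\<close> itself.\<close>
      define z where "z = It (- 1) y"
      have z: "z \<in> X" by (simp add: z_def It_in yX)
      define x where "x = base z"
      have x: "x \<in> C" "x \<in> X" using ent_props(1)[OF z] C_sub by (auto simp: x_def)
      have e: "It j x = It (j - int (ent z) - 1) y" for j
        unfolding x_def base_def z_def by (simp flip: It_add[OF yX] add: algebra_simps)
      have "rt x = Suc (ent z)"
      proof (rule rt_eqI[OF x(2)])
        show "It (int (Suc (ent z))) x \<in> C" using y by (simp add: e)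
        fix j assume j: "0 < j" "j < int (Suc (ent z))"
        then have "It (- (int (ent z) - j)) z \<notin> C" by (intro ent_props(2)[OF z]) auto
        then show "It j x \<notin> C" unfolding e by (simp add: z_def flip: It_add[OF yX])
      qed simp
      then have "fr x = y" by (simp add: fr_eq e)
      then show "y \<in> fr ` C" using x by blast
    qed
  qed
qed

end

lemma minimal_system_homeo: "minimal_system X S \<Longrightarrow> homeo_system X S"
  by (simp add: minimal_system_def dyn_system_def homeo_system_def)

lemma minimal_system_hit:
  assumes "minimal_system X S" and C: "openin (top_of_set X) C" "C \<noteq> {}" and x: "x \<in> X"
  shows "\<exists>n. int_iterate X S n x \<in> C"
proof -
  interpret homeo_system X S using assms(1) by (rule minimal_system_homeo)
  obtain O' where O': "open O'" "C = X \<inter> O'" using C(1) by (auto simp: openin_open)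
  obtain y where y: "y \<in> X" "y \<in> O'" using C(2) O'(2) by blast
  have "y \<in> closure (two_sided_orbit X S x)" using assms(1) x y by (auto simp: minimal_system_def)
  then have "O' \<inter> two_sided_orbit X S x \<noteq> {}"
    using O'(1) y(2) open_Int_closure_eq_empty[of O' "two_sided_orbit X S x"] by blast
  then obtain n where "int_iterate X S n x \<in> O'" by (auto simp: two_sided_orbit_def)
  then show ?thesis using O'(2) It_in[OF x] by blast
qed

lemma minimal_system_section:
  assumes "minimal_system X S" "openin (top_of_set X) C" "closedin (top_of_set X) C" "C \<noteq> {}"
  shows "clopen_section X S C"
proof (intro clopen_section.intro clopen_section_axioms.intro assms minimal_system_homeo)
  show "compact X" using assms(1) by (simp add: minimal_system_def dyn_system_def)
  show "\<exists>n. int_iterate X S n x \<in> C" if "x \<in> X" for x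
    by (rule minimal_system_hit[OF assms(1,2,4) that])
qed

section \<open>Conjugate induced systems give flow equivalence\<close>

text \<open>The piecewise linear function with slope \<open>f n\<close> between \<open>n\<close> and
  \<open>n + 1\<close>. The formula on closed unit intervals, right end included although the floor
  jumps there, reduces continuity to pasting two neighbours.\<close>

lemma interpolation:
  fixes f :: "int \<Rightarrow> real"
  assumes pos: "\<And>i. 0 < f i"
  defines "\<phi> \<equiv> \<lambda>t. int_sum f \<lfloor>t\<rfloor> + frac t * f \<lfloor>t\<rfloor>"
  shows "continuous_on UNIV \<phi>" "strict_mono \<phi>"
    and "of_int n \<le> t \<Longrightarrow> t \<le> of_int n + 1 \<Longrightarrow> \<phi> t = int_sum f n + (t - of_int n) * f n"
proof -
  have eq: "\<phi> t = int_sum f n + (t - of_int n) * f n"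
    if "of_int n \<le> t" "t \<le> of_int n + 1" for n t
  proof (cases "t = of_int n + 1")
    case True
    then have "\<lfloor>t\<rfloor> = n + 1" "frac t = 0" by (auto simp: frac_def)
    then show ?thesis using True int_sum_Suc[of f n] by (simp add: \<phi>_def)
  next
    case False
    then have "\<lfloor>t\<rfloor> = n" using that by linarith
    then show ?thesis by (simp add: \<phi>_def frac_def)
  qed
  then show "of_int n \<le> t \<Longrightarrow> t \<le> of_int n + 1 \<Longrightarrow> \<phi> t = int_sum f n + (t - of_int n) * f n" .
  show "strict_mono \<phi>"
  proof (rule strict_monoI)
    fix s t :: real assume st: "s < t"
    have lt: "\<phi> s < int_sum f (\<lfloor>s\<rfloor> + 1)"
    proof -
      have "frac s * f \<lfloor>s\<rfloor> < 1 * f \<lfloor>s\<rfloor>"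
        using pos frac_lt_1[of s] by (intro mult_strict_right_mono) auto
      then show ?thesis using int_sum_Suc[of f "\<lfloor>s\<rfloor>"] by (simp add: \<phi>_def)
    qed
    show "\<phi> s < \<phi> t"
    proof (cases "\<lfloor>s\<rfloor> = \<lfloor>t\<rfloor>")
      case True
      then have "frac s < frac t" using st by (simp add: frac_def)
      then show ?thesis using True pos[of "\<lfloor>t\<rfloor>"] by (simp add: \<phi>_def)
    next
      case False
      then have "\<lfloor>s\<rfloor> + 1 \<le> \<lfloor>t\<rfloor>" using st by linarith
      then have "int_sum f (\<lfloor>s\<rfloor> + 1) \<le> int_sum f \<lfloor>t\<rfloor>"
        using int_sum_lower[of "\<lfloor>s\<rfloor> + 1" "\<lfloor>t\<rfloor>" 0 f] less_imp_le[OF pos] by simp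
      moreover have "int_sum f \<lfloor>t\<rfloor> \<le> \<phi> t"
        using pos[of "\<lfloor>t\<rfloor>"] frac_ge_0[of t] by (simp add: \<phi>_def)
      ultimately show ?thesis using lt by linarith
    qed
  qed
  have c: "continuous_on {of_int n..of_int n + 1} \<phi>" for n
  proof -
    have "continuous_on {of_int n..of_int n + 1} (\<lambda>t. int_sum f n + (t - of_int n) * f n)"
      by (intro continuous_intros)
    then show ?thesis by (rule continuous_on_eq) (simp add: eq[of n])
  qed
  have "isCont \<phi> t" for t
  proof -
    \<comment> \<open>With the ceiling, \<open>t\<close> is interior to the union of two adjacent
      unit intervals even when it is an integer.\<close>
    define n where "n = \<lceil>t\<rceil> - 1"
    have n: "of_int n < t" "t < of_int n + 2" unfolding n_def by linarith+
    have "continuous_on ({of_int n..of_int n + 1} \<union> {of_int (n+1)..of_int (n+1) + 1}) \<phi>"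
      by (intro continuous_on_closed_Un c) auto
    moreover have "{of_int n..of_int n + 1} \<union> {of_int (n+1)..of_int (n+1) + 1} = {of_int n..of_int n + (2::real)}"
      by auto
    ultimately have "continuous_on {of_int n..of_int n + 2} \<phi>" by simp
    then show ?thesis
      by (rule continuous_on_interior) (use n in \<open>simp add: interior_atLeastAtMost_real\<close>)
  qed
  then show "continuous_on UNIV \<phi>" by (simp add: continuous_on_eq_continuous_within)
qed

lemma suspension_flow_add: "suspension_flow s (suspension_flow t c) = suspension_flow (t + s) c"
  by (simp add: suspension_flow_def image_image case_prod_beta add.assoc)

lemma suspension_flow_0 [simp]: "suspension_flow 0 c = c"
  by (simp add: suspension_flow_def)

lemma (in homeo_system) flow_in_topspace:
  assumes "c \<in> topspace (suspension X S)"
  shows "suspension_flow t c \<in> topspace (suspension X S)"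
proof -
  obtain x s where "x \<in> X" "c = q (x, s)" using assms by (rule topspace_suspE)
  then show ?thesis by simp
qed

section \<open>Affine extension of a conjugacy between induced maps to the suspensions\<close>

locale conj_sections =
  A: clopen_section X S C + B: clopen_section Y T D
  for X :: "'a::topological_space set" and S C and Y :: "'b::topological_space set" and T D +
  fixes \<psi> :: "'a \<Rightarrow> 'b" and \<psi>' :: "'b \<Rightarrow> 'a"
  assumes conj_homeo: "homeomorphism C D \<psi> \<psi>'"
    and conj_eq: "\<And>x. x \<in> C \<Longrightarrow> \<psi> (first_return S C x) = first_return T D (\<psi> x)"
begin

lemma psi_in: "x \<in> C \<Longrightarrow> \<psi> x \<in> D" "x \<in> C \<Longrightarrow> \<psi> x \<in> Y" "x \<in> C \<Longrightarrow> \<psi>' (\<psi> x) = x"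
  using homeomorphism_image1[OF conj_homeo] homeomorphism_apply1[OF conj_homeo] B.C_sub
  by blast+

text \<open>The slope of the affine map of a column of height \<open>rt x\<close> onto the column
  over \<open>\<psi> x\<close>; differing heights are the origin of the change of time.\<close>

definition speed :: "'a \<Rightarrow> real" where
  "speed x = real (B.rt (\<psi> x)) / real (A.rt x)"

lemma speed_pos:
  assumes "x \<in> C" shows "speed x > 0"
proof -
  have "x \<in> X" using assms A.C_sub by blast
  then show ?thesis
    using A.rt_props(1)[of x] B.rt_props(1)[OF psi_in(2)[OF assms]] by (simp add: speed_def)
qed

text \<open>Tower coordinates of the point at height \<open>ent x + s\<close> over
  \<open>base x\<close>, rescaled to the column over \<open>\<psi> (base x)\<close>. The value is
  the intended one only for \<open>s\<close> between 0 and 1; beyond that, the speed of another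
  column may be needed.\<close>

definition H :: "'a \<times> real \<Rightarrow> ('b \<times> real) set" where
  "H p = B.q (\<psi> (A.base (fst p)), (real (A.ent (fst p)) + snd p) * speed (A.base (fst p)))"

text \<open>Moving the integer part of the height into the base point makes the invariance
  \<open>G_shift\<close> immediate. The price is that continuity at integer heights has to be proved
  separately.\<close>

definition G :: "'a \<times> real \<Rightarrow> ('b \<times> real) set" where
  "G p = H (A.It \<lfloor>snd p\<rfloor> (fst p), frac (snd p))"

lemma G_shift: "x \<in> X \<Longrightarrow> G (A.It n x, s) = G (x, s + of_int n)"
  by (simp add: G_def A.It_add)

text \<open>The top \<open>u = rt x\<close> is included. There the floor already leads to the next
  column, and the values match because \<open>\<psi>\<close> intertwines the first return maps and
  \<open>rt x * speed x\<close> is the return time of \<open>\<psi> x\<close>.\<close>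

lemma G_tower:
  assumes x: "x \<in> C" and u: "0 \<le> u" "u \<le> real (A.rt x)"
  shows "G (x, u) = B.q (\<psi> x, u * speed x)"
proof (cases "u = real (A.rt x)")
  case True
  have xX: "x \<in> X" "A.rt x > 0" using x A.C_sub A.rt_props by auto
  have fC: "A.fr x \<in> C" "A.fr x \<in> X" using A.fr_in[OF xX(1)] A.C_sub by auto
  have "A.ent (A.fr x) = 0" "A.base (A.fr x) = A.fr x"
    using A.ent_eqI[OF fC(1), of 0] A.rt_props(1)[OF fC(2)] by auto
  moreover have "\<lfloor>u\<rfloor> = int (A.rt x)" "frac u = 0" using True by (auto simp: frac_def)
  ultimately have "G (x, u) = B.q (\<psi> (A.fr x), 0)"
    by (simp add: G_def H_def flip: A.fr_eq del: frac_eq_0_iff)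
  also have "\<dots> = B.q (B.It (int (B.rt (\<psi> x))) (\<psi> x), 0)" using conj_eq[OF x] B.fr_eq by simp
  also have "\<dots> = B.q (\<psi> x, real (B.rt (\<psi> x)))" using B.class_shift psi_in x by simp
  also have "real (B.rt (\<psi> x)) = u * speed x" using True xX by (simp add: speed_def)
  finally show ?thesis .
next
  case False
  define n where "n = nat \<lfloor>u\<rfloor>"
  have n: "\<lfloor>u\<rfloor> = int n" using u by (simp add: n_def)
  then have "n < A.rt x" using u False by linarith
  then have "A.ent (A.It (int n) x) = n" "A.base (A.It (int n) x) = x" using A.ent_eqI x by auto
  moreover have "real n + frac u = u" using n by (simp add: frac_def)
  ultimately show ?thesis by (simp add: G_def H_def n)
qed

lemma tower_rep:
  assumes "x \<in> X"
  obtains x0 u where "x0 \<in> C" "0 \<le> u" "u \<le> real (A.rt x0)" "A.q (x, s) = A.q (x0, u)"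
proof -
  define z where "z = A.It \<lfloor>s\<rfloor> x"
  have z: "z \<in> X" using assms A.It_in by (simp add: z_def)
  have b: "A.base z \<in> C" "A.base z \<in> X" using A.ent_props(1)[OF z] A.C_sub by auto
  have "A.q (x, s) = A.q (z, frac s)"
    using A.class_shift[OF assms, of "\<lfloor>s\<rfloor>" "frac s"] by (simp add: z_def frac_def)
  also have "\<dots> = A.q (A.base z, frac s + real (A.ent z))"
    using A.class_shift[OF b(2), of "int (A.ent z)" "frac s"] A.ent_props(3)[OF z] by simp
  finally have "A.q (x, s) = A.q (A.base z, frac s + real (A.ent z))" .
  moreover have "frac s + real (A.ent z) \<le> real (A.rt (A.base z))"
    using A.ent_less[OF z] frac_lt_1[of s] by linarith
  ultimately show ?thesis using b(1) by (intro that[of "A.base z" "frac s + real (A.ent z)"]) auto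
qed

text \<open>The gluing condition between the level of \<open>x\<close> and the level of
  \<open>S x\<close>. By \<open>G_tower\<close> it also holds when \<open>S x\<close> begins a new
  column.\<close>

lemma H_step:
  assumes "x \<in> X" shows "H (x, 1) = H (S x, 0)"
proof -
  have b: "A.base x \<in> C" "A.base x \<in> X" using A.ent_props(1)[OF assms] A.C_sub by auto
  have e: "S x = A.It (int (A.ent x) + 1) (A.base x)"
    using A.It_Suc(1)[OF b(2), of "int (A.ent x)"] A.ent_props(3)[OF assms] by simp
  have "H (S x, 0) = G (S x, 0)" by (simp add: G_def)
  also have "\<dots> = G (A.base x, real (A.ent x) + 1)"
    unfolding e by (simp add: G_shift[OF b(2)])
  also have "\<dots> = B.q (\<psi> (A.base x), (real (A.ent x) + 1) * speed (A.base x))"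
    using A.ent_less[OF assms] by (intro G_tower b) auto
  finally show ?thesis by (simp only: H_def fst_conv snd_conv)
qed

lemma G_closed:
  assumes "x \<in> X" "of_int n \<le> s" "s \<le> of_int n + 1"
  shows "G (x, s) = H (A.It n x, s - of_int n)"
proof (cases "s = of_int n + 1")
  case True
  then have "\<lfloor>s\<rfloor> = n + 1" "frac s = 0" by (auto simp: frac_def)
  then have "G (x, s) = H (S (A.It n x), 0)"
    using A.It_Suc(1)[OF assms(1), of n] by (simp add: G_def del: frac_eq_0_iff)
  then show ?thesis using H_step[OF A.It_in[OF assms(1)]] True by simp
next
  case False
  then have "\<lfloor>s\<rfloor> = n" using assms by linarith
  then show ?thesis by (simp add: G_def frac_def)
qed

text \<open>Once the entry time and the two column heights are frozen, \<open>H\<close> is the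
  quotient map after an explicit continuous formula.\<close>

lemma continuous_H: "continuous_map (top_of_set (X \<times> UNIV)) (suspension Y T) H"
proof -
  let ?e = "\<lambda>x. (A.ent x, A.rt (A.base x), B.rt (\<psi> (A.base x)))"
  let ?f = "\<lambda>v p. B.q (\<psi> (A.It (- int (fst v)) (fst p)),
    (real (fst v) + snd p) * (real (snd (snd v)) / real (fst (snd v))))"
  have psi: "continuous_on C \<psi>" using homeomorphism_cont1[OF conj_homeo] .
  have cb: "continuous_on X A.base"
  proof -
    let ?g = "\<lambda>k p. A.It (- int k) (fst p)"
    have "continuous_map (top_of_set (X \<times> (UNIV::real set))) euclidean (\<lambda>p. ?g (A.ent (fst p)) p)"
    proof (rule loc_const_paste[OF A.loc_const_ent])
      show "continuous_map (top_of_set ({x \<in> X. A.ent x = k} \<times> UNIV)) euclidean (?g k)" for k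
        by (simp, intro continuous_on_compose2[OF A.cont_It] continuous_on_fst continuous_on_id) auto
    qed
    then have "continuous_on (X \<times> (UNIV::real set)) (\<lambda>p. A.base (fst p))" by (simp add: A.base_def)
    then have "continuous_on X (\<lambda>x. A.base (fst (x, 0::real)))"
      by (rule continuous_on_compose2) (auto intro!: continuous_intros)
    then show ?thesis by simp
  qed
  have bC: "A.base ` X \<subseteq> C" using A.ent_props(1) by auto
  have e: "loc_const X ?e"
  proof (intro loc_const_pair)
    show "loc_const X (\<lambda>x. A.rt (A.base x))"
      using cb bC A.C_sub by (intro loc_const_compose[OF A.loc_const_rt]) auto
    have "continuous_on X (\<lambda>x. \<psi> (A.base x))"
      using psi cb bC by (rule continuous_on_compose2)
    then show "loc_const X (\<lambda>x. B.rt (\<psi> (A.base x)))"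
      using bC psi_in(2) by (intro loc_const_compose[OF B.loc_const_rt]) auto
  qed (rule A.loc_const_ent)
  have "continuous_map (top_of_set (X \<times> UNIV)) (suspension Y T) (\<lambda>p. ?f (?e (fst p)) p)"
  proof (rule loc_const_paste[OF e])
    fix v :: "nat \<times> nat \<times> nat"
    let ?P = "{x \<in> X. ?e x = v} \<times> (UNIV :: real set)"
    let ?r = "\<lambda>p. (\<psi> (A.It (- int (fst v)) (fst p)),
      (real (fst v) + snd p) * (real (snd (snd v)) / real (fst (snd v))))"
    have b: "A.It (- int (fst v)) (fst p) \<in> C" if "p \<in> ?P" for p
      using that A.ent_props(1)[of "fst p"] by (auto simp: A.base_def)
    have "continuous_on ?P (\<lambda>p. A.It (- int (fst v)) (fst p))"
      by (intro continuous_on_compose2[OF A.cont_It] continuous_on_fst continuous_on_id) auto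
    then have "continuous_on ?P (\<lambda>p. \<psi> (A.It (- int (fst v)) (fst p)))"
      by (rule continuous_on_compose2[OF psi]) (use b in auto)
    then have "continuous_on ?P ?r"
      by (intro continuous_on_Pair continuous_on_mult continuous_on_add continuous_on_const
          continuous_on_snd continuous_on_id)
    moreover have "?r ` ?P \<subseteq> Y \<times> UNIV" using b psi_in(2) by auto
    ultimately have "continuous_map (top_of_set ?P) (top_of_set (Y \<times> UNIV)) ?r"
      by (simp add: image_subset_iff_funcset)
    from continuous_map_compose[OF this B.continuous_class]
    show "continuous_map (top_of_set ?P) (suspension Y T) (?f v)" by (simp add: comp_def)
  qed
  moreover have "(\<lambda>p. ?f (?e (fst p)) p) = H"
    by (simp add: H_def speed_def fun_eq_iff A.base_def)
  ultimately show ?thesis by simp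
qed

text \<open>The closed strips between consecutive integer heights are locally finite, and on each of
  them \<open>G\<close> is a translate of \<open>H\<close>; on common boundaries the translates
  agree by \<open>G_closed\<close>.\<close>

lemma continuous_G: "continuous_map (top_of_set (X \<times> UNIV)) (suspension Y T) G"
proof (rule pasting_lemma_locally_finite[where I = UNIV
      and T = "\<lambda>n::int. X \<times> {of_int n..of_int n + 1}" and f = "\<lambda>n p. H (A.It n (fst p), snd p - of_int n)"])
  fix p assume p: "p \<in> topspace (top_of_set (X \<times> (UNIV :: real set)))"
  let ?V = "X \<times> {snd p - 1 <..< snd p + 1}"
  have "{n::int. X \<times> {of_int n..of_int n + 1} \<inter> ?V \<noteq> {}} \<subseteq> {\<lfloor>snd p\<rfloor> - 3..\<lfloor>snd p\<rfloor> + 3}"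
  proof
    fix n :: int assume "n \<in> {n. X \<times> {of_int n..of_int n + 1} \<inter> ?V \<noteq> {}}"
    then obtain t where "of_int n \<le> t" "t \<le> of_int n + 1" "snd p - 1 < t" "t < snd p + 1" by auto
    then show "n \<in> {\<lfloor>snd p\<rfloor> - 3..\<lfloor>snd p\<rfloor> + 3}" by (simp, linarith)
  qed
  then have "finite {n::int. X \<times> {of_int n..of_int n + 1} \<inter> ?V \<noteq> {}}" using finite_subset by blast
  moreover have "openin (top_of_set (X \<times> UNIV)) ?V" by (auto intro: openin_Times)
  moreover have "p \<in> ?V" using p by (cases p) auto
  ultimately show "\<exists>V. openin (top_of_set (X \<times> UNIV)) V \<and> p \<in> V
      \<and> finite {n::int \<in> UNIV. X \<times> {of_int n..of_int n + 1} \<inter> V \<noteq> {}}" by auto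
  have "p \<in> X \<times> {of_int \<lfloor>snd p\<rfloor>..of_int \<lfloor>snd p\<rfloor> + 1}"
    using p by (cases p) (use real_of_int_floor_add_one_ge[of "snd p"] in auto)
  then show "\<exists>j. j \<in> UNIV \<and> p \<in> X \<times> {of_int j..of_int j + 1} \<and> G p = H (A.It j (fst p), snd p - of_int j)"
    using G_closed[of "fst p" "\<lfloor>snd p\<rfloor>" "snd p"] by (intro exI[of _ "\<lfloor>snd p\<rfloor>"]) auto
next
  fix n :: int
  show "closedin (top_of_set (X \<times> UNIV)) (X \<times> {of_int n..of_int n + (1::real)})"
    by (auto intro: closedin_Times)
  let ?P = "X \<times> {of_int n..of_int n + (1::real)}"
  let ?r = "\<lambda>p. (A.It n (fst p), snd p - of_int n)"
  have "continuous_on ?P ?r"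
    by (intro continuous_on_Pair continuous_on_compose2[OF A.cont_It] continuous_on_diff
          continuous_on_fst continuous_on_snd continuous_on_const continuous_on_id) auto
  moreover have "?r ` ?P \<subseteq> X \<times> UNIV" using A.It_in by auto
  ultimately have "continuous_map (top_of_set ?P) (top_of_set (X \<times> UNIV)) ?r"
    by (simp add: image_subset_iff_funcset)
  from continuous_map_compose[OF this continuous_H]
  have "continuous_map (top_of_set ?P) (suspension Y T) (\<lambda>p. H (A.It n (fst p), snd p - of_int n))"
    by (simp add: comp_def)
  moreover have "X \<times> UNIV \<inter> ?P = ?P" by auto
  ultimately show "continuous_map (subtopology (top_of_set (X \<times> UNIV)) ?P) (suspension Y T)
      (\<lambda>p. H (A.It n (fst p), snd p - of_int n))"
    by (simp add: subtopology_subtopology)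
next
  fix i j :: int and p
  assume "p \<in> topspace (top_of_set (X \<times> (UNIV :: real set))) \<inter> X \<times> {of_int i..of_int i + 1} \<inter> X \<times> {of_int j..of_int j + 1}"
  then show "H (A.It i (fst p), snd p - of_int i) = H (A.It j (fst p), snd p - of_int j)"
    using G_closed[of "fst p" i "snd p"] G_closed[of "fst p" j "snd p"] by auto
qed

abbreviation h :: "('a \<times> real) set \<Rightarrow> ('b \<times> real) set" where
  "h \<equiv> A.lift G"

lemma h_class: "x \<in> X \<Longrightarrow> h (A.q (x, s)) = G (x, s)"
  using A.lift_class[of G] G_shift by blast

lemma continuous_h: "continuous_map (suspension X S) (suspension Y T) h"
  using A.continuous_lift[OF _ continuous_G] G_shift by blast

lemma h_tower:
  assumes "x \<in> C" "0 \<le> u" "u \<le> real (A.rt x)"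
  shows "h (A.q (x, u)) = B.q (\<psi> x, u * speed x)"
proof -
  have "x \<in> X" using assms A.C_sub by blast
  then show ?thesis using h_class[of x u] G_tower[OF assms] by simp
qed

text \<open>Over each unit of time the image moves with the constant speed of the current column, so
  the time change interpolates the summed speeds. Subtracting \<open>\<phi> s\<close> accounts for a
  start at height \<open>s\<close>.\<close>

lemma h_flow:
  assumes c: "c \<in> topspace (suspension X S)"
  shows "\<exists>\<phi>. continuous_on UNIV \<phi> \<and> strict_mono \<phi> \<and>
    (\<forall>t. h (suspension_flow t c) = suspension_flow (\<phi> t) (h c))"
proof -
  obtain x s where xs: "x \<in> X" "c = A.q (x, s)" using c by (rule A.topspace_suspE)
  define f where "f i = speed (A.base (A.It i x))" for i
  have pos: "f i > 0" for i
    unfolding f_def by (intro speed_pos A.ent_props(1) A.It_in xs)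
  define \<phi> where "\<phi> = (\<lambda>t. int_sum f \<lfloor>t\<rfloor> + frac t * f \<lfloor>t\<rfloor>)"
  note ip = interpolation[of f, OF pos, folded \<phi>_def]
  have H: "H (A.It n x, u) = suspension_flow (u * f n) (H (A.It n x, 0))" for n u
  proof -
    have "\<psi> (A.base (A.It n x)) \<in> Y" by (intro psi_in A.ent_props(1) A.It_in xs)
    then show ?thesis by (simp add: H_def f_def algebra_simps)
  qed
  have G0: "G (x, of_int n) = H (A.It n x, 0)" for n by (simp add: G_def)
  have st: "G (x, of_int n + 1) = suspension_flow (f n) (G (x, of_int n))" for n
    using G_closed[OF xs(1), of n "of_int n + 1"] H[of n 1] G0 by simp
  have Gint: "G (x, of_int n) = suspension_flow (int_sum f n) (G (x, 0))" for n
  proof (induction n rule: int_induct[where k = 0])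
    case base
    then show ?case by simp
  next
    case (step1 i)
    have "G (x, of_int (i + 1)) = suspension_flow (f i) (G (x, of_int i))" using st[of i] by simp
    then show ?case using step1 by (simp add: suspension_flow_add int_sum_Suc)
  next
    case (step2 i)
    have "suspension_flow (- f (i - 1)) (G (x, of_int i)) = G (x, of_int (i - 1))"
      using st[of "i - 1"] by (simp add: suspension_flow_add)
    moreover have "int_sum f i = int_sum f (i - 1) + f (i - 1)" using int_sum_Suc[of f "i - 1"] by simp
    ultimately show ?case using step2 by (simp add: suspension_flow_add)
  qed
  have G: "G (x, t) = suspension_flow (\<phi> t) (G (x, 0))" for t
  proof -
    have "G (x, t) = suspension_flow (frac t * f \<lfloor>t\<rfloor>) (G (x, of_int \<lfloor>t\<rfloor>))"
      using H[of "\<lfloor>t\<rfloor>" "frac t"] G0 by (simp add: G_def)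
    then show ?thesis by (simp add: Gint suspension_flow_add \<phi>_def)
  qed
  have "h (suspension_flow t c) = suspension_flow (\<phi> (s + t) - \<phi> s) (h c)" for t
    using xs G[of s] G[of "s + t"] by (simp add: h_class suspension_flow_add)
  moreover have "strict_mono (\<lambda>t. \<phi> (s + t) - \<phi> s)"
    using ip(2) by (simp add: strict_mono_def)
  moreover have "continuous_on UNIV (\<lambda>t. \<phi> (s + t) - \<phi> s)"
    by (intro continuous_on_diff continuous_on_const continuous_on_compose2[OF ip(1)] continuous_on_add continuous_on_id) auto
  ultimately show ?thesis by blast
qed

end

text \<open>Every class has a representative in a column over \<open>C\<close>. On it the two maps
  are affine with reciprocal slopes over mutually inverse base maps.\<close>

lemma conj_sections_inverse:
  assumes "conj_sections X S C Y T D \<psi> \<psi>'" "conj_sections Y T D X S C \<psi>' \<psi>"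
    and c: "c \<in> topspace (suspension X S)"
  shows "homeo_system.lift Y T (conj_sections.G Y T D X S C \<psi>')
      (homeo_system.lift X S (conj_sections.G X S C Y T D \<psi>) c) = c"
proof -
  interpret P: conj_sections X S C Y T D \<psi> \<psi>' by fact
  interpret Q: conj_sections Y T D X S C \<psi>' \<psi> by fact
    obtain x s where "x \<in> X" "c = P.A.q (x, s)" using c by (rule P.A.topspace_suspE)
    then obtain x0 u where *: "x0 \<in> C" "0 \<le> u" "u \<le> real (P.A.rt x0)" "c = P.A.q (x0, u)"
      using P.tower_rep by metis
    have r: "P.A.rt x0 > 0" "P.B.rt (\<psi> x0) > 0"
      using P.A.rt_props(1) P.B.rt_props(1) * P.A.C_sub P.psi_in by auto
    have "u * P.speed x0 \<le> real (P.A.rt x0) * P.speed x0"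
      using * P.speed_pos by (intro mult_right_mono) (auto simp: less_imp_le)
    also have "\<dots> = real (P.B.rt (\<psi> x0))" using r by (simp add: P.speed_def)
    finally have le: "u * P.speed x0 \<le> real (P.B.rt (\<psi> x0))" .
    have "Q.h (P.h c) = P.A.q (\<psi>' (\<psi> x0), u * P.speed x0 * Q.speed (\<psi> x0))"
      using * P.h_tower[of x0 u] Q.h_tower[of "\<psi> x0" "u * P.speed x0"] le P.psi_in(1)[OF *(1)]
        P.speed_pos[OF *(1)] by simp
    also have "\<psi>' (\<psi> x0) = x0" using P.psi_in * by simp
    also have "u * P.speed x0 * Q.speed (\<psi> x0) = u"
      using r P.psi_in(3)[OF *(1)] by (simp add: P.speed_def Q.speed_def)
    finally show ?thesis using * by simp
qed

lemma conj_sections_sym: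
  assumes "conj_sections X S C Y T D \<psi> \<psi>'"
  shows "conj_sections Y T D X S C \<psi>' \<psi>"
proof -
  interpret P: conj_sections X S C Y T D \<psi> \<psi>' by fact
  show ?thesis
  proof (intro conj_sections.intro conj_sections_axioms.intro P.A.clopen_section_axioms P.B.clopen_section_axioms)
    show "homeomorphism D C \<psi>' \<psi>" by (rule homeomorphism_symD[OF P.conj_homeo])
    fix y assume y: "y \<in> D"
    have *: "\<psi>' y \<in> C" "\<psi> (\<psi>' y) = y"
      using homeomorphism_image2[OF P.conj_homeo] homeomorphism_apply2[OF P.conj_homeo] y by auto
    have "\<psi> (first_return S C (\<psi>' y)) = first_return T D y" using P.conj_eq[OF *(1)] * by simp
    moreover have "first_return S C (\<psi>' y) \<in> C" using P.A.fr_in[of "\<psi>' y"] P.A.C_sub * by auto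
    ultimately show "\<psi>' (first_return T D y) = first_return S C (\<psi>' y)"
      using P.psi_in(3)[of "first_return S C (\<psi>' y)"] by simp
  qed
qed

lemma conj_sections_flow_equivalent:
  assumes "conj_sections X S C Y T D \<psi> \<psi>'"
  shows "flow_equivalent X S Y T"
proof -
  interpret P: conj_sections X S C Y T D \<psi> \<psi>' by fact
  interpret Q: conj_sections Y T D X S C \<psi>' \<psi> by (rule conj_sections_sym[OF assms])
  have inv: "Q.h (P.h c) = c" if "c \<in> topspace (suspension X S)" for c
    using conj_sections_inverse[OF P.conj_sections_axioms Q.conj_sections_axioms that] .
  have inv': "P.h (Q.h c) = c" if "c \<in> topspace (suspension Y T)" for c
    using conj_sections_inverse[OF Q.conj_sections_axioms P.conj_sections_axioms that] .
  have maps: "homeomorphic_maps (suspension X S) (suspension Y T) P.h Q.h"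
    using P.continuous_h Q.continuous_h inv inv' by (simp add: homeomorphic_maps_def)
  have "P.h ` flow_orbit c = flow_orbit (P.h c)" if c: "c \<in> topspace (suspension X S)" for c
  proof
    show "P.h ` flow_orbit c \<subseteq> flow_orbit (P.h c)"
      using P.h_flow[OF c] by (auto simp: flow_orbit_def)
    have hc: "P.h c \<in> topspace (suspension Y T)"
      using continuous_map_image_subset_topspace[OF P.continuous_h] c by auto
    \<comment> \<open>That the image fills the whole orbit is read off from the time change of the
      inverse map.\<close>
    obtain \<phi> where \<phi>: "\<And>t. Q.h (suspension_flow t (P.h c)) = suspension_flow (\<phi> t) (Q.h (P.h c))"
      using Q.h_flow[OF hc] by blast
    show "flow_orbit (P.h c) \<subseteq> P.h ` flow_orbit c"
    proof
      fix d assume "d \<in> flow_orbit (P.h c)"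
      then obtain t where t: "d = suspension_flow t (P.h c)" by (auto simp: flow_orbit_def)
      have "d \<in> topspace (suspension Y T)" using P.B.flow_in_topspace[OF hc] t by simp
      then have "d = P.h (Q.h d)" by (simp add: inv')
      also have "Q.h d = suspension_flow (\<phi> t) c" using \<phi> inv[OF c] t by simp
      finally show "d \<in> P.h ` flow_orbit c" by (auto simp: flow_orbit_def)
    qed
  qed
  moreover have "homeomorphic_map (suspension X S) (suspension Y T) P.h"
    using maps homeomorphic_map_maps by blast
  ultimately show ?thesis
    unfolding flow_equivalent_def by (intro exI[of _ P.h] conjI ballI P.h_flow)
qed

section \<open>Flow equivalence gives locally conjugate sections\<close>

text \<open>A time change with bounded range would force \<open>cis (\<pi> n)\<close> to converge, because the
  circle coordinate of the suspension is continuous.\<close>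

lemma (in homeo_system) time_change_unbounded:
  fixes T :: "'b::topological_space \<Rightarrow> 'b" and \<phi> :: "real \<Rightarrow> real"
  assumes Y: "homeo_system Y T" and maps: "homeomorphic_maps (suspension X S) (suspension Y T) h h'"
    and c: "c \<in> topspace (suspension X S)"
    and \<phi>: "\<And>t. h (suspension_flow t c) = suspension_flow (\<phi> t) (h c)"
    and \<sigma>: "\<sigma> = 1 \<or> \<sigma> = (-1::real)"
  shows "\<not> convergent (\<lambda>n. \<phi> (\<sigma> * real n / 2))"
proof
  interpret B: homeo_system Y T by fact
  assume "convergent (\<lambda>n. \<phi> (\<sigma> * real n / 2))"
  then obtain L where L: "(\<lambda>n. \<phi> (\<sigma> * real n / 2)) \<longlonglongrightarrow> L" by (auto simp: convergent_def)
  obtain x s where xs: "x \<in> X" "c = q (x, s)" using c by (rule topspace_suspE)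
  have "h c \<in> topspace (suspension Y T)"
    using maps c by (auto simp: homeomorphic_maps_def continuous_map_def)
  then obtain y u where yu: "y \<in> Y" "h c = B.q (y, u)" by (rule B.topspace_suspE)
  \<comment> \<open>The circle coordinate: the action changes the real coordinate by integers only,
    so \<open>g\<close> descends to the suspension.\<close>
  define g :: "'a \<times> real \<Rightarrow> complex" where "g p = cis (2 * pi * snd p)" for p
  have ginv: "g (It n x, s) = g (x, s + of_int n)" for x n s
    by (simp add: g_def distrib_left flip: cis_mult)
  have "continuous_map (top_of_set (X \<times> UNIV)) euclidean g"
    by (auto simp: g_def[abs_def] intro!: continuous_intros)
  then have l: "continuous_map (suspension X S) euclidean (lift g)"
    using continuous_lift[of g euclidean] ginv by simp
  have lg: "lift g (q (x, s)) = cis (2 * pi * s)" for s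
    using lift_class[of g x s] ginv xs by (simp add: g_def)
  let ?F = "\<lambda>v. lift g (h' (B.q (y, v)))"
  have "continuous_map euclideanreal (top_of_set (Y \<times> UNIV)) (\<lambda>v. (y, v))"
    using yu by (simp add: continuous_map_in_subtopology, intro continuous_intros)
  from continuous_map_compose[OF this B.continuous_class]
  have "continuous_map euclideanreal (suspension Y T) (\<lambda>v. B.q (y, v))" by (simp add: comp_def)
  moreover have "continuous_map (suspension Y T) (suspension X S) h'"
    using maps by (simp add: homeomorphic_maps_def)
  ultimately have "continuous_map euclideanreal euclidean (lift g \<circ> (h' \<circ> (\<lambda>v. B.q (y, v))))"
    using l by (intro continuous_map_compose)
  then have "continuous_on UNIV ?F" by (simp add: comp_def)
  then have "isCont ?F v" for v
    by (simp add: continuous_on_eq_continuous_within)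
  moreover have "(\<lambda>n. u + \<phi> (\<sigma> * real n / 2)) \<longlonglongrightarrow> u + L" by (intro tendsto_intros L)
  ultimately have lim: "(\<lambda>n. ?F (u + \<phi> (\<sigma> * real n / 2))) \<longlonglongrightarrow> ?F (u + L)"
    using isCont_tendsto_compose by blast
  have F: "?F (u + \<phi> t) = cis (2 * pi * (s + t))" for t
  proof -
    have "B.q (y, u + \<phi> t) = h (suspension_flow t c)" using \<phi> yu by simp
    moreover have "h' (h (suspension_flow t c)) = suspension_flow t c"
      using maps flow_in_topspace[OF c] by (simp add: homeomorphic_maps_def)
    ultimately show ?thesis using lg xs by simp
  qed
  have "(\<lambda>n. ?F (u + \<phi> (\<sigma> * real (Suc n) / 2)) - ?F (u + \<phi> (\<sigma> * real n / 2))) \<longlonglongrightarrow> ?F (u + L) - ?F (u + L)"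
    by (intro tendsto_diff lim LIMSEQ_Suc)
  then have "(\<lambda>n. norm (?F (u + \<phi> (\<sigma> * real (Suc n) / 2)) - ?F (u + \<phi> (\<sigma> * real n / 2)))) \<longlonglongrightarrow> norm (0::complex)"
    by (intro tendsto_norm) simp
  \<comment> \<open>Half a unit of time is half a turn, so consecutive values are antipodal on the
    unit circle.\<close>
  moreover have "norm (?F (u + \<phi> (\<sigma> * real (Suc n) / 2)) - ?F (u + \<phi> (\<sigma> * real n / 2))) = 2" for n
  proof -
    let ?a = "2 * pi * (s + \<sigma> * real n / 2)"
    have "2 * pi * (s + \<sigma> * real (Suc n) / 2) = ?a + \<sigma> * pi" by (simp add: field_simps)
    moreover have "cis (\<sigma> * pi) = -1" using \<sigma> by (auto simp: cis.code complex_eq_iff)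
    ultimately have "cis (2 * pi * (s + \<sigma> * real (Suc n) / 2)) = - cis ?a"
      by (simp flip: cis_mult)
    then show ?thesis unfolding F by (simp add: norm_mult flip: mult_2)
  qed
  ultimately have "(\<lambda>n::nat. 2::real) \<longlonglongrightarrow> 0" by simp
  then show False by (simp add: LIMSEQ_const_iff)
qed

text \<open>Surjectivity replaces continuity: an increasing bijection of the line is continuous
  anyway, and this form passes to the inverse map directly. The normalisation
  \<open>\<phi> 0 = 0\<close> lets signs of times be compared.\<close>

definition time_changes ::
    "'a set \<Rightarrow> ('a::topological_space \<Rightarrow> 'a) \<Rightarrow> (('a \<times> real) set \<Rightarrow> ('b \<times> real) set) \<Rightarrow> bool" where
  "time_changes X S h \<longleftrightarrow> (\<forall>c \<in> topspace (suspension X S). \<exists>\<phi>. strict_mono \<phi> \<and> surj \<phi> \<and> \<phi> 0 = 0 \<and>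
     (\<forall>t. h (suspension_flow t c) = suspension_flow (\<phi> t) (h c)))"

text \<open>A time change bounded above or below would converge along half-integer times by
  monotonicity, which \<open>time_change_unbounded\<close> forbids; the intermediate value theorem
  then gives surjectivity.\<close>

lemma flow_equivalentD:
  assumes X: "homeo_system X S" and Y: "homeo_system Y T" and "flow_equivalent X S Y T"
  obtains h h' where "homeomorphic_maps (suspension X S) (suspension Y T) h h'" "time_changes X S h"
proof -
  interpret A: homeo_system X S by fact
  obtain h where h: "homeomorphic_map (suspension X S) (suspension Y T) h"
    and *: "\<And>c. c \<in> topspace (suspension X S) \<Longrightarrow> \<exists>\<phi>. continuous_on UNIV \<phi> \<and> strict_mono \<phi> \<and>
              (\<forall>t. h (suspension_flow t c) = suspension_flow (\<phi> t) (h c))"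
    using assms(3) unfolding flow_equivalent_def by blast
  obtain h' where maps: "homeomorphic_maps (suspension X S) (suspension Y T) h h'"
    using h homeomorphic_map_maps by blast
  have "time_changes X S h"
    unfolding time_changes_def
  proof
    fix c assume c: "c \<in> topspace (suspension X S)"
    obtain \<phi> where \<phi>: "continuous_on UNIV \<phi>" "strict_mono \<phi>"
      "\<And>t. h (suspension_flow t c) = suspension_flow (\<phi> t) (h c)"
      using *[OF c] by blast
    have le: "\<phi> s \<le> \<phi> t \<longleftrightarrow> s \<le> t" for s t using \<phi>(2) by (simp add: strict_mono_less_eq)
    have up: "\<exists>t. L < \<phi> t" for L
    proof (rule ccontr)
      assume "\<not> ?thesis"
      then have "\<phi> t \<le> L" for t by (simp add: not_less)
      then have "\<phi> 0 \<le> \<phi> (1 * real n / 2) \<and> \<phi> (1 * real n / 2) \<le> L" for n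
        by (simp add: le)
      then have "norm (\<phi> (1 * real n / 2)) \<le> \<bar>L\<bar> + \<bar>\<phi> 0\<bar>" for n
        by (smt (verit, best) real_norm_def)
      then have "Bseq (\<lambda>n. \<phi> (1 * real n / 2))" by (rule BseqI')
      moreover have "monoseq (\<lambda>n. \<phi> (1 * real n / 2))"
        by (intro monoI1) (simp add: le)
      ultimately show False
        using Bseq_monoseq_convergent A.time_change_unbounded[OF Y maps c \<phi>(3), of 1] by blast
    qed
    have dn: "\<exists>t. \<phi> t < L" for L
    proof (rule ccontr)
      assume "\<not> ?thesis"
      then have "L \<le> \<phi> t" for t by (simp add: not_less)
      then have "L \<le> \<phi> (-1 * real n / 2) \<and> \<phi> (-1 * real n / 2) \<le> \<phi> 0" for n
        by (simp add: le)
      then have "norm (\<phi> (-1 * real n / 2)) \<le> \<bar>L\<bar> + \<bar>\<phi> 0\<bar>" for n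
        by (smt (verit, best) real_norm_def)
      then have "Bseq (\<lambda>n. \<phi> (-1 * real n / 2))" by (rule BseqI')
      moreover have "monoseq (\<lambda>n. \<phi> (-1 * real n / 2))"
        by (intro monoI2) (simp add: le)
      ultimately show False
        using Bseq_monoseq_convergent A.time_change_unbounded[OF Y maps c \<phi>(3), of "-1"] by blast
    qed
    have surj: "\<exists>t. \<phi> t = v" for v
    proof -
      obtain a b where "\<phi> a < v" "v < \<phi> b" using up dn by blast
      moreover from this have "a \<le> b" using le[of a b] by simp
      ultimately show ?thesis
        using IVT'[of \<phi> a v b] continuous_on_subset[OF \<phi>(1)] by fastforce
    qed
    \<comment> \<open>On a periodic orbit \<open>\<phi> 0\<close> may be a non-zero period. Flowing
      by it fixes \<open>h c\<close>, so it can be subtracted.\<close>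
    let ?\<phi> = "\<lambda>t. \<phi> t - \<phi> 0"
    have "h (suspension_flow t c) = suspension_flow (?\<phi> t) (h c)" for t
    proof -
      have "h c = suspension_flow (\<phi> 0) (h c)" using \<phi>(3)[of 0] by simp
      then have "suspension_flow (?\<phi> t) (h c) = suspension_flow (?\<phi> t) (suspension_flow (\<phi> 0) (h c))" by simp
      then show ?thesis using \<phi>(3) by (simp add: suspension_flow_add)
    qed
    moreover have "surj ?\<phi>"
    proof (rule surjI)
      show "?\<phi> (SOME t. \<phi> t = v + \<phi> 0) = v" for v using someI_ex[OF surj[of "v + \<phi> 0"]] by simp
    qed
    ultimately show "\<exists>\<phi>. strict_mono \<phi> \<and> surj \<phi> \<and> \<phi> 0 = 0 \<and>
        (\<forall>t. h (suspension_flow t c) = suspension_flow (\<phi> t) (h c))"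
      using \<phi>(2) by (intro exI[of _ ?\<phi>]) (simp add: strict_mono_def)
  qed
  then show ?thesis using maps that by blast
qed

lemma time_changes_inverse:
  assumes maps: "homeomorphic_maps (suspension X S) (suspension Y T) h h'" and h: "time_changes X S h"
    and X: "homeo_system X S"
  shows "time_changes Y T h'"
  unfolding time_changes_def
proof
  interpret A: homeo_system X S by fact
  fix d assume d: "d \<in> topspace (suspension Y T)"
  define c where "c = h' d"
  have c: "c \<in> topspace (suspension X S)" "h c = d"
    using maps d by (auto simp: homeomorphic_maps_def continuous_map_def c_def)
  obtain \<phi> where \<phi>: "strict_mono \<phi>" "surj \<phi>" "\<phi> 0 = 0"
      "\<And>t. h (suspension_flow t c) = suspension_flow (\<phi> t) (h c)"
    using h c unfolding time_changes_def by blast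
  have i: "\<phi> (inv \<phi> t) = t" "inv \<phi> (\<phi> t) = t" for t
    using surj_f_inv_f[OF \<phi>(2)] inv_f_f[OF strict_mono_imp_inj_on[OF \<phi>(1)]] by auto
  have "strict_mono (inv \<phi>)"
    using strict_mono_less[OF \<phi>(1)] i by (metis strict_monoI)
  moreover have "surj (inv \<phi>)" using i by (metis surjI)
  moreover have "inv \<phi> 0 = 0" using i(2)[of 0] \<phi>(3) by simp
  moreover have "h' (suspension_flow t d) = suspension_flow (inv \<phi> t) (h' d)" for t
  proof -
    have "suspension_flow t d = h (suspension_flow (inv \<phi> t) c)" using \<phi>(4) i c by simp
    then show ?thesis
      using maps A.flow_in_topspace[OF c(1)] by (simp add: homeomorphic_maps_def c_def)
  qed
  ultimately show "\<exists>\<phi>. strict_mono \<phi> \<and> surj \<phi> \<and> \<phi> 0 = 0 \<and>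
        (\<forall>t. h' (suspension_flow t d) = suspension_flow (\<phi> t) (h' d))" by blast
qed

section \<open>Flow boxes and transport between cross sections\<close>

context homeo_system
begin

text \<open>A flow box around height \<open>s0\<close>. Identified points have heights differing by
  an integer, so for half-width at most 1 / 2 the coordinates in the box are unique
  (\<open>box_inj\<close>).\<close>

definition box :: "real \<Rightarrow> 'a set \<Rightarrow> real \<Rightarrow> ('a \<times> real) set set" where
  "box s0 U \<delta> = q ` (U \<times> {s0 - \<delta> <..< s0 + \<delta>})"

lemma open_box: "openin (top_of_set X) U \<Longrightarrow> openin (suspension X S) (box s0 U \<delta>)"
  unfolding box_def by (intro open_class) (auto intro: openin_Times)

lemma boxE:
  assumes "c \<in> box s0 U \<delta>" obtains x s where "x \<in> U" "\<bar>s - s0\<bar> < \<delta>" "c = q (x, s)"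
proof -
  obtain p where "p \<in> U \<times> {s0 - \<delta> <..< s0 + \<delta>}" "c = q p" using assms unfolding box_def by blast
  then show ?thesis by (cases p) (auto simp: abs_diff_less_iff intro!: that)
qed

lemma boxI: "x \<in> U \<Longrightarrow> \<bar>s - s0\<bar> < \<delta> \<Longrightarrow> q (x, s) \<in> box s0 U \<delta>"
  unfolding box_def by (rule imageI) (simp add: abs_diff_less_iff)

lemma box_inj:
  assumes "x \<in> X" "x' \<in> X" "\<bar>s - s0\<bar> < 1 / 2" "\<bar>s' - s0\<bar> < 1 / 2" "q (x, s) = q (x', s')"
  shows "x = x'" "s = s'"
proof -
  obtain n where n: "x' = It n x" "s' = s - of_int n" using class_eq_iff assms by blast
  then have "n = 0" using assms(3,4) by linarith
  then show "x = x'" "s = s'" using n by auto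
qed

definition box_proj :: "real \<Rightarrow> ('a \<times> real) set \<Rightarrow> 'a" where
  "box_proj s0 c = (THE x. x \<in> X \<and> (\<exists>s. \<bar>s - s0\<bar> < 1 / 2 \<and> c = q (x, s)))"

lemma box_proj: "x \<in> X \<Longrightarrow> \<bar>s - s0\<bar> < 1 / 2 \<Longrightarrow> box_proj s0 (q (x, s)) = x"
  unfolding box_proj_def
proof (rule the_equality)
  fix x' assume x: "x \<in> X" "\<bar>s - s0\<bar> < 1 / 2"
    and "x' \<in> X \<and> (\<exists>s'. \<bar>s' - s0\<bar> < 1 / 2 \<and> q (x, s) = q (x', s'))"
  then obtain s' where "x' \<in> X" "\<bar>s' - s0\<bar> < 1 / 2" "q (x, s) = q (x', s')" by blast
  then show "x' = x" using box_inj(1)[of x x' s s0 s'] x by simp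
qed auto

end

locale susp_equiv = A: homeo_system X S + B: homeo_system Y T
  for X :: "'a::topological_space set" and S and Y :: "'b::topological_space set" and T +
  fixes h h'
  assumes maps: "homeomorphic_maps (suspension X S) (suspension Y T) h h'"
    and tc: "time_changes X S h"
begin

lemma hh: "c \<in> topspace (suspension X S) \<Longrightarrow> h' (h c) = c"
  using maps by (simp add: homeomorphic_maps_def)

lemma cont_h: "continuous_map (suspension X S) (suspension Y T) h"
  "continuous_map (suspension Y T) (suspension X S) h'"
  using maps by (auto simp: homeomorphic_maps_def)

text \<open>The holonomy map: \<open>h\<close> carries the cross section at height \<open>s0\<close>
  into a flow box around height \<open>u0\<close>, and the projection slides the image along the
  flow to height \<open>u0\<close>.\<close>

definition \<psi> :: "real \<Rightarrow> real \<Rightarrow> 'a \<Rightarrow> 'b" where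
  "\<psi> s0 u0 x = B.box_proj u0 (h (A.q (x, s0)))"

definition \<psi>' :: "real \<Rightarrow> real \<Rightarrow> 'b \<Rightarrow> 'a" where
  "\<psi>' s0 u0 y = A.box_proj s0 (h' (B.q (y, u0)))"

text \<open>Sliding to height \<open>u0\<close> and applying \<open>h'\<close> returns to the flow
  line of \<open>x\<close> at height \<open>s0 + t\<close> with \<open>\<phi> t = u0 - u\<close>;
  the projection recovers \<open>x\<close> as soon as \<open>\<bar>t\<bar> < 1 / 2\<close>. The
  number \<open>\<eta>\<close> is chosen so that \<open>h'\<close> keeps a box of half-width
  \<open>\<eta>\<close> inside one of half-width 1 / 2, and monotonicity of \<open>\<phi>\<close>
  then bounds \<open>t\<close>.\<close>

lemma left_inverse:
  assumes x0: "x0 \<in> X" and y0: "y0 \<in> Y" "h (A.q (x0, s0)) = B.q (y0, u0)"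
  obtains U where "openin (top_of_set X) U" "x0 \<in> U" "continuous_on U (\<psi> s0 u0)"
    "\<And>x. x \<in> U \<Longrightarrow> \<psi>' s0 u0 (\<psi> s0 u0 x) = x"
    "\<And>x. x \<in> U \<Longrightarrow> \<psi> s0 u0 x \<in> Y \<and> (\<exists>u. \<bar>u - u0\<bar> < 1 / 2 \<and> h (A.q (x, s0)) = B.q (\<psi> s0 u0 x, u))"
proof -
  have "openin (suspension Y T) {d \<in> topspace (suspension Y T). h' d \<in> A.box s0 X (1 / 2)}"
    by (intro openin_continuous_map_preimage[OF cont_h(2)] A.open_box) simp
  from openin_continuous_map_preimage[OF B.continuous_class this]
  have "openin (top_of_set (Y \<times> UNIV)) {p \<in> Y \<times> UNIV. h' (B.q p) \<in> A.box s0 X (1 / 2)}"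
    (is "openin _ ?W") by (auto elim!: back_subst[of "openin _"])
  moreover have "h' (B.q (y0, u0)) = A.q (x0, s0)" using hh[of "A.q (x0, s0)"] x0 y0 by simp
  then have "(y0, u0) \<in> ?W" using x0 y0 A.boxI by simp
  ultimately obtain V I where V: "openin (top_of_set Y) V" "y0 \<in> V" "openin (top_of_set UNIV) I" "u0 \<in> I" "V \<times> I \<subseteq> ?W"
    using Times_in_interior_subtopology[of y0 u0 ?W Y UNIV] by blast
  then have "open I" by simp
  obtain \<eta>0 where e0: "\<eta>0 > 0" "ball u0 \<eta>0 \<subseteq> I" using \<open>open I\<close> V(4) by (meson openE)
  define \<eta> where "\<eta> = min \<eta>0 (1 / 2)"
  have \<eta>: "\<eta> > 0" "\<eta> \<le> 1 / 2" using e0 by (auto simp: \<eta>_def)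
  have Vbox: "h' (B.q (y, u)) \<in> A.box s0 X (1 / 2)" if "y \<in> V" "\<bar>u - u0\<bar> < \<eta>" for y u
  proof -
    have "u \<in> ball u0 \<eta>0" using that by (auto simp: \<eta>_def dist_real_def)
    then have "(y, u) \<in> V \<times> I" using e0 that by auto
    then show ?thesis using V(5) by auto
  qed
  have VY: "V \<subseteq> Y" using openin_imp_subset V by blast
  have pre: "openin (top_of_set X) {x \<in> X. h (A.q (x, s0)) \<in> B.box u0 P \<delta>}"
    if "openin (top_of_set Y) P" for P \<delta>
  proof -
    have "continuous_map (top_of_set X) (top_of_set (X \<times> UNIV)) (\<lambda>x. (x, s0))"
      by (auto intro!: continuous_intros)
    from continuous_map_compose[OF this continuous_map_compose[OF A.continuous_class cont_h(1)]]
    have "continuous_map (top_of_set X) (suspension Y T) (\<lambda>x. h (A.q (x, s0)))" by (simp add: comp_def)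
    from openin_continuous_map_preimage[OF this B.open_box[OF that]] show ?thesis by simp
  qed
  define U where "U = {x \<in> X. h (A.q (x, s0)) \<in> B.box u0 V \<eta>}"
  have U: "\<psi> s0 u0 x \<in> V" "\<exists>u. \<bar>u - u0\<bar> < \<eta> \<and> h (A.q (x, s0)) = B.q (\<psi> s0 u0 x, u)" if "x \<in> U" for x
  proof -
    have "h (A.q (x, s0)) \<in> B.box u0 V \<eta>" using that by (simp add: U_def)
    then obtain y u where *: "y \<in> V" "\<bar>u - u0\<bar> < \<eta>" "h (A.q (x, s0)) = B.q (y, u)" by (rule B.boxE)
    then have "\<psi> s0 u0 x = y" using B.box_proj[of y u u0] \<eta> VY by (auto simp: \<psi>_def)
    then show "\<psi> s0 u0 x \<in> V" "\<exists>u. \<bar>u - u0\<bar> < \<eta> \<and> h (A.q (x, s0)) = B.q (\<psi> s0 u0 x, u)"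
      using * by auto
  qed
  show ?thesis
  proof (rule that[of U])
    show "openin (top_of_set X) U" unfolding U_def using pre V by blast
    show "x0 \<in> U" unfolding U_def using x0 y0 V \<eta> B.boxI by simp
    show "\<psi> s0 u0 x \<in> Y \<and> (\<exists>u. \<bar>u - u0\<bar> < 1 / 2 \<and> h (A.q (x, s0)) = B.q (\<psi> s0 u0 x, u))" if "x \<in> U" for x
      using U[OF that] VY \<eta> by force
    show "\<psi>' s0 u0 (\<psi> s0 u0 x) = x" if x: "x \<in> U" for x
    proof -
      obtain u where u: "\<bar>u - u0\<bar> < \<eta>" "h (A.q (x, s0)) = B.q (\<psi> s0 u0 x, u)" using U(2)[OF x] by blast
      have xX: "x \<in> X" using x by (simp add: U_def)
      have yY: "\<psi> s0 u0 x \<in> Y" using U(1)[OF x] VY by blast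
      obtain \<phi> where \<phi>: "strict_mono \<phi>" "surj \<phi>" "\<phi> 0 = 0"
        "\<And>t. h (suspension_flow t (A.q (x, s0))) = suspension_flow (\<phi> t) (h (A.q (x, s0)))"
        using tc A.class_in_topspace[OF xX, of s0] unfolding time_changes_def by blast
      have key: "h' (B.q (\<psi> s0 u0 x, u + \<phi> t)) = A.q (x, s0 + t)" for t
        using \<phi>(4)[of t] u hh[of "A.q (x, s0 + t)"] xX yY by simp
      \<comment> \<open>At time 1 / 2 or -1 / 2 the line through \<open>x\<close> is outside the
        open box, since no integer is closer than 1 / 2 to these times. Its image must therefore
        have left the \<open>\<eta>\<close>-range.\<close>
      have half: "\<not> \<bar>u + \<phi> t - u0\<bar> < \<eta>" if "\<bar>t\<bar> = 1 / 2" for t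
      proof
        assume "\<bar>u + \<phi> t - u0\<bar> < \<eta>"
        then have "A.q (x, s0 + t) \<in> A.box s0 X (1 / 2)" using Vbox[OF U(1)[OF x]] key by metis
        then obtain x' s' where *: "x' \<in> X" "\<bar>s' - s0\<bar> < 1 / 2" "A.q (x, s0 + t) = A.q (x', s')" by (rule A.boxE)
        then obtain n where "s' = s0 + t - of_int n" using A.class_eq_iff[OF xX] by blast
        then have "\<bar>t - of_int n\<bar> < 1 / 2" using * by simp
        then have "2 * real_of_int n - 1 < 2 * t" "2 * t < 2 * real_of_int n + 1"
          by linarith+
        moreover have "2 * t = 1 \<or> 2 * t = - 1" using that by (auto simp: abs_if split: if_splits)
        ultimately have "real_of_int (2 * n - 1) < real_of_int 1 \<and> real_of_int 1 < real_of_int (2 * n + 1)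
            \<or> real_of_int (2 * n - 1) < real_of_int (- 1) \<and> real_of_int (- 1) < real_of_int (2 * n + 1)"
          by auto
        then show False unfolding of_int_less_iff by presburger
      qed
      \<comment> \<open>If this \<open>t\<close> were beyond 1 / 2 in size, the image at time 1 / 2
        or -1 / 2 would lie between heights \<open>u\<close> and \<open>u0\<close>, hence still
        within \<open>\<eta>\<close> of \<open>u0\<close>.\<close>
      obtain t where t: "\<phi> t = u0 - u" using \<phi>(2) by (metis surjD)
      have "\<bar>t\<bar> < 1 / 2"
      proof (rule ccontr)
        assume "\<not> ?thesis"
        then consider "t \<ge> 1 / 2" | "t \<le> - (1 / 2)" by linarith
        then show False
        proof cases
          case 1
          then have "\<phi> 0 \<le> \<phi> (1 / 2)" "\<phi> (1 / 2) \<le> \<phi> t"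
            using strict_mono_less_eq[OF \<phi>(1)] by simp_all
          then have "\<bar>u + \<phi> (1 / 2) - u0\<bar> < \<eta>" using u(1) t \<phi>(3) by linarith
          then show False using half[of "1 / 2"] by simp
        next
          case 2
          then have "\<phi> (- (1 / 2)) \<le> \<phi> 0" "\<phi> t \<le> \<phi> (- (1 / 2))"
            using strict_mono_less_eq[OF \<phi>(1)] by simp_all
          then have "\<bar>u + \<phi> (- (1 / 2)) - u0\<bar> < \<eta>" using u(1) t \<phi>(3) by linarith
          then show False using half[of "- (1 / 2)"] by simp
        qed
      qed
      moreover have "h' (B.q (\<psi> s0 u0 x, u0)) = A.q (x, s0 + t)" using key[of t] t by simp
      ultimately show ?thesis unfolding \<psi>'_def using A.box_proj[OF xX, of "s0 + t" s0] by simp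
    qed
    show "continuous_on U (\<psi> s0 u0)"
    proof -
      have "openin (top_of_set U) {x \<in> U. \<psi> s0 u0 x \<in> P}" if P: "openin (top_of_set Y) P" for P
      proof -
        have PY: "P \<subseteq> Y" using openin_imp_subset P by blast
        \<comment> \<open>Preimages under the holonomy are preimages of open flow boxes, which gives
          continuity.\<close>
        have "{x \<in> U. \<psi> s0 u0 x \<in> P} = U \<inter> {x \<in> X. h (A.q (x, s0)) \<in> B.box u0 P (1 / 2)}"
        proof (intro equalityI subsetI)
          fix x assume x: "x \<in> {x \<in> U. \<psi> s0 u0 x \<in> P}"
          then obtain u where "\<bar>u - u0\<bar> < \<eta>" "h (A.q (x, s0)) = B.q (\<psi> s0 u0 x, u)" using U(2) by blast
          then show "x \<in> U \<inter> {x \<in> X. h (A.q (x, s0)) \<in> B.box u0 P (1 / 2)}"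
            using x \<eta> by (auto simp: U_def intro!: B.boxI)
        next
          fix x assume x: "x \<in> U \<inter> {x \<in> X. h (A.q (x, s0)) \<in> B.box u0 P (1 / 2)}"
          then have "h (A.q (x, s0)) \<in> B.box u0 P (1 / 2)" by simp
          then obtain y u where *: "y \<in> P" "\<bar>u - u0\<bar> < 1 / 2" "h (A.q (x, s0)) = B.q (y, u)" by (rule B.boxE)
          then have "\<psi> s0 u0 x = y" using B.box_proj[of y u u0] PY by (auto simp: \<psi>_def)
          then show "x \<in> {x \<in> U. \<psi> s0 u0 x \<in> P}" using x * by simp
        qed
        moreover have "openin (top_of_set X) (U \<inter> {x \<in> X. h (A.q (x, s0)) \<in> B.box u0 P (1 / 2)})"
          using pre[OF P, of "1 / 2"] pre[OF V(1), of \<eta>] U_def by (simp add: openin_Int)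
        ultimately show ?thesis by (auto intro: openin_subset_trans simp: U_def)
      qed
      then have "continuous_map (top_of_set U) (top_of_set Y) (\<psi> s0 u0)"
        using U(1) VY by (auto simp: continuous_map_def)
      then show ?thesis by simp
    qed
  qed
qed

lemma inverse_susp_equiv: "susp_equiv Y T X S h' h"
proof (intro susp_equiv.intro susp_equiv_axioms.intro A.homeo_system_axioms B.homeo_system_axioms)
  show "homeomorphic_maps (suspension Y T) (suspension X S) h' h"
    by (rule homeomorphic_maps_sym[THEN iffD1, OF maps])
  show "time_changes Y T h'"
    by (rule time_changes_inverse[OF maps tc A.homeo_system_axioms])
qed

end

text \<open>Visits of \<open>x\<close> to \<open>C\<close> are the crossings of its flow line with
  the section over \<open>C\<close> at height \<open>s0\<close>. The map \<open>h\<close> carries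
  them in order to crossings near height \<open>u0\<close>, displaced by less than 1 / 2, so first
  returns correspond to first returns.\<close>

lemma susp_equiv_local_conjugacy:
  assumes "susp_equiv X S Y T h h'"
    and mX: "minimal_system X S" and mY: "minimal_system Y T"
    and x0: "x0 \<in> X"
  obtains U \<psi> \<psi>' where "openin (top_of_set X) U" "x0 \<in> U"
    "\<And>C. C \<subseteq> U \<Longrightarrow> C \<noteq> {} \<Longrightarrow> openin (top_of_set X) C \<Longrightarrow> closedin (top_of_set X) C \<Longrightarrow>
      conj_sections X S C Y T (\<psi> ` C) \<psi> \<psi>'"
proof -
  interpret P: susp_equiv X S Y T h h' by fact
  interpret Q: susp_equiv Y T X S h' h by (rule P.inverse_susp_equiv)
  define s0 :: real where "s0 = 0"
  have "h (P.A.q (x0, s0)) \<in> topspace (suspension Y T)"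
    using P.cont_h(1) x0 by (auto simp: continuous_map_def)
  then obtain y0 u0 where y0: "y0 \<in> Y" "h (P.A.q (x0, s0)) = P.B.q (y0, u0)" by (rule P.B.topspace_suspE)
  have "h' (P.B.q (y0, u0)) = P.A.q (x0, s0)" using P.hh[of "P.A.q (x0, s0)"] x0 y0 by simp
  note Q_li = Q.left_inverse[OF y0(1) x0 this]
  define f where "f = P.\<psi> s0 u0"
  define g where "g = P.\<psi>' s0 u0"
  have fg: "Q.\<psi> u0 s0 = g" "Q.\<psi>' u0 s0 = f"
    by (simp_all add: fun_eq_iff f_def g_def P.\<psi>_def P.\<psi>'_def Q.\<psi>_def Q.\<psi>'_def)
  obtain U where U: "openin (top_of_set X) U" "x0 \<in> U" "continuous_on U f"
    "\<And>x. x \<in> U \<Longrightarrow> g (f x) = x"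
    and U2: "\<And>x. x \<in> U \<Longrightarrow> f x \<in> Y \<and> (\<exists>u. \<bar>u - u0\<bar> < 1 / 2 \<and> h (P.A.q (x, s0)) = P.B.q (f x, u))"
    by (rule P.left_inverse[OF x0 y0, folded f_def g_def]) (rule that)
  obtain W where W: "openin (top_of_set Y) W" "y0 \<in> W" "continuous_on W g"
    "\<And>y. y \<in> W \<Longrightarrow> f (g y) = y"
    and W2: "\<And>y. y \<in> W \<Longrightarrow> g y \<in> X \<and> (\<exists>s. \<bar>s - s0\<bar> < 1 / 2 \<and> h' (P.B.q (y, u0)) = P.A.q (g y, s))"
    by (rule Q_li[unfolded fg]) (rule that)
  have UX: "U \<subseteq> X" and WY: "W \<subseteq> Y" using U W openin_imp_subset by blast+
  have f0: "f x0 = y0"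
    unfolding f_def P.\<psi>_def y0(2) using y0 by (intro P.B.box_proj) auto
  \<comment> \<open>Requiring \<open>f x \<in> W\<close> makes the image of a clopen
    \<open>C\<close> the preimage of \<open>C\<close> under \<open>g\<close> in \<open>W\<close>,
    hence open. Its closedness comes from compactness.\<close>
  define U' where "U' = {x \<in> U. f x \<in> W}"
  have "continuous_map (top_of_set U) (top_of_set Y) f"
    using U(3) U2 by (auto simp: continuous_map_in_subtopology)
  from openin_continuous_map_preimage[OF this W(1)] have "openin (top_of_set U) U'"
    by (simp add: U'_def)
  then have oU': "openin (top_of_set X) U'" using U(1) openin_trans by blast
  \<comment> \<open>The offset \<open>eps x\<close> measures how far from height \<open>u0\<close>
    the image of the cross section lies over \<open>f x\<close>.\<close>
  have "\<forall>x\<in>U. \<exists>e. \<bar>e\<bar> < 1 / 2 \<and> h (P.A.q (x, s0)) = P.B.q (f x, u0 + e)"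
  proof
    fix x assume "x \<in> U"
    then obtain u where "\<bar>u - u0\<bar> < 1 / 2" "h (P.A.q (x, s0)) = P.B.q (f x, u)" using U2 by blast
    then show "\<exists>e. \<bar>e\<bar> < 1 / 2 \<and> h (P.A.q (x, s0)) = P.B.q (f x, u0 + e)"
      by (intro exI[of _ "u - u0"]) simp
  qed
  then obtain eps where eps: "\<And>x. x \<in> U \<Longrightarrow> \<bar>eps x\<bar> < 1 / 2"
    "\<And>x. x \<in> U \<Longrightarrow> h (P.A.q (x, s0)) = P.B.q (f x, u0 + eps x)"
    by (metis (no_types))
  show ?thesis
  proof (rule that[OF oU'])
    show "x0 \<in> U'" using U W f0 by (simp add: U'_def)
    fix C assume C: "C \<subseteq> U'" "C \<noteq> {}" "openin (top_of_set X) C" "closedin (top_of_set X) C"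
    have CU: "C \<subseteq> U" and CX: "C \<subseteq> X" using C UX by (auto simp: U'_def)
    define D where "D = f ` C"
    have D_eq: "D = {y \<in> W. g y \<in> C}"
    proof
      show "D \<subseteq> {y \<in> W. g y \<in> C}" using C U(4) by (auto simp: D_def U'_def)
      show "{y \<in> W. g y \<in> C} \<subseteq> D" unfolding D_def using W(4) by (metis (mono_tags, lifting) image_eqI mem_Collect_eq subsetI)
    qed
    have "continuous_map (top_of_set W) (top_of_set X) g"
      using W(3) W2 by (auto simp: continuous_map_in_subtopology)
    from openin_continuous_map_preimage[OF this C(3)] have "openin (top_of_set W) D"
      by (simp add: D_eq)
    then have oD: "openin (top_of_set Y) D" using W(1) openin_trans by blast
    have DY: "D \<subseteq> Y" using D_eq WY by auto
    have fC: "continuous_on C f" using U(3) CU by (rule continuous_on_subset)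
    have "compact X" using mX by (simp add: minimal_system_def dyn_system_def)
    then have "compact C" using C(4) closedin_compact by blast
    then have "compact D" unfolding D_def using fC by (intro compact_continuous_image)
    then have "compactin (top_of_set Y) D" using DY by (simp add: compactin_subtopology)
    moreover have "Hausdorff_space (top_of_set Y)"
      using mY metrizable_imp_Hausdorff_space by (auto simp: minimal_system_def dyn_system_def)
    ultimately have cD: "closedin (top_of_set Y) D" by (simp add: compactin_imp_closedin)
    interpret CX: clopen_section X S C by (rule minimal_system_section[OF mX C(3,4,2)])
    have Dne: "D \<noteq> {}" using C(2) by (simp add: D_def)
    interpret DY: clopen_section Y T D by (rule minimal_system_section[OF mY oD cD Dne])
    have hom: "homeomorphism C D f g"
      using C(1) U(4) W(4) fC continuous_on_subset[OF W(3), of D] CU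
      by (intro homeomorphismI) (auto simp: D_eq U'_def)
    have conj: "f (CX.fr x) = DY.fr (f x)" if x: "x \<in> C" for x
    proof -
      have xU: "x \<in> U" "x \<in> X" "f x \<in> Y" using x CU CX U2 by auto
      obtain \<phi> where \<phi>: "strict_mono \<phi>" "surj \<phi>" "\<phi> 0 = 0"
        "\<And>t. h (suspension_flow t (P.A.q (x, s0))) = suspension_flow (\<phi> t) (h (P.A.q (x, s0)))"
        using P.tc P.A.class_in_topspace[OF xU(2), of s0] unfolding time_changes_def by blast
      have line: "h (P.A.q (x, s0 + t)) = P.B.q (f x, u0 + eps x + \<phi> t)" for t
        using \<phi>(4)[of t] eps(2)[OF xU(1)] xU by simp
      txt \<open>\<open>m\<close> is an increasing bijection from the visit times of \<open>x\<close> to \<open>C\<close> onto those of \<open>f x\<close> to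
        \<open>D\<close>; it is strictly increasing because \<open>\<bar>eps\<bar> < 1 / 2\<close>.\<close>
      define m where "m n = \<phi> (of_int n) + eps x - eps (P.A.It n x)" for n :: int
      have M: "\<exists>k. f (P.A.It n x) = P.B.It k (f x) \<and> of_int k = m n" if n: "P.A.It n x \<in> C" for n
      proof -
        have nU: "P.A.It n x \<in> U" "f (P.A.It n x) \<in> Y" using n CU U2 by auto
        have "P.B.q (f x, u0 + eps x + \<phi> (of_int n)) = P.B.q (f (P.A.It n x), u0 + eps (P.A.It n x))"
          using line[of "of_int n"] eps(2)[OF nU(1)] P.A.class_shift[OF xU(2), of n s0] by simp
        then obtain k where "f (P.A.It n x) = P.B.It k (f x)"
          "u0 + eps (P.A.It n x) = u0 + eps x + \<phi> (of_int n) - of_int k"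
          using P.B.class_eq_iff[OF xU(3) nU(2)] by blast
        then show ?thesis by (intro exI[of _ k]) (simp add: m_def)
      qed
      have M': "\<exists>n. P.A.It n x \<in> C \<and> of_int k = m n" if k: "P.B.It k (f x) \<in> D" for k
      proof -
        obtain z where z: "z \<in> C" "f z = P.B.It k (f x)" using k unfolding D_def by (metis imageE)
        have zU: "z \<in> U" "z \<in> X" using z CU CX by auto
        obtain t where t: "\<phi> t = eps z + of_int k - eps x" using \<phi>(2) by (metis surjD)
        have "h (P.A.q (z, s0)) = P.B.q (f x, u0 + eps z + of_int k)"
          using eps(2)[OF zU(1)] z(2) P.B.class_shift[OF xU(3), of k "u0 + eps z"] by simp
        also have "\<dots> = h (P.A.q (x, s0 + t))" using line[of t] t by (simp add: algebra_simps)
        finally have "h' (h (P.A.q (z, s0))) = h' (h (P.A.q (x, s0 + t)))" by simp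
        then have "P.A.q (x, s0 + t) = P.A.q (z, s0)"
          unfolding P.hh[OF P.A.class_in_topspace[OF zU(2)]] P.hh[OF P.A.class_in_topspace[OF xU(2)]]
          by (rule sym)
        then obtain n where n: "z = P.A.It n x" "s0 = s0 + t - of_int n"
          using P.A.class_eq_iff[OF xU(2) zU(2)] by blast
        then show ?thesis using z t by (intro exI[of _ n]) (simp add: m_def)
      qed
      have mono: "m n1 < m n2" if n: "n1 < n2" "P.A.It n1 x \<in> C" "P.A.It n2 x \<in> C" for n1 n2
      proof -
        obtain k1 k2 where k: "f (P.A.It n1 x) = P.B.It k1 (f x)" "of_int k1 = m n1"
          "f (P.A.It n2 x) = P.B.It k2 (f x)" "of_int k2 = m n2"
          using M[OF n(2)] M[OF n(3)] by blast
        have lt: "\<phi> (of_int n1) < \<phi> (of_int n2)" using \<phi>(1) n(1) by (simp add: strict_mono_less)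
        have "\<bar>eps (P.A.It n1 x)\<bar> < 1 / 2" "\<bar>eps (P.A.It n2 x)\<bar> < 1 / 2" using n CU eps(1) by auto
        then have "real_of_int k2 > of_int k1 - 1" using lt unfolding k m_def by linarith
        \<comment> \<open>The bound on the offsets gives only \<open>k1 \<le> k2\<close>. Equality
          would make both visits the same point of \<open>C\<close>, with the same offset, and then
          \<open>m\<close> differs because \<open>\<phi>\<close> does.\<close>
        moreover have "k1 \<noteq> k2"
        proof
          assume "k1 = k2"
          then have "g (f (P.A.It n1 x)) = g (f (P.A.It n2 x))" using k by simp
          then have "P.A.It n1 x = P.A.It n2 x" using U(4)[OF subsetD[OF CU n(2)]] U(4)[OF subsetD[OF CU n(3)]] by simp
          then have "m n1 < m n2" using lt by (simp add: m_def)
          then show False using k \<open>k1 = k2\<close> by simp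
        qed
        ultimately have "k1 < k2" by linarith
        then show ?thesis using k by (metis of_int_less_iff)
      qed
      have m0: "m 0 = 0" by (simp add: m_def \<phi>)
      define r where "r = int (CX.rt x)"
      have r: "r > 0" "P.A.It r x \<in> C" using CX.rt_props[OF xU(2)] by (auto simp: r_def)
      obtain k where k: "f (P.A.It r x) = P.B.It k (f x)" "of_int k = m r" using M r by blast
      have "0 < m r" using mono[of 0 r] r x m0 by simp
      then have kpos: "k > 0" using k by simp
      have kD: "P.B.It k (f x) \<in> D" unfolding D_def k(1)[symmetric] by (rule imageI[OF r(2)])
      have "DY.rt (f x) = nat k"
      proof (rule DY.rt_eqI[OF xU(3)])
        fix j assume j: "0 < j" "j < int (nat k)"
        show "P.B.It j (f x) \<notin> D"
        proof
          assume "P.B.It j (f x) \<in> D"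
          then obtain n where n: "P.A.It n x \<in> C" "of_int j = m n" using M' by blast
          have "n > 0"
          proof (rule ccontr)
            assume "\<not> n > 0"
            then have "m n \<le> 0" using mono[of n 0] n x m0 by (cases "n = 0") auto
            then show False using n j by simp
          qed
          then have "r \<le> n" using CX.rt_le[OF xU(2), of "nat n"] n by (simp add: r_def)
          then have "m r \<le> m n" using mono[of r n] r n by (cases "r = n") auto
          then have "k \<le> j" using k(2) n(2) by (metis of_int_le_iff)
          then show False using j kpos by simp
        qed
      qed (use kpos kD in auto)
      then show ?thesis using k(1) kpos by (simp add: CX.fr_eq DY.fr_eq flip: r_def)
    qed
    show "conj_sections X S C Y T (f ` C) f g"
      using hom conj unfolding D_def[symmetric]
      by (intro conj_sections.intro conj_sections_axioms.intro CX.clopen_section_axioms DY.clopen_section_axioms)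
  qed
qed

section \<open>Interval exchange systems have linear complexity\<close>

definition window :: "(int \<Rightarrow> 'a) \<Rightarrow> int \<Rightarrow> nat \<Rightarrow> 'a list" where
  "window x k n = map (\<lambda>i. x (k + int i)) [0..<n]"

lemma window_eq_iff: "window x k n = window y k n \<longleftrightarrow> (\<forall>i. k \<le> i \<and> i < k + int n \<longrightarrow> x i = y i)"
proof
  assume *: "window x k n = window y k n"
  show "\<forall>i. k \<le> i \<and> i < k + int n \<longrightarrow> x i = y i"
  proof (intro allI impI)
    fix i assume i: "k \<le> i \<and> i < k + int n"
    have "window x k n ! nat (i - k) = window y k n ! nat (i - k)" using * by simp
    moreover have "nat (i - k) < n" "k + int (nat (i - k)) = i" using i by auto
    ultimately show "x i = y i" by (simp add: window_def)
  qed
qed (auto simp: window_def)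

section \<open>Interval exchanges as injective piecewise translations, and their cut points\<close>

context
  fixes d :: nat and \<pi> lam
  assumes data: "iet_data d \<pi> lam"
begin

lemma lam_pos: "k \<in> {1..d} \<Longrightarrow> lam k > 0"
  using data by (simp add: iet_data_def)

lemma alpha_mono: "i \<le> j \<Longrightarrow> j \<le> d \<Longrightarrow> iet_alpha lam i \<le> iet_alpha lam j"
  unfolding iet_alpha_def by (rule sum_mono2) (auto intro: less_imp_le[OF lam_pos])

lemma interval_unique:
  assumes "k \<in> {1..d}" "k' \<in> {1..d}" "x \<in> iet_interval lam k" "x \<in> iet_interval lam k'"
  shows "k = k'"
proof -
  have "\<not> i < j" if "i \<in> {1..d}" "j \<in> {1..d}" "x \<in> iet_interval lam i" "x \<in> iet_interval lam j" for i j
  proof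
    assume "i < j"
    then have "iet_alpha lam i \<le> iet_alpha lam (j - 1)" using that by (intro alpha_mono) auto
    then show False using that by (auto simp: iet_interval_def)
  qed
  then show ?thesis using assms by (metis linorder_neqE_nat)
qed

definition disp :: "nat \<Rightarrow> real" where
  "disp k = (\<Sum>l | l \<in> {1..d} \<and> l > k \<and> \<pi> l < \<pi> k. lam l) - (\<Sum>l | l \<in> {1..d} \<and> l < k \<and> \<pi> l > \<pi> k. lam l)"

lemma iet_eq:
  assumes "k \<in> {1..d}" "x \<in> iet_interval lam k"
  shows "iet d \<pi> lam x = x + disp k"
proof -
  have "(THE k. k \<in> {1..d} \<and> x \<in> iet_interval lam k) = k"
    using assms interval_unique by (intro the_equality) blast+
  then show ?thesis by (simp add: iet_def disp_def)
qed

lemma interval_exists: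
  assumes "x \<in> iet_domain d lam" obtains k where "k \<in> {1..d}" "x \<in> iet_interval lam k"
proof -
  let ?k = "LEAST k. x \<le> iet_alpha lam k"
  have xd: "x \<le> iet_alpha lam d" "iet_alpha lam 0 < x" using assms by (auto simp: iet_domain_def)
  have 1: "x \<le> iet_alpha lam ?k" by (rule LeastI[of "\<lambda>k. x \<le> iet_alpha lam k", OF xd(1)])
  have 2: "?k \<le> d" by (rule Least_le[of "\<lambda>k. x \<le> iet_alpha lam k", OF xd(1)])
  have 3: "?k \<noteq> 0" using 1 xd by (intro notI) simp
  then have "\<not> x \<le> iet_alpha lam (?k - 1)" by (intro not_less_Least) simp
  then show ?thesis using 1 2 3 that[of ?k] by (auto simp: iet_interval_def)
qed

text \<open>Intervals to the left of \<open>k\<close> both before and after the exchange cancel;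
  what remains is the left end of the image of the \<open>k\<close>-th interval, the total length
  placed before it.\<close>

lemma alpha_disp:
  assumes k: "k \<in> {1..d}"
  shows "iet_alpha lam (k - 1) + disp k = (\<Sum>l | l \<in> {1..d} \<and> \<pi> l < \<pi> k. lam l)"
proof -
  have inj: "inj \<pi>" using data permutes_inj by (auto simp: iet_data_def)
  let ?A = "{l. l \<in> {1..d} \<and> l < k \<and> \<pi> l > \<pi> k}" and ?B = "{l. l \<in> {1..d} \<and> l < k \<and> \<pi> l < \<pi> k}"
    and ?C = "{l. l \<in> {1..d} \<and> l > k \<and> \<pi> l < \<pi> k}"
  have ne: "\<pi> l \<noteq> \<pi> k" if "l \<noteq> k" for l using inj that by (auto dest: injD)
  have "{1..k - 1} = ?A \<union> ?B"
  proof (intro equalityI subsetI)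
    fix l assume "l \<in> {1..k - 1}"
    then have "l \<in> {1..d}" "l < k" using k by auto
    moreover from this have "\<pi> l < \<pi> k \<or> \<pi> k < \<pi> l" using ne[of l] by linarith
    ultimately show "l \<in> ?A \<union> ?B" by blast
  qed (use k in auto)
  moreover have "sum lam (?A \<union> ?B) = sum lam ?A + sum lam ?B"
    by (rule sum.union_disjoint) auto
  ultimately have 1: "iet_alpha lam (k - 1) = sum lam ?A + sum lam ?B"
    by (simp add: iet_alpha_def)
  have "{l. l \<in> {1..d} \<and> \<pi> l < \<pi> k} = ?B \<union> ?C"
  proof (intro equalityI subsetI)
    fix l assume l: "l \<in> {l. l \<in> {1..d} \<and> \<pi> l < \<pi> k}"
    then have "l < k \<or> k < l" by (cases l k rule: linorder_cases) auto
    then show "l \<in> ?B \<union> ?C" using l by blast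
  qed blast
  moreover have "sum lam (?B \<union> ?C) = sum lam ?B + sum lam ?C"
    by (rule sum.union_disjoint) auto
  ultimately show ?thesis using 1 by (simp add: disp_def)
qed

lemma iet_image_bounds:
  assumes k: "k \<in> {1..d}" "x \<in> iet_interval lam k"
  shows "(\<Sum>l | l \<in> {1..d} \<and> \<pi> l < \<pi> k. lam l) < iet d \<pi> lam x"
    and "iet d \<pi> lam x \<le> (\<Sum>l | l \<in> {1..d} \<and> \<pi> l \<le> \<pi> k. lam l)"
proof -
  have inj: "inj \<pi>" using data permutes_inj by (auto simp: iet_data_def)
  have "{l. l \<in> {1..d} \<and> \<pi> l \<le> \<pi> k} = insert k {l. l \<in> {1..d} \<and> \<pi> l < \<pi> k}"
    using k inj by (auto simp: le_less dest: injD)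
  then have "(\<Sum>l | l \<in> {1..d} \<and> \<pi> l \<le> \<pi> k. lam l) = lam k + (\<Sum>l | l \<in> {1..d} \<and> \<pi> l < \<pi> k. lam l)"
    by simp
  moreover have "iet_alpha lam k = iet_alpha lam (k - 1) + lam k"
  proof -
    obtain j where "k = Suc j" using k by (cases k) auto
    then show ?thesis by (simp add: iet_alpha_def)
  qed
  ultimately show "(\<Sum>l | l \<in> {1..d} \<and> \<pi> l < \<pi> k. lam l) < iet d \<pi> lam x"
    and "iet d \<pi> lam x \<le> (\<Sum>l | l \<in> {1..d} \<and> \<pi> l \<le> \<pi> k. lam l)"
    using iet_eq[OF k] alpha_disp[OF k(1)] k(2) by (auto simp: iet_interval_def)
qed

lemma iet_inj: "inj_on (iet d \<pi> lam) (iet_domain d lam)"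
proof (rule inj_onI)
  fix x y assume xy: "x \<in> iet_domain d lam" "y \<in> iet_domain d lam" "iet d \<pi> lam x = iet d \<pi> lam y"
  obtain k where k: "k \<in> {1..d}" "x \<in> iet_interval lam k" using interval_exists[OF xy(1)] .
  obtain j where j: "j \<in> {1..d}" "y \<in> iet_interval lam j" using interval_exists[OF xy(2)] .
  have lt: "(\<Sum>l | l \<in> {1..d} \<and> \<pi> l \<le> \<pi> a. lam l) \<le> (\<Sum>l | l \<in> {1..d} \<and> \<pi> l < \<pi> b. lam l)"
    if "\<pi> a < \<pi> b" for a b
    using that by (intro sum_mono2) (auto intro: less_imp_le[OF lam_pos])
  have "\<not> \<pi> k < \<pi> j" "\<not> \<pi> j < \<pi> k"
    using lt[of k j] lt[of j k] iet_image_bounds[OF k] iet_image_bounds[OF j] xy(3) by linarith+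
  then have "\<pi> k = \<pi> j" by simp
  moreover have "inj \<pi>" using data permutes_inj by (auto simp: iet_data_def)
  ultimately have "k = j" by (auto dest: injD)
  moreover have "x + disp k = y + disp j" using iet_eq[OF k] iet_eq[OF j] xy(3) by linarith
  ultimately show "x = y" by simp
qed

lemma iet_in: assumes "x \<in> iet_domain d lam" shows "iet d \<pi> lam x \<in> iet_domain d lam"
proof -
  obtain k where k: "k \<in> {1..d}" "x \<in> iet_interval lam k" using interval_exists[OF assms] .
  have "0 \<le> (\<Sum>l | l \<in> {1..d} \<and> \<pi> l < \<pi> k. lam l)"
    by (intro sum_nonneg) (auto intro: less_imp_le[OF lam_pos])
  moreover have "(\<Sum>l | l \<in> {1..d} \<and> \<pi> l \<le> \<pi> k. lam l) \<le> iet_alpha lam d"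
    unfolding iet_alpha_def by (intro sum_mono2) (auto intro: less_imp_le[OF lam_pos])
  ultimately show ?thesis
    using iet_image_bounds[OF k] by (auto simp: iet_domain_def iet_alpha_def)
qed

lemma iet_pow_in: "x \<in> iet_domain d lam \<Longrightarrow> (iet d \<pi> lam ^^ n) x \<in> iet_domain d lam"
  by (induction n) (simp_all add: iet_in)

lemma iet_pow_inj: "inj_on (iet d \<pi> lam ^^ n) (iet_domain d lam)"
proof (induction n)
  case (Suc n)
  have "inj_on (iet d \<pi> lam \<circ> iet d \<pi> lam ^^ n) (iet_domain d lam)"
    using Suc by (rule comp_inj_on) (rule inj_on_subset[OF iet_inj], use iet_pow_in in auto)
  then show ?case by (simp add: comp_def)
qed auto

text \<open>The points where words of length \<open>n\<close> may change: preimages of internal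
  discontinuities under the first \<open>n\<close> powers, the identity included.\<close>

definition cuts :: "nat \<Rightarrow> real set" where
  "cuts n = {z \<in> iet_domain d lam. \<exists>i<n. \<exists>k\<in>{1..d-1}. (iet d \<pi> lam ^^ i) z = iet_alpha lam k}"

text \<open>By injectivity each pair of a power and a discontinuity contributes at most one
  point.\<close>

lemma card_cuts: "finite (cuts n) \<and> card (cuts n) \<le> n * d"
proof -
  define F where "F i k = {z \<in> iet_domain d lam. (iet d \<pi> lam ^^ i) z = iet_alpha lam k}" for i k
  have eq: "cuts n = (\<Union>i<n. \<Union>k\<in>{1..d-1}. F i k)" unfolding cuts_def F_def by blast
  have le: "finite (F i k) \<and> card (F i k) \<le> 1" for i k
  proof (cases "F i k = {}")
    case False
    then obtain z where z: "z \<in> F i k" by blast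
    have "F i k \<subseteq> {z}"
    proof
      fix w assume "w \<in> F i k"
      then show "w \<in> {z}" using z inj_onD[OF iet_pow_inj[of i], of w z] by (simp add: F_def)
    qed
    then show ?thesis using finite_subset[of "F i k" "{z}"] card_mono[of "{z}" "F i k"] by simp
  qed simp
  have "card (\<Union>k\<in>{1..d-1}. F i k) \<le> d" for i
  proof -
    have "card (\<Union>k\<in>{1..d-1}. F i k) \<le> (\<Sum>k\<in>{1..d-1}. card (F i k))" by (rule card_UN_le) simp
    also have "\<dots> \<le> (\<Sum>k\<in>{1..d-1}. 1)" using le by (intro sum_mono) blast
    finally show ?thesis by simp
  qed
  then have "(\<Sum>i<n. card (\<Union>k\<in>{1..d-1}. F i k)) \<le> (\<Sum>i<n. d)" by (intro sum_mono)
  moreover have "card (cuts n) \<le> (\<Sum>i<n. card (\<Union>k\<in>{1..d-1}. F i k))"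
    unfolding eq by (rule card_UN_le) simp
  moreover have "finite (cuts n)" unfolding eq using le by (intro finite_UN_I) auto
  ultimately show ?thesis by simp
qed

text \<open>Intervals are convex: as long as the end points \<open>x\<close> and \<open>y\<close>
  share an interval, everything between them does too and is moved by the same amount.\<close>

lemma common_translation:
  assumes "x \<in> iet_domain d lam" "y \<in> iet_domain d lam" "x \<le> z" "z \<le> y"
    and same: "\<And>i. i < n \<Longrightarrow> l i \<in> {1..d} \<and> (iet d \<pi> lam ^^ i) x \<in> iet_interval lam (l i)
      \<and> (iet d \<pi> lam ^^ i) y \<in> iet_interval lam (l i)"
  shows "(iet d \<pi> lam ^^ n) z - z = (iet d \<pi> lam ^^ n) x - x
    \<and> (iet d \<pi> lam ^^ n) y - y = (iet d \<pi> lam ^^ n) x - x"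
  using same
proof (induction n)
  case (Suc n)
  have l: "l n \<in> {1..d}" "(iet d \<pi> lam ^^ n) x \<in> iet_interval lam (l n)"
    "(iet d \<pi> lam ^^ n) y \<in> iet_interval lam (l n)" using Suc.prems[of n] by auto
  have IH: "(iet d \<pi> lam ^^ n) z - z = (iet d \<pi> lam ^^ n) x - x"
    "(iet d \<pi> lam ^^ n) y - y = (iet d \<pi> lam ^^ n) x - x" using Suc.IH Suc.prems by auto
  have "(iet d \<pi> lam ^^ n) x \<le> (iet d \<pi> lam ^^ n) z" "(iet d \<pi> lam ^^ n) z \<le> (iet d \<pi> lam ^^ n) y"
    using IH assms(3,4) by linarith+
  then have "(iet d \<pi> lam ^^ n) z \<in> iet_interval lam (l n)"
    using l by (auto simp: iet_interval_def)
  then show ?case using IH l by (simp add: iet_eq[OF l(1)])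
qed simp

text \<open>Up to the first disagreement the whole segment moves by one translation. The right end
  of the interval then containing the image of \<open>x\<close> pulls back to a cut. As intervals
  are closed on the right, the cut may equal \<open>x\<close> but not \<open>y\<close>.\<close>

lemma cut_between:
  assumes x: "x \<in> iet_domain d lam" and y: "y \<in> iet_domain d lam" and xy: "x \<le> y"
    and lx: "\<And>i. i < n \<Longrightarrow> lx i \<in> {1..d} \<and> (iet d \<pi> lam ^^ i) x \<in> iet_interval lam (lx i)"
    and ly: "\<And>i. i < n \<Longrightarrow> ly i \<in> {1..d} \<and> (iet d \<pi> lam ^^ i) y \<in> iet_interval lam (ly i)"
    and diff: "\<exists>i<n. lx i \<noteq> ly i"
  shows "\<exists>z\<in>cuts n. x \<le> z \<and> z < y"
proof -
  define m where "m = (LEAST i. i < n \<and> lx i \<noteq> ly i)"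
  have m: "m < n" "lx m \<noteq> ly m" using LeastI_ex[of "\<lambda>i. i < n \<and> lx i \<noteq> ly i"] diff by (auto simp: m_def)
  have same: "lx i = ly i" if "i < m" for i
    using not_less_Least[of i "\<lambda>i. i < n \<and> lx i \<noteq> ly i"] that m by (auto simp: m_def)
  let ?T = "iet d \<pi> lam ^^ m"
  have tr: "?T z - z = ?T x - x \<and> ?T y - y = ?T x - x" if "x \<le> z" "z \<le> y" for z
  proof (rule common_translation[OF x y that, where l = lx])
    fix i assume "i < m"
    then show "lx i \<in> {1..d} \<and> (iet d \<pi> lam ^^ i) x \<in> iet_interval lam (lx i)
      \<and> (iet d \<pi> lam ^^ i) y \<in> iet_interval lam (lx i)"
      using lx[of i] ly[of i] same[of i] m(1) by simp
  qed
  have Txy: "?T x \<le> ?T y" using tr[of x] xy by linarith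
  have kx: "lx m \<in> {1..d}" "?T x \<in> iet_interval lam (lx m)" and ky: "ly m \<in> {1..d}" "?T y \<in> iet_interval lam (ly m)"
    using lx ly m by auto
  have lt: "lx m < ly m"
  proof (rule ccontr)
    assume "\<not> lx m < ly m"
    then have "iet_alpha lam (ly m) \<le> iet_alpha lam (lx m - 1)" using kx m by (intro alpha_mono) auto
    then show False using kx ky Txy by (auto simp: iet_interval_def)
  qed
  define z where "z = x + (iet_alpha lam (lx m) - ?T x)"
  have "iet_alpha lam (lx m) \<le> iet_alpha lam (ly m - 1)" using lt ky by (intro alpha_mono) auto
  then have le: "?T x \<le> iet_alpha lam (lx m)" "iet_alpha lam (lx m) < ?T y"
    using kx ky by (auto simp: iet_interval_def)
  then have z: "x \<le> z" "z < y" using tr[of x] xy unfolding z_def by linarith+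
  then have "?T z = iet_alpha lam (lx m)" using tr[of z] by (simp add: z_def)
  moreover have "z \<in> iet_domain d lam" using z x y by (auto simp: iet_domain_def)
  moreover have "lx m \<in> {1..d-1}" using kx ky lt by auto
  ultimately have "z \<in> cuts n" unfolding cuts_def using m(1) by blast
  then show ?thesis using z by blast
qed

text \<open>Choose a point for each word and count the cuts strictly to its left. By
  \<open>cut_between\<close> this rank separates words, and it takes at most one value more than
  there are cuts.\<close>

lemma itinerary_words:
  "finite ((\<lambda>x. window x 0 n) ` iet_itineraries d \<pi> lam) \<and>
   card ((\<lambda>x. window x 0 n) ` iet_itineraries d \<pi> lam) \<le> n * d + 1"
proof -
  let ?W = "(\<lambda>x. window x 0 n) ` iet_itineraries d \<pi> lam"
  let ?R = "\<lambda>w x. x \<in> iet_domain d lam \<and>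
    (\<exists>l. w = window l 0 n \<and> (\<forall>i<n. l (int i) \<in> {1..d} \<and> (iet d \<pi> lam ^^ i) x \<in> iet_interval lam (l (int i))))"
  have "\<forall>w\<in>?W. \<exists>x. ?R w x"
  proof
    fix w assume "w \<in> ?W"
    then obtain l x where l: "w = window l 0 n" "x \<in> iet_domain d lam"
      "\<forall>j. l j \<in> {1..d} \<and> iet_power d \<pi> lam j x \<in> iet_interval lam (l j)"
      by (auto simp: iet_itineraries_def)
    have "l (int i) \<in> {1..d} \<and> (iet d \<pi> lam ^^ i) x \<in> iet_interval lam (l (int i))" for i
      using l(3)[THEN spec, of "int i"] by (simp only: int_iterate_of_nat)
    then show "\<exists>x. ?R w x" using l by blast
  qed
  then obtain p where p: "\<And>w. w \<in> ?W \<Longrightarrow> ?R w (p w)" by metis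
  define rank where "rank w = card {z \<in> cuts n. z < p w}" for w
  have lt: "rank v < rank w" if vw: "v \<in> ?W" "w \<in> ?W" "v \<noteq> w" "p v \<le> p w" for v w
  proof -
    obtain l where l: "v = window l 0 n"
      "\<forall>i<n. l (int i) \<in> {1..d} \<and> (iet d \<pi> lam ^^ i) (p v) \<in> iet_interval lam (l (int i))"
      using p[OF vw(1)] by blast
    obtain l' where l': "w = window l' 0 n"
      "\<forall>i<n. l' (int i) \<in> {1..d} \<and> (iet d \<pi> lam ^^ i) (p w) \<in> iet_interval lam (l' (int i))"
      using p[OF vw(2)] by blast
    have "\<exists>i<n. l (int i) \<noteq> l' (int i)"
      using vw(3) l(1) l'(1) unfolding window_def by (metis (no_types, lifting) add_0 atLeastLessThan_iff map_cong set_upt)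
    then obtain z where z: "z \<in> cuts n" "p v \<le> z" "z < p w"
      using cut_between[of "p v" "p w" n "\<lambda>i. l (int i)" "\<lambda>i. l' (int i)"] p vw l l' by blast
    have "{z \<in> cuts n. z < p v} \<subseteq> {z \<in> cuts n. z < p w}" using vw(4) by auto
    \<comment> \<open>The strict inequality in the rank matters: a cut equal to \<open>p v\<close>
      counts for \<open>w\<close> but not for \<open>v\<close>.\<close>
    moreover have "z \<in> {z \<in> cuts n. z < p w}" "z \<notin> {z \<in> cuts n. z < p v}" using z by simp_all
    ultimately have "{z \<in> cuts n. z < p v} \<subset> {z \<in> cuts n. z < p w}" by blast
    moreover have "finite {z \<in> cuts n. z < p w}" using card_cuts[of n] by simp
    ultimately show ?thesis unfolding rank_def by (intro psubset_card_mono)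
  qed
  have inj: "inj_on rank ?W"
  proof (rule inj_onI)
    fix v w assume "v \<in> ?W" "w \<in> ?W" "rank v = rank w"
    then show "v = w" using lt[of v w] lt[of w v] by (metis linear less_irrefl)
  qed
  have "rank ` ?W \<subseteq> {..n * d}"
  proof
    fix r assume "r \<in> rank ` ?W"
    then obtain w where "r = rank w" by blast
    then have "r \<le> card (cuts n)" unfolding rank_def using card_cuts[of n] by (auto intro: card_mono)
    then show "r \<in> {..n * d}" using card_cuts[of n] by simp
  qed
  then have "finite (rank ` ?W)" "card (rank ` ?W) \<le> n * d + 1"
    using finite_subset[of _ "{..n * d}"] card_mono[of "{..n * d}" "rank ` ?W"] by simp_all
  then show ?thesis using inj by (simp add: card_image finite_image_iff)
qed

end

lemma open_window: "open {y :: int \<Rightarrow> nat. window y k n = w}"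
proof (cases "\<exists>x :: int \<Rightarrow> nat. window x k n = w")
  case True
  then obtain x :: "int \<Rightarrow> nat" where x: "window x k n = w" by blast
  have "open ((\<lambda>y :: int \<Rightarrow> nat. y i) -` {x i})" for i
    by (intro open_vimage open_discrete continuous_on_product_coordinates)
  then have "open (\<Inter>i\<in>{k..<k + int n}. (\<lambda>y :: int \<Rightarrow> nat. y i) -` {x i})"
    by (intro open_INT) auto
  moreover have "(\<Inter>i\<in>{k..<k + int n}. (\<lambda>y. y i) -` {x i}) = {y. window y k n = w}"
    unfolding x[symmetric] window_eq_iff by auto
  ultimately show ?thesis by simp
qed simp

text \<open>Fixing a window is an open condition, so taking the closure creates no new
  words.\<close>

lemma encoding_words:
  assumes "iet_data d \<pi> lam"
  shows "finite ((\<lambda>x. window x 0 n) ` iet_encoding d \<pi> lam) \<and>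
    card ((\<lambda>x. window x 0 n) ` iet_encoding d \<pi> lam) \<le> n * d + 1"
proof -
  have "(\<lambda>x. window x 0 n) ` iet_encoding d \<pi> lam \<subseteq> (\<lambda>x. window x 0 n) ` iet_itineraries d \<pi> lam"
  proof
    fix w assume "w \<in> (\<lambda>x. window x 0 n) ` iet_encoding d \<pi> lam"
    then obtain x where x: "x \<in> closure (iet_itineraries d \<pi> lam)" "w = window x 0 n"
      by (auto simp: iet_encoding_def)
    have "{y. window y 0 n = w} \<inter> iet_itineraries d \<pi> lam \<noteq> {}"
      using x open_window[of 0 n w] unfolding closure_iff_nhds_not_empty by blast
    then show "w \<in> (\<lambda>x. window x 0 n) ` iet_itineraries d \<pi> lam" by blast
  qed
  then show ?thesis using itinerary_words[OF assms, of n]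
    by (meson card_mono finite_subset le_trans)
qed

section \<open>Return codings of subshifts\<close>

lemma loc_const_window: "loc_const X (\<lambda>y :: int \<Rightarrow> nat. window y k n)"
  unfolding loc_const_def
proof
  fix w
  have "{y \<in> X. window y k n = w} = X \<inter> {y. window y k n = w}" by auto
  then show "openin (top_of_set X) {y \<in> X. window y k n = w}"
    using open_window[of k n w] by (simp add: openin_open_Int)
qed

lemma window_subset_open:
  assumes "open U" "x \<in> U"
  shows "\<exists>c::nat. {y :: int \<Rightarrow> nat. window y (- int c) (2 * c) = window x (- int c) (2 * c)} \<subseteq> U"
proof -
  have "openin (product_topology (\<lambda>i. euclidean) UNIV) U" using assms(1) by (simp add: open_fun_def)
  then obtain V where V: "x \<in> (\<Pi>\<^sub>E i\<in>UNIV. V i)" "finite {i. V i \<noteq> topspace (euclidean :: nat topology)}"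
    "(\<Pi>\<^sub>E i\<in>UNIV. V i) \<subseteq> U"
    using product_topology_open_contains_basis[of "\<lambda>i. euclidean" UNIV U x] assms(2) by blast
  let ?F = "{i. V i \<noteq> UNIV}"
  have fin: "finite ?F" using V(2) by simp
  \<comment> \<open>The summand 1 is needed because windows run over \<open>- int c \<le> i\<close>
    and \<open>i < int c\<close>, open on the right; the inserted 0 covers an empty
    \<open>?F\<close>.\<close>
  define c where "c = Max (insert 0 ((\<lambda>i. nat \<bar>i\<bar> + 1) ` ?F))"
  have c: "nat \<bar>i\<bar> + 1 \<le> c" if "i \<in> ?F" for i
    unfolding c_def using fin that by (intro Max_ge) auto
  have "{y :: int \<Rightarrow> nat. window y (- int c) (2 * c) = window x (- int c) (2 * c)} \<subseteq> U"
  proof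
    fix y :: "int \<Rightarrow> nat"
    assume "y \<in> {y. window y (- int c) (2 * c) = window x (- int c) (2 * c)}"
    then have eq: "y i = x i" if "- int c \<le> i" "i < int c" for i
      using that unfolding mem_Collect_eq window_eq_iff by simp
    have "y i \<in> V i" for i
    proof (cases "i \<in> ?F")
      case True
      then have "y i = x i" using c[OF True] by (intro eq) linarith+
      then show ?thesis using V(1) by (auto simp: PiE_iff)
    qed simp
    then show "y \<in> U" using V(3) by (auto simp: PiE_iff)
  qed
  then show ?thesis by blast
qed

text \<open>Uniform continuity in the form used by the Curtis-Hedlund-Lyndon theorem: by compactness
  one window of coordinates decides the value at every point.\<close>

lemma loc_const_uniform:
  fixes K :: "(int \<Rightarrow> nat) set"
  assumes K: "compact K" and f: "loc_const K f"
  shows "\<exists>c::nat. \<forall>x\<in>K. \<forall>y\<in>K. (\<forall>i. - int c \<le> i \<and> i < int c \<longrightarrow> x i = y i) \<longrightarrow> f x = f y"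
proof -
  let ?W = "\<lambda>x c. {y \<in> K. window y (- int c) (2 * c) = window x (- int c) (2 * c)}"
  have "\<forall>x\<in>K. \<exists>c. \<forall>y\<in>?W x c. f y = f x"
  proof
    fix x assume x: "x \<in> K"
    have "openin (top_of_set K) {y \<in> K. f y = f x}" using f by (simp add: loc_const_def)
    then obtain O' where O': "open O'" "{y \<in> K. f y = f x} = K \<inter> O'" by (auto simp: openin_open)
    then have "x \<in> O'" using x by auto
    then obtain c where "{y. window y (- int c) (2 * c) = window x (- int c) (2 * c)} \<subseteq> O'"
      using window_subset_open[OF O'(1)] by blast
    then show "\<exists>c. \<forall>y\<in>?W x c. f y = f x" using O'(2) by (intro exI[of _ c]) blast
  qed
  from bchoice[OF this] obtain c where c: "\<And>x y. x \<in> K \<Longrightarrow> y \<in> ?W x (c x) \<Longrightarrow> f y = f x" by blast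
  have "\<forall>w\<in>(\<lambda>x. ?W x (c x)) ` K. openin (top_of_set K) w"
    using loc_const_window[of K] by (auto simp: loc_const_def)
  moreover have "K \<subseteq> \<Union>((\<lambda>x. ?W x (c x)) ` K)" by blast
  ultimately obtain D where D: "D \<subseteq> (\<lambda>x. ?W x (c x)) ` K" "finite D" "K \<subseteq> \<Union>D"
    using K unfolding compact_eq_openin_cover by meson
  obtain F where F: "F \<subseteq> K" "finite F" "D = (\<lambda>x. ?W x (c x)) ` F"
    using finite_subset_image[OF D(2,1)] by blast
  define M where "M = Max (insert 0 (c ` F))"
  have M: "c z \<le> M" if "z \<in> F" for z unfolding M_def using F that by (intro Max_ge) auto
  show ?thesis
  proof (intro exI[of _ M] ballI impI)
    fix x y assume xy: "x \<in> K" "y \<in> K" "\<forall>i. - int M \<le> i \<and> i < int M \<longrightarrow> x i = y i"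
    obtain z where z: "z \<in> F" "x \<in> ?W z (c z)" using D(3) F(3) xy(1) by blast
    have "y \<in> ?W z (c z)"
    proof -
      have "y i = z i" if "- int (c z) \<le> i \<and> i < - int (c z) + int (2 * c z)" for i
      proof -
        have "x i = z i" using z(2) that unfolding mem_Collect_eq window_eq_iff by blast
        moreover have "x i = y i" using xy(3) that M[OF z(1)] by simp
        ultimately show ?thesis by simp
      qed
      then show ?thesis unfolding mem_Collect_eq window_eq_iff using xy(2) by blast
    qed
    then have "f y = f z" using c z(1) F(1) by blast
    moreover have "f x = f z" using c z F(1) by blast
    ultimately show "f x = f y" by simp
  qed
qed

lemma int_sum_cong:
  assumes "\<And>j. min 0 n \<le> j \<Longrightarrow> j < max 0 n \<Longrightarrow> f j = g j"
  shows "int_sum f n = int_sum g n"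
proof -
  have "sum f {0..<n} = sum g {0..<n}" "sum f {n..<0} = sum g {n..<0}"
    using assms by (auto intro!: sum.cong)
  then show ?thesis by (simp add: int_sum_def)
qed

section \<open>Visit times and return blocks in a subshift\<close>

locale subshift_section = clopen_section X shift C for X C
begin

lemma shift_apply: "shift x j = x (j + 1)"
  by (simp add: shift_def)

lemma It_shift: "x \<in> X \<Longrightarrow> It n x j = x (j + n)"
proof -
  assume x: "x \<in> X"
  have "It n x = (\<lambda>j. x (j + n))"
  proof (induction n rule: int_induct[where k = 0])
    case base
    then show ?case by simp
  next
    case (step1 i)
    have "It (i + 1) x j = x (j + (i + 1))" for j
      unfolding It_Suc(1)[OF x, of i] shift_apply step1(2) by (simp add: algebra_simps)
    then show ?case by blast
  next
    case (step2 i)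
    have "shift (It (i - 1) x) = It i x" using It_Suc(1)[OF x, of "i - 1"] by simp
    then have "It (i - 1) x (j - 1 + 1) = x (j - 1 + i)" for j
      unfolding shift_apply[symmetric] using step2(2) by simp
    then have "It (i - 1) x j = x (j + (i - 1))" for j by (simp add: algebra_simps)
    then show ?case by blast
  qed
  then show ?thesis by simp
qed

abbreviation "Fi \<equiv> int_iterate C fr"

lemma Fi_in: "y \<in> C \<Longrightarrow> Fi i y \<in> C"
  by (rule int_iterate_in[OF bij_fr])

lemma Fi_Suc: "y \<in> C \<Longrightarrow> Fi (i + 1) y = fr (Fi i y)"
  using int_iterate_Suc[OF bij_fr, of y i] by simp

lemma Fi_add: "y \<in> C \<Longrightarrow> Fi (i + j) y = Fi i (Fi j y)"
  by (rule int_iterate_add[OF bij_fr])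

text \<open>For \<open>y\<close> in \<open>C\<close>, the time of its \<open>i\<close>-th visit to
  \<open>C\<close>, negative for past visits (\<open>Fi_eq\<close>).\<close>

definition R :: "(int \<Rightarrow> nat) \<Rightarrow> int \<Rightarrow> int" where
  "R y = int_sum (\<lambda>j. int (rt (Fi j y)))"

lemma R_0 [simp]: "R y 0 = 0"
  by (simp add: R_def)

lemma R_Suc: "R y (i + 1) = R y i + int (rt (Fi i y))"
  by (simp add: R_def int_sum_Suc)

lemma Fi_eq:
  assumes y: "y \<in> C" shows "Fi i y = It (R y i) y"
proof (induction i rule: int_induct[where k = 0])
  case base
  then show ?case by simp
next
  case (step1 i)
  have "Fi (i + 1) y = It (int (rt (Fi i y))) (It (R y i) y)"
    unfolding step1(2)[symmetric] fr_eq[symmetric] by (rule Fi_Suc[OF y])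
  then show ?case using R_Suc[of y i] It_add[of y "int (rt (Fi i y))" "R y i"] C_sub y
    by (auto simp: add.commute)
next
  case (step2 i)
  have yX: "y \<in> X" "Fi (i - 1) y \<in> X" using C_sub y Fi_in[OF y] by auto
  have "It (int (rt (Fi (i - 1) y))) (Fi (i - 1) y) = It (R y i) y"
    unfolding step2(2)[symmetric] fr_eq[symmetric] using Fi_Suc[OF y, of "i - 1"] by simp
  then have "Fi (i - 1) y = It (- int (rt (Fi (i - 1) y))) (It (R y i) y)"
    using It_neg(1)[OF yX(2), of "int (rt (Fi (i - 1) y))"] by simp
  also have "\<dots> = It (- int (rt (Fi (i - 1) y)) + R y i) y"
    by (rule It_add[OF yX(1), symmetric])
  also have "- int (rt (Fi (i - 1) y)) + R y i = R y (i - 1)" using R_Suc[of y "i - 1"] by simp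
  finally show ?case .
qed

lemma R_lower: assumes "y \<in> C" "i \<le> j" shows "j - i \<le> R y j - R y i"
proof -
  have "1 \<le> int (rt (Fi k y))" for k using rt_props(1)[of "Fi k y"] Fi_in[OF assms(1)] C_sub by force
  then show ?thesis using int_sum_lower[OF assms(2), of 1 "\<lambda>j. int (rt (Fi j y))"] by (simp add: R_def)
qed

lemma R_upper:
  assumes "\<forall>x\<in>X. rt x \<le> M" "y \<in> C" "i \<le> j" shows "R y j - R y i \<le> (j - i) * int M"
proof -
  have "int (rt (Fi k y)) \<le> int M" for k using assms(1) Fi_in[OF assms(2), of k] C_sub by auto
  then show ?thesis using int_sum_upper[OF assms(3), of "\<lambda>j. int (rt (Fi j y))" "int M"] by (simp add: R_def)
qed

definition block :: "(int \<Rightarrow> nat) \<Rightarrow> nat list" where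
  "block x = window x 0 (rt x)"

lemma length_block [simp]: "length (block x) = rt x"
  by (simp add: block_def window_def)

lemma loc_const_block: "loc_const X block"
  unfolding loc_const_def
proof
  fix w
  have "{x \<in> X. block x = w} = {x \<in> X. (rt x, window x 0 (length w)) = (length w, w)}"
    using length_block by (auto simp: block_def window_def)
  then show "openin (top_of_set X) {x \<in> X. block x = w}"
    using loc_const_pair[OF loc_const_rt loc_const_window[of X 0 "length w"]]
    by (simp only: loc_const_def)
qed

text \<open>Agreement of \<open>2 * N + 1\<close> consecutive blocks. A block records a return time
  along with its letters, so equivalent points also visit \<open>C\<close> at the same times in this
  range.\<close>

definition eqv :: "nat \<Rightarrow> (int \<Rightarrow> nat) \<Rightarrow> (int \<Rightarrow> nat) \<Rightarrow> bool" where
  "eqv N x y \<longleftrightarrow> (\<forall>i. \<bar>i\<bar> \<le> int N \<longrightarrow> block (Fi i x) = block (Fi i y))"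

lemma eqv_refl [simp]: "eqv N x x" and eqv_sym: "eqv N x y \<Longrightarrow> eqv N y x"
  and eqv_trans: "eqv N x y \<Longrightarrow> eqv N y z \<Longrightarrow> eqv N x z"
  and eqv_mono: "eqv N x y \<Longrightarrow> M \<le> N \<Longrightarrow> eqv M x y"
  by (auto simp: eqv_def)

text \<open>The range extends to \<open>int N + 1\<close> because block number \<open>N\<close> ends
  at that visit.\<close>

lemma eqv_R:
  assumes "eqv N x y" "- int N \<le> i" "i \<le> int N + 1"
  shows "R x i = R y i"
  unfolding R_def
proof (rule int_sum_cong)
  fix j assume "min 0 i \<le> j" "j < max 0 i"
  then have "\<bar>j\<bar> \<le> int N" using assms(2,3) by linarith
  then have "block (Fi j x) = block (Fi j y)" using assms(1) by (simp add: eqv_def)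
  then show "int (rt (Fi j x)) = int (rt (Fi j y))" by (metis length_block)
qed

lemma eqv_agree:
  assumes xy: "x \<in> C" "y \<in> C" "eqv N x y"
  shows "\<forall>j. R x (- int N) \<le> j \<and> j < R x (int N + 1) \<longrightarrow> x j = y j"
proof -
  have X: "x \<in> X" "y \<in> X" using xy C_sub by auto
  have "m \<le> int N + 1 \<longrightarrow> (\<forall>j. R x (- int N) \<le> j \<and> j < R x m \<longrightarrow> x j = y j)" if "- int N \<le> m" for m
    using that
  proof (induction m rule: int_ge_induct)
    case base
    then show ?case by simp
  next
    case (step i)
    show ?case
    proof (intro impI allI)
      fix j assume i: "i + 1 \<le> int N + 1" and j: "R x (- int N) \<le> j \<and> j < R x (i + 1)"
      show "x j = y j"
      proof (cases "j < R x i")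
        case True
        then show ?thesis using step.IH i j by simp
      next
        case False
        have b: "block (Fi i x) = block (Fi i y)" using xy(3) i step.hyps by (simp add: eqv_def)
        then have "rt (Fi i x) = rt (Fi i y)" by (metis length_block)
        with b have "window (Fi i x) 0 (rt (Fi i x)) = window (Fi i y) 0 (rt (Fi i x))" by (simp add: block_def)
        moreover have "0 \<le> j - R x i \<and> j - R x i < 0 + int (rt (Fi i x))" using False j R_Suc[of x i] by simp
        ultimately have "Fi i x (j - R x i) = Fi i y (j - R x i)" unfolding window_eq_iff by blast
        moreover have "R x i = R y i" using eqv_R[OF xy(3), of i] i step.hyps by simp
        ultimately show ?thesis using Fi_eq[OF xy(1), of i] Fi_eq[OF xy(2), of i] It_shift X by simp
      qed
    qed
  qed
  from this[of "int N + 1"] show ?thesis by simp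
qed

text \<open>Converse of \<open>eqv_agree\<close> with a loss of \<open>c\<close> blocks on each
  side: membership in \<open>C\<close> and the return time are decided by a window of radius
  \<open>c\<close>, so near the ends of the known stretch visits cannot yet be recognised.\<close>

lemma agree_eqv:
  "\<exists>c. \<forall>N. \<forall>y\<in>C. \<forall>z\<in>X. (\<forall>j. R y (- int (N + c)) \<le> j \<and> j < R y (int (N + c) + 1) \<longrightarrow> y j = z j)
    \<longrightarrow> z \<in> C \<and> eqv N y z"
proof -
  have "loc_const X (\<lambda>x. x \<in> C)"
    unfolding loc_const_def
  proof
    fix b
    show "openin (top_of_set X) {x \<in> X. (x \<in> C) = b}"
      using open_visit[of 0] open_no_visit[of 0] by (cases b) simp_all
  qed
  then have "loc_const X (\<lambda>x. (x \<in> C, rt x))" by (intro loc_const_pair loc_const_rt)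
  from loc_const_uniform[OF cpt this] obtain c :: nat where
    c: "\<And>x y. x \<in> X \<Longrightarrow> y \<in> X \<Longrightarrow> (\<And>i. - int c \<le> i \<Longrightarrow> i < int c \<Longrightarrow> x i = y i) \<Longrightarrow> (x \<in> C, rt x) = (y \<in> C, rt y)"
    by blast
  show ?thesis
  proof (intro exI[of _ c] allI ballI impI)
    fix N y z
    assume y: "y \<in> C" and z: "z \<in> X"
      and ag: "\<forall>j. R y (- int (N + c)) \<le> j \<and> j < R y (int (N + c) + 1) \<longrightarrow> y j = z j"
    have yX: "y \<in> X" using y C_sub by blast
    \<comment> \<open>Blocks have length at least 1, so \<open>c\<close> additional blocks supply
      \<open>c\<close> additional coordinates on either side.\<close>
    have l: "R y (- int (N + c)) \<le> R y (- int N) - int c" using R_lower[OF y, of "- int (N + c)" "- int N"] by simp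
    have u: "R y (int N + 1) + int c \<le> R y (int (N + c) + 1)" using R_lower[OF y, of "int N + 1" "int (N + c) + 1"] by simp
    have same: "(It t y \<in> C, rt (It t y)) = (It t z \<in> C, rt (It t z))"
      if t: "R y (- int N) \<le> t" "t \<le> R y (int N + 1)" for t
    proof (rule c)
      fix i assume i: "- int c \<le> i" "i < int c"
      then have "y (i + t) = z (i + t)" using ag l u t by (intro ag[rule_format]) linarith
      then show "It t y i = It t z i" using It_shift yX z by simp
    qed (simp_all add: It_in yX z)
    have Rmono: "R y i \<le> R y j" if "i \<le> j" for i j using R_lower[OF y that] that by linarith
    have zC: "z \<in> C" using same[of 0] Rmono[of "- int N" 0] Rmono[of 0 "int N + 1"] y by simp
    have same': "It (R y i) z \<in> C \<and> rt (It (R y i) z) = rt (Fi i y)" if "- int N \<le> i" "i \<le> int N + 1" for i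
      using same[of "R y i"] Rmono[OF that(1)] Rmono[OF that(2)] Fi_eq[OF y, of i] Fi_in[OF y, of i] by simp
    have ret: "fr (It (R y i) z) = It (R y (i + 1)) z" if "- int N \<le> i" "i \<le> int N" for i
      using same'[of i] that R_Suc[of y i] It_add[OF z, of "int (rt (Fi i y))" "R y i"] by (simp add: fr_eq add.commute)
    have up: "i \<le> int N + 1 \<longrightarrow> Fi i z = It (R y i) z" if "0 \<le> i" for i
      using that
    proof (induction i rule: int_ge_induct)
      case base
      then show ?case by simp
    next
      case (step i)
      then show ?case using ret[of i] Fi_Suc[OF zC, of i] by simp
    qed
    \<comment> \<open>Backwards the visits of \<open>z\<close> are identified through injectivity of
      the first return map, as only forward returns are computed by \<open>ret\<close>.\<close>
    have dn: "- int N \<le> i \<longrightarrow> Fi i z = It (R y i) z" if "i \<le> 0" for i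
      using that
    proof (induction i rule: int_le_induct)
      case base
      then show ?case by simp
    next
      case (step i)
      show ?case
      proof
        assume i: "- int N \<le> i - 1"
        have "fr (It (R y (i - 1)) z) = It (R y i) z"
          using ret[of "i - 1"] i step.hyps by simp
        also have "\<dots> = fr (Fi (i - 1) z)" using step.IH i Fi_Suc[OF zC, of "i - 1"] by simp
        finally have "fr (Fi (i - 1) z) = fr (It (R y (i - 1)) z)" by simp
        moreover have "It (R y (i - 1)) z \<in> C" using same'[of "i - 1"] i step.hyps by simp
        ultimately show "Fi (i - 1) z = It (R y (i - 1)) z"
          using bij_fr Fi_in[OF zC] by (auto simp: bij_betw_def dest: inj_onD)
      qed
    qed
    have "block (Fi i y) = block (Fi i z)" if i: "\<bar>i\<bar> \<le> int N" for i
    proof -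
      have Fz: "Fi i z = It (R y i) z" using up[of i] dn[of i] i by (cases "0 \<le> i") auto
      have rt: "rt (Fi i z) = rt (Fi i y)" unfolding Fz using same'[of i] i by simp
      have "window (Fi i y) 0 (rt (Fi i y)) = window (Fi i z) 0 (rt (Fi i y))"
        unfolding window_eq_iff
      proof (intro allI impI)
        fix j assume j: "0 \<le> j \<and> j < 0 + int (rt (Fi i y))"
        have "R y (- int N) \<le> R y i" "R y (i + 1) \<le> R y (int N + 1)" using i by (intro Rmono; simp)+
        then have "y (j + R y i) = z (j + R y i)"
          using ag l u j R_Suc[of y i] by (intro ag[rule_format]) linarith
        then show "Fi i y j = Fi i z j" unfolding Fz Fi_eq[OF y] using It_shift yX z by simp
      qed
      then show ?thesis by (simp add: block_def rt)
    qed
    then show "z \<in> C \<and> eqv N y z" using zC by (simp add: eqv_def)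
  qed
qed

text \<open>The cylinder is given by the word of \<open>y\<close> between its visits number
  \<open>-(N + c)\<close> and \<open>N + c + 1\<close>. Points of the finer class share this word,
  and sharing it forces the coarser equivalence.\<close>

lemma cylinder_between:
  "\<exists>c. \<forall>N. \<forall>y\<in>C. \<exists>E. cylinder X E \<and> {z \<in> C. eqv (N + c) y z} \<subseteq> E \<and> E \<subseteq> {z \<in> C. eqv N y z}"
proof -
  obtain c where c: "\<And>N y z. y \<in> C \<Longrightarrow> z \<in> X \<Longrightarrow>
    (\<forall>j. R y (- int (N + c)) \<le> j \<and> j < R y (int (N + c) + 1) \<longrightarrow> y j = z j) \<Longrightarrow> z \<in> C \<and> eqv N y z"
    using agree_eqv by blast
  show ?thesis
  proof (intro exI[of _ c] allI ballI)
    fix N y assume y: "y \<in> C"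
    define k where "k = R y (- int (N + c))"
    define n where "n = nat (R y (int (N + c) + 1) - k)"
    define E where "E = {z \<in> X. window z k n = window y k n}"
    have "2 * int (N + c) + 1 \<le> R y (int (N + c) + 1) - k"
      unfolding k_def using R_lower[OF y, of "- int (N + c)" "int (N + c) + 1"] by simp
    then have n: "n > 0" "k + int n = R y (int (N + c) + 1)" by (auto simp: n_def)
    have E: "z \<in> E \<longleftrightarrow> z \<in> X \<and> (\<forall>j. R y (- int (N + c)) \<le> j \<and> j < R y (int (N + c) + 1) \<longrightarrow> y j = z j)" for z
      unfolding E_def mem_Collect_eq window_eq_iff n(2) unfolding k_def by metis
    have "cylinder X E"
      unfolding cylinder_def
    proof (intro conjI exI)
      show "E \<noteq> {}" using E[of y] y C_sub by auto
      show "window y k n \<noteq> []" using n by (simp add: window_def)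
      show "E = {x \<in> X. map (\<lambda>i. x (k + int i)) [0..<length (window y k n)] = window y k n}"
        by (simp add: E_def window_def)
    qed
    moreover have "{z \<in> C. eqv (N + c) y z} \<subseteq> E"
      using E eqv_agree[OF y, of _ "N + c"] C_sub by auto
    moreover have "E \<subseteq> {z \<in> C. eqv N y z}" using E c[OF y] by blast
    ultimately show "\<exists>E. cylinder X E \<and> {z \<in> C. eqv (N + c) y z} \<subseteq> E \<and> E \<subseteq> {z \<in> C. eqv N y z}" by blast
  qed
qed

text \<open>Bounded return times confine the blocks that decide a class to a window of length linear
  in \<open>N\<close>, so inequivalent points yield distinct words of that length.\<close>

lemma eqv_classes_linear:
  assumes words: "\<And>n. finite ((\<lambda>x. window x 0 n) ` X) \<and> card ((\<lambda>x. window x 0 n) ` X) \<le> n * d + 1"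
  shows "\<exists>A B. \<forall>N F. F \<subseteq> C \<longrightarrow> (\<forall>x\<in>F. \<forall>y\<in>F. x \<noteq> y \<longrightarrow> \<not> eqv N x y) \<longrightarrow> card F \<le> A * N + B"
proof -
  obtain c where c: "\<And>N y z. y \<in> C \<Longrightarrow> z \<in> X \<Longrightarrow>
    (\<forall>j. R y (- int (N + c)) \<le> j \<and> j < R y (int (N + c) + 1) \<longrightarrow> y j = z j) \<Longrightarrow> z \<in> C \<and> eqv N y z"
    using agree_eqv by blast
  obtain M where M: "\<forall>x\<in>X. rt x \<le> M" using rt_bounded by blast
  show ?thesis
  proof (intro exI allI impI)
    fix N F assume F: "F \<subseteq> C" "\<forall>x\<in>F. \<forall>y\<in>F. x \<noteq> y \<longrightarrow> \<not> eqv N x y"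
    \<comment> \<open>Visits number \<open>-(N + c)\<close> and \<open>N + c + 1\<close> occur
      within \<open>K\<close> time steps of 0, since each return takes at most
      \<open>M\<close>.\<close>
    define K where "K = (N + c + 1) * M"
    \<comment> \<open>Shifting by \<open>K\<close> moves the symmetric window to start at 0, where
      words are counted.\<close>
    let ?w = "\<lambda>x. window (It (- int K) x) 0 (2 * K)"
    have FX: "F \<subseteq> X" using F C_sub by auto
    have "inj_on ?w F"
    proof (rule inj_onI)
      fix x y assume xy: "x \<in> F" "y \<in> F" "?w x = ?w y"
      have X: "x \<in> X" "y \<in> X" "x \<in> C" using xy F C_sub by auto
      have "\<forall>j. R x (- int (N + c)) \<le> j \<and> j < R x (int (N + c) + 1) \<longrightarrow> x j = y j"
      proof (intro allI impI)
        fix j assume j: "R x (- int (N + c)) \<le> j \<and> j < R x (int (N + c) + 1)"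
        have "R x 0 - R x (- int (N + c)) \<le> int (N + c) * int M"
          using R_upper[OF M X(3), of "- int (N + c)" 0] by (simp add: add.commute)
        moreover have "int (N + c) * int M \<le> int K" by (simp add: K_def algebra_simps)
        moreover have "R x (int (N + c) + 1) - R x 0 \<le> int K"
          using R_upper[OF M X(3), of 0 "int (N + c) + 1"] by (simp add: K_def algebra_simps)
        ultimately have "0 \<le> j + int K \<and> j + int K < 0 + int (2 * K)" using j by simp
        then have "It (- int K) x (j + int K) = It (- int K) y (j + int K)"
          using xy(3) unfolding window_eq_iff by blast
        then show "x j = y j" using It_shift X by simp
      qed
      then have "eqv N x y" using c X by blast
      then show "x = y" using F(2) xy by blast
    qed
    moreover have "?w ` F \<subseteq> (\<lambda>x. window x 0 (2 * K)) ` X" using FX It_in by auto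
    ultimately have "card F \<le> card ((\<lambda>x. window x 0 (2 * K)) ` X)"
      using words card_inj_on_le by blast
    also have "\<dots> \<le> 2 * K * d + 1" using words by blast
    also have "\<dots> = (2 * M * d) * N + (2 * M * d * (c + 1) + 1)" by (simp add: K_def algebra_simps)
    finally show "card F \<le> (2 * M * d) * N + (2 * M * d * (c + 1) + 1)" .
  qed
qed

text \<open>Otherwise every class would split at each of the levels \<open>c, 2c, 3c, \<dots>\<close>, and the number of
  classes would grow exponentially.\<close>

lemma exists_stable_class:
  assumes words: "\<And>n. finite ((\<lambda>x. window x 0 n) ` X) \<and> card ((\<lambda>x. window x 0 n) ` X) \<le> n * d + 1"
    and ne: "C \<noteq> {}"
  shows "\<exists>N. \<exists>x\<in>C. \<forall>y\<in>C. eqv N x y \<longrightarrow> eqv (N + c) x y"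
proof (rule ccontr)
  assume "\<not> ?thesis"
  then have "\<forall>N. \<forall>x\<in>C. \<exists>y\<in>C. eqv N x y \<and> \<not> eqv (N + c) x y" by blast
  then obtain g where g: "\<And>N x. x \<in> C \<Longrightarrow> g N x \<in> C \<and> eqv N x (g N x) \<and> \<not> eqv (N + c) x (g N x)" by metis
  have grow: "\<exists>F\<subseteq>C. finite F \<and> card F = 2 ^ k \<and> (\<forall>x\<in>F. \<forall>y\<in>F. x \<noteq> y \<longrightarrow> \<not> eqv (k * c) x y)" for k
  proof (induction k)
    case 0
    obtain x where "x \<in> C" using ne by blast
    then show ?case by (intro exI[of _ "{x}"]) simp
  next
    case (Suc k)
    then obtain F where F: "F \<subseteq> C" "finite F" "card F = 2 ^ k"
      and sep: "\<And>x y. x \<in> F \<Longrightarrow> y \<in> F \<Longrightarrow> eqv (k * c) x y \<Longrightarrow> x = y" by blast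
    \<comment> \<open>Every representative is kept and gains a companion, equivalent to it at level
      \<open>k * c\<close> but not at level \<open>Suc k * c\<close>; companions of different
      representatives remain separated already at level \<open>k * c\<close>.\<close>
    let ?g = "g (k * c)"
    have gF: "?g x \<in> C" "eqv (k * c) x (?g x)" "\<not> eqv (Suc k * c) x (?g x)" if "x \<in> F" for x
      using g[of x "k * c"] F(1) that by (auto simp: add.commute)
    have down: "eqv (k * c) x y" if "eqv (Suc k * c) x y" for x y
      using that by (rule eqv_mono) simp
    have inj: "inj_on ?g F"
    proof (rule inj_onI)
      fix x y assume xy: "x \<in> F" "y \<in> F" "?g x = ?g y"
      have "eqv (k * c) x y" using gF(2)[OF xy(1)] eqv_sym[OF gF(2)[OF xy(2)]] xy(3) eqv_trans by metis
      then show "x = y" using sep xy by blast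
    qed
    have cross: False if xy: "x \<in> F" "y \<in> F" "eqv (Suc k * c) x (?g y)" for x y
    proof -
      have "eqv (k * c) x y" using down[OF xy(3)] eqv_sym[OF gF(2)[OF xy(2)]] by (rule eqv_trans)
      then have "x = y" using sep xy by blast
      then show False using gF(3)[OF xy(1)] xy(3) by simp
    qed
    have disj: "F \<inter> ?g ` F = {}"
    proof (rule ccontr)
      assume "F \<inter> ?g ` F \<noteq> {}"
      then obtain x y where "x \<in> F" "y \<in> F" "x = ?g y" by blast
      then show False using cross[of x y] by simp
    qed
    have "card (F \<union> ?g ` F) = 2 ^ Suc k"
      using F disj by (simp add: card_Un_disjoint card_image[OF inj])
    moreover have "x = y" if xy: "x \<in> F \<union> ?g ` F" "y \<in> F \<union> ?g ` F" "eqv (Suc k * c) x y" for x y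
    proof -
      consider "x \<in> F" "y \<in> F" | y' where "x \<in> F" "y' \<in> F" "y = ?g y'"
        | x' where "x' \<in> F" "y \<in> F" "x = ?g x'" | x' y' where "x' \<in> F" "y' \<in> F" "x = ?g x'" "y = ?g y'"
        using xy by blast
      then show ?thesis
      proof cases
        case 1
        then show ?thesis using sep down xy(3) by blast
      next
        case 2
        then show ?thesis using cross xy(3) by blast
      next
        case 3
        then show ?thesis using cross eqv_sym[OF xy(3)] by blast
      next
        case 4
        have "eqv (k * c) x' y" using gF(2)[OF 4(1)] down[OF xy(3)] unfolding 4(3) by (rule eqv_trans)
        then have "eqv (k * c) x' y'" using eqv_sym[OF gF(2)[OF 4(2)]] unfolding 4(4) by (rule eqv_trans)
        then show ?thesis using sep 4 by blast
      qed
    qed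
    moreover have "F \<union> ?g ` F \<subseteq> C" using F gF by auto
    ultimately show ?case using F(2) by (intro exI[of _ "F \<union> ?g ` F"]) auto
  qed
  obtain A B where AB: "\<And>N F. F \<subseteq> C \<Longrightarrow> (\<forall>x\<in>F. \<forall>y\<in>F. x \<noteq> y \<longrightarrow> \<not> eqv N x y) \<Longrightarrow> card F \<le> A * N + B"
    using eqv_classes_linear[OF words] by blast
  have le: "2 ^ k \<le> A * (k * c) + B" for k using grow[of k] AB by metis
  \<comment> \<open>At \<open>k = 2 * m\<close> the lower bound \<open>2 ^ k\<close> is the square
    of \<open>2 ^ m\<close> and exceeds \<open>m * m\<close>, while this \<open>m\<close> is large
    enough for \<open>m * m\<close> to dominate the linear bound.\<close>
  define m where "m = 2 * (A * c) + B + 1"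
  have "m * m < 2 ^ m * 2 ^ m" by (intro mult_strict_mono less_exp) (auto simp: m_def)
  also have "\<dots> = 2 ^ (2 * m)" by (simp add: mult_2 power_add)
  also have "\<dots> \<le> A * (2 * m * c) + B" by (rule le)
  also have "\<dots> \<le> (2 * (A * c)) * m + (B + 1) * m" by (simp add: m_def algebra_simps)
  also have "\<dots> = m * m" by (simp add: m_def algebra_simps)
  finally show False by simp
qed

end

section \<open>From clopen sections to cylinders\<close>

text \<open>A conjugacy of induced maps is a sliding block code between sequences of return blocks:
  one image block depends on finitely many source blocks around it, and commuting with the returns
  transfers this bound to every position.\<close>

lemma conj_sections_eqv:
  assumes "conj_sections X shift C Y shift D \<psi> \<psi>'"
  shows "\<exists>c. \<forall>N. \<forall>x\<in>C. \<forall>y\<in>C. subshift_section.eqv C (N + c) x y \<longrightarrow> subshift_section.eqv D N (\<psi> x) (\<psi> y)"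
proof -
  interpret P: conj_sections X shift C Y shift D \<psi> \<psi>' by fact
  interpret A: subshift_section X C by (intro subshift_section.intro P.A.clopen_section_axioms)
  interpret B: subshift_section Y D by (intro subshift_section.intro P.B.clopen_section_axioms)
  have "compact C" using P.A.clC P.A.cpt closedin_compact by blast
  moreover have "loc_const C (\<lambda>x. B.block (\<psi> x))"
    using homeomorphism_cont1[OF P.conj_homeo] P.psi_in(2) by (intro loc_const_compose[OF B.loc_const_block]) auto
  ultimately have "\<exists>c::nat. \<forall>x\<in>C. \<forall>y\<in>C. (\<forall>i. - int c \<le> i \<and> i < int c \<longrightarrow> x i = y i)
      \<longrightarrow> B.block (\<psi> x) = B.block (\<psi> y)"
    by (rule loc_const_uniform)
  then obtain c :: nat where
    c: "\<And>x y. x \<in> C \<Longrightarrow> y \<in> C \<Longrightarrow> (\<forall>i. - int c \<le> i \<and> i < int c \<longrightarrow> x i = y i) \<Longrightarrow> B.block (\<psi> x) = B.block (\<psi> y)"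
    by blast
  have c': "B.block (\<psi> x) = B.block (\<psi> y)" if xy: "x \<in> C" "y \<in> C" "A.eqv c x y" for x y
  proof (rule c[OF xy(1,2)])
    \<comment> \<open>The window of \<open>c\<close> coordinates on each side is covered by
      \<open>c\<close> return blocks on each side, again because blocks are non-empty.\<close>
    have "A.R x (- int c) \<le> - int c" "int c \<le> A.R x (int c + 1)"
      using A.R_lower[OF xy(1), of "- int c" 0] A.R_lower[OF xy(1), of 0 "int c + 1"] by auto
    then show "\<forall>i. - int c \<le> i \<and> i < int c \<longrightarrow> x i = y i"
      using A.eqv_agree[OF xy] by auto
  qed
  have Fi: "\<psi> (A.Fi i x) = B.Fi i (\<psi> x)" if x: "x \<in> C" for i x
  proof (induction i rule: int_induct[where k = 0])
    case base
    then show ?case by simp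
  next
    case (step1 i)
    then show ?case
      using A.Fi_Suc[OF x, of i] B.Fi_Suc[OF P.psi_in(1)[OF x], of i] P.conj_eq[OF A.Fi_in[OF x, of i]] by simp
  next
    case (step2 i)
    have "first_return shift D (\<psi> (A.Fi (i - 1) x)) = first_return shift D (B.Fi (i - 1) (\<psi> x))"
      using step2 A.Fi_Suc[OF x, of "i - 1"] B.Fi_Suc[OF P.psi_in(1)[OF x], of "i - 1"]
        P.conj_eq[OF A.Fi_in[OF x, of "i - 1"]] by simp
    then show ?case
      using inj_onD[OF bij_betw_imp_inj_on[OF P.B.bij_fr]] P.psi_in(1)[OF A.Fi_in[OF x]]
        B.Fi_in[OF P.psi_in(1)[OF x]] by blast
  qed
  show ?thesis
  proof (intro exI[of _ c] allI ballI impI)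
    fix N x y assume xy: "x \<in> C" "y \<in> C" "A.eqv (N + c) x y"
    have "B.block (\<psi> (A.Fi i x)) = B.block (\<psi> (A.Fi i y))" if i: "\<bar>i\<bar> \<le> int N" for i
    proof (rule c')
      show "A.eqv c (A.Fi i x) (A.Fi i y)"
        unfolding A.eqv_def
      proof (intro allI impI)
        fix j assume "\<bar>j\<bar> \<le> int c"
        then have "\<bar>j + i\<bar> \<le> int (N + c)" using i by linarith
        then have "A.block (A.Fi (j + i) x) = A.block (A.Fi (j + i) y)" using xy(3) unfolding A.eqv_def by blast
        then show "A.block (A.Fi j (A.Fi i x)) = A.block (A.Fi j (A.Fi i y))"
          by (simp add: A.Fi_add xy(1,2))
      qed
    qed (simp_all add: A.Fi_in xy)
    then show "B.eqv N (\<psi> x) (\<psi> y)" unfolding B.eqv_def by (simp add: Fi xy(1,2))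
  qed
qed

text \<open>A class unchanged from level \<open>N\<close> to the level raised by all four constants
  is squeezed from both sides: by a cylinder of \<open>X\<close> directly, and by a cylinder of
  \<open>Y\<close> after transport.\<close>

lemma conj_sections_cylinders:
  assumes cs: "conj_sections X shift C Y shift D \<psi> \<psi>'" "conj_sections Y shift D X shift C \<psi>' \<psi>"
    and ne: "C \<noteq> {}"
    and words: "\<And>n. finite ((\<lambda>x. window x 0 n) ` X) \<and> card ((\<lambda>x. window x 0 n) ` X) \<le> n * d + 1"
  shows "\<exists>E\<subseteq>C. cylinder X E \<and> cylinder Y (\<psi> ` E)"
proof -
  interpret P: conj_sections X shift C Y shift D \<psi> \<psi>' by fact
  interpret A: subshift_section X C by (intro subshift_section.intro P.A.clopen_section_axioms)
  interpret B: subshift_section Y D by (intro subshift_section.intro P.B.clopen_section_axioms)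
  obtain c1 where c1: "\<And>N x y. x \<in> C \<Longrightarrow> y \<in> C \<Longrightarrow> A.eqv (N + c1) x y \<Longrightarrow> B.eqv N (\<psi> x) (\<psi> y)"
    using conj_sections_eqv[OF cs(1)] by blast
  obtain c2 where c2: "\<And>N x y. x \<in> D \<Longrightarrow> y \<in> D \<Longrightarrow> B.eqv (N + c2) x y \<Longrightarrow> A.eqv N (\<psi>' x) (\<psi>' y)"
    using conj_sections_eqv[OF cs(2)] by blast
  obtain c3 where c3: "\<And>N y. y \<in> C \<Longrightarrow> \<exists>E. cylinder X E \<and> {z \<in> C. A.eqv (N + c3) y z} \<subseteq> E \<and> E \<subseteq> {z \<in> C. A.eqv N y z}"
    using A.cylinder_between by blast
  obtain c4 where c4: "\<And>N y. y \<in> D \<Longrightarrow> \<exists>E. cylinder Y E \<and> {z \<in> D. B.eqv (N + c4) y z} \<subseteq> E \<and> E \<subseteq> {z \<in> D. B.eqv N y z}"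
    using B.cylinder_between by blast
  obtain N x where x: "x \<in> C" and stable: "\<And>y. y \<in> C \<Longrightarrow> A.eqv N x y \<Longrightarrow> A.eqv (N + (c1 + c2 + c3 + c4)) x y"
    using A.exists_stable_class[OF words ne, of "c1 + c2 + c3 + c4"] by blast
  define K where "K = {z \<in> C. A.eqv N x z}"
  obtain E where E: "cylinder X E" "{z \<in> C. A.eqv (N + c3) x z} \<subseteq> E" "E \<subseteq> K"
    using c3[OF x, of N] unfolding K_def by blast
  have "K \<subseteq> E"
  proof
    fix z assume z: "z \<in> K"
    then have "A.eqv (N + c3) x z" using stable[of z] A.eqv_mono[of "N + (c1 + c2 + c3 + c4)" x z "N + c3"] by (simp add: K_def)
    then show "z \<in> E" using E(2) z by (auto simp: K_def)
  qed
  then have KE: "K = E" using E(3) by blast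
  have xD: "\<psi> x \<in> D" using P.psi_in x by blast
  \<comment> \<open>Level \<open>N + c2\<close> is chosen so that pulling back by
    \<open>\<psi>'\<close> costs \<open>c2\<close> and lands in the class of level \<open>N\<close>,
    which is \<open>K\<close>.\<close>
  obtain E' where E': "cylinder Y E'" "{z \<in> D. B.eqv (N + c2 + c4) (\<psi> x) z} \<subseteq> E'" "E' \<subseteq> {z \<in> D. B.eqv (N + c2) (\<psi> x) z}"
    using c4[OF xD, of "N + c2"] by blast
  have "\<psi> ` K \<subseteq> E'"
  proof
    fix w assume "w \<in> \<psi> ` K"
    then obtain z where z: "z \<in> C" "A.eqv N x z" "w = \<psi> z" by (auto simp: K_def)
    \<comment> \<open>Stability enters here: it lifts membership in \<open>K\<close> high enough to
      pay \<open>c1\<close> for \<open>\<psi>\<close> and \<open>c4\<close> for being inside the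
      cylinder.\<close>
    have "A.eqv (N + c2 + c4 + c1) x z"
      using A.eqv_mono[OF stable[OF z(1,2)], of "N + c2 + c4 + c1"] by simp
    then have "B.eqv (N + c2 + c4) (\<psi> x) (\<psi> z)" using c1[OF x z(1)] by blast
    then show "w \<in> E'" using E'(2) P.psi_in(1)[OF z(1)] z(3) by blast
  qed
  moreover have "E' \<subseteq> \<psi> ` K"
  proof
    fix w assume "w \<in> E'"
    then have w: "w \<in> D" "B.eqv (N + c2) (\<psi> x) w" using E'(3) by auto
    have "\<psi>' w \<in> C" "\<psi> (\<psi>' w) = w"
      using homeomorphism_image2[OF P.conj_homeo] homeomorphism_apply2[OF P.conj_homeo] w(1) by auto
    moreover have "A.eqv N x (\<psi>' w)" using c2[OF xD w(1) w(2)] P.psi_in(3)[OF x] by simp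
    ultimately show "w \<in> \<psi> ` K" unfolding K_def by (intro image_eqI[of _ _ "\<psi>' w"]) simp_all
  qed
  ultimately have "\<psi> ` K = E'" by blast
  then show ?thesis using KE E(1) E'(1) by (intro exI[of _ E]) (auto simp: K_def)
qed

lemma cylinder_clopen:
  assumes "cylinder X C"
  shows "openin (top_of_set X) C" "closedin (top_of_set X) C" "C \<noteq> {}"
proof -
  obtain k w where C: "C = {x \<in> X. window x k (length w) = w}"
    using assms unfolding cylinder_def window_def by blast
  note lc = loc_const_openin[OF loc_const_window[of X k "length w"]]
  show "openin (top_of_set X) C" unfolding C using lc[of "\<lambda>v. v = w"] .
  have "X - C = {x \<in> X. window x k (length w) \<noteq> w}" unfolding C by blast
  then have "openin (top_of_set X) (X - C)" using lc[of "\<lambda>v. v \<noteq> w"] by simp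
  moreover have "C \<subseteq> X" unfolding C by blast
  ultimately show "closedin (top_of_set X) C" by (simp add: closedin_def)
  show "C \<noteq> {}" using assms by (simp add: cylinder_def)
qed

lemma cylinder_in_open:
  assumes U: "openin (top_of_set X) U" and x: "x \<in> U"
  obtains C where "cylinder X C" "C \<subseteq> U" "x \<in> C"
proof -
  obtain O' where O': "open O'" "U = X \<inter> O'" using U by (auto simp: openin_open)
  then obtain c :: nat where c: "{y. window y (- int c) (2 * c) = window x (- int c) (2 * c)} \<subseteq> O'"
    using window_subset_open[OF O'(1), of x] x by blast
  \<comment> \<open>One extra coordinate keeps the word non-empty when \<open>c = 0\<close>.\<close>
  define w where "w = window x (- int c) (2 * c + 1)"
  define C where "C = {y \<in> X. window y (- int c) (2 * c + 1) = w}"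
  have "cylinder X C"
    unfolding cylinder_def
  proof (intro conjI exI)
    show "C \<noteq> {}" using x O' by (auto simp: C_def w_def)
    show "w \<noteq> []" by (simp add: w_def window_def)
    show "C = {y \<in> X. map (\<lambda>i. y (- int c + int i)) [0..<length w] = w}"
      unfolding C_def by (simp add: w_def window_def)
  qed
  moreover have "C \<subseteq> U"
  proof
    fix y assume "y \<in> C"
    then have y: "y \<in> X" "window y (- int c) (2 * c + 1) = window x (- int c) (2 * c + 1)"
      by (auto simp: C_def w_def)
    then have "window y (- int c) (2 * c) = window x (- int c) (2 * c)"
      unfolding window_eq_iff by simp
    then show "y \<in> U" using c y(1) O'(2) by blast
  qed
  moreover have "x \<in> C" using x O' by (simp add: C_def w_def)
  ultimately show ?thesis using that by blast
qed

theorem theorem4p9: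
  fixes X Y :: "(int \<Rightarrow> nat) set"
  assumes "interval_exchange_system_ido X" and "minimal_system X shift"
    and "interval_exchange_system_ido Y" and "minimal_system Y shift"
  shows "flow_equivalent X shift Y shift \<longleftrightarrow>
    (\<exists>C D. cylinder X C \<and> cylinder Y D \<and>
       topologically_conjugate C (first_return shift C) D (first_return shift D))"
proof
  note mX = \<open>minimal_system X shift\<close> and mY = \<open>minimal_system Y shift\<close>
  assume "flow_equivalent X shift Y shift"
  then obtain h h' where "homeomorphic_maps (suspension X shift) (suspension Y shift) h h'" "time_changes X shift h"
    using flow_equivalentD[OF minimal_system_homeo[OF mX] minimal_system_homeo[OF mY]] by blast
  then have se: "susp_equiv X shift Y shift h h'"
    by (intro susp_equiv.intro susp_equiv_axioms.intro minimal_system_homeo mX mY)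
  obtain x0 where x0: "x0 \<in> X" using mX by (auto simp: minimal_system_def dyn_system_def)
  obtain U \<psi> \<psi>' where U: "openin (top_of_set X) U" "x0 \<in> U"
    and conj: "\<And>C. C \<subseteq> U \<Longrightarrow> C \<noteq> {} \<Longrightarrow> openin (top_of_set X) C \<Longrightarrow> closedin (top_of_set X) C \<Longrightarrow>
      conj_sections X shift C Y shift (\<psi> ` C) \<psi> \<psi>'"
    by (rule susp_equiv_local_conjugacy[OF se mX mY x0]) (rule that)
  \<comment> \<open>Any cylinder inside \<open>U\<close> serves as the section on which return
    blocks are read; its image need not be a cylinder.\<close>
  obtain C where C: "cylinder X C" "C \<subseteq> U" using cylinder_in_open[OF U] by blast
  note cC = cylinder_clopen[OF C(1)]
  have cs: "conj_sections X shift C Y shift (\<psi> ` C) \<psi> \<psi>'" by (rule conj[OF C(2) cC(3,1,2)])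
  obtain d \<pi> lam where "iet_data d \<pi> lam" "X = iet_encoding d \<pi> lam"
    using assms(1) unfolding interval_exchange_system_ido_def by blast
  then have "finite ((\<lambda>x. window x 0 n) ` X) \<and> card ((\<lambda>x. window x 0 n) ` X) \<le> n * d + 1" for n
    using encoding_words by blast
  from conj_sections_cylinders[OF cs conj_sections_sym[OF cs] cC(3) this]
  obtain E where E: "E \<subseteq> C" "cylinder X E" "cylinder Y (\<psi> ` E)" by blast
  note cE = cylinder_clopen[OF E(2)]
  \<comment> \<open>The same \<open>\<psi>\<close> conjugates the maps induced on the smaller set
    \<open>E\<close>, because the local conjugacy holds for every non-empty clopen subset of
    \<open>U\<close>.\<close>
  have "conj_sections X shift E Y shift (\<psi> ` E) \<psi> \<psi>'"
    by (rule conj[OF order_trans[OF E(1) C(2)] cE(3,1,2)])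
  then have "topologically_conjugate E (first_return shift E) (\<psi> ` E) (first_return shift (\<psi> ` E))"
    unfolding topologically_conjugate_def using conj_sections.conj_homeo conj_sections.conj_eq by blast
  then show "\<exists>C D. cylinder X C \<and> cylinder Y D \<and>
       topologically_conjugate C (first_return shift C) D (first_return shift D)"
    using E by blast
next
  assume "\<exists>C D. cylinder X C \<and> cylinder Y D \<and>
       topologically_conjugate C (first_return shift C) D (first_return shift D)"
  then obtain C D \<psi> \<psi>' where CD: "cylinder X C" "cylinder Y D" and "homeomorphism C D \<psi> \<psi>'"
    "\<And>x. x \<in> C \<Longrightarrow> \<psi> (first_return shift C x) = first_return shift D (\<psi> x)"
    unfolding topologically_conjugate_def by blast
  then have "conj_sections X shift C Y shift D \<psi> \<psi>'"
    by (intro conj_sections.intro conj_sections_axioms.intro minimal_system_section assms cylinder_clopen)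
  then show "flow_equivalent X shift Y shift" by (rule conj_sections_flow_equivalent)
qed

end
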